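(* Let $g$ be a classical simple Lie algebra (of type $A$, $B$, $C$ or $D$) over $\mathbb C$, let $\lambda_0$ be the initial (highest) root, and let $$\mathcal F_{\mathcal E}=\Bigl(\prod_{\lambda'\in\pi'}\exp\bigl\{E_{\lambda'}\otimes E_{\lambda_0-\lambda'}\,e^{-\frac12\sigma_{\lambda_0}}\bigr\}\Bigr)\exp\{H_{\lambda_0}\otimes\sigma_{\lambda_0}\},\qquad\sigma_{\lambda_0}=\ln(1+E_{\lambda_0}),$$ be the maximal canonical extended twist for $U(g)$ with initial root $\lambda_0$. Then the Hopf algebra $U_{\mathcal E}(g)$ obtained from $U(g)$ (with its primitive coproduct) by the twist $\mathcal F_{\mathcal E}$ contains a primitive subalgebra equivalent to the universal enveloping algebra $U(g^{\bot}_{\lambda_0})$, where $g^{\bot}_{\lambda_0}\subset g$ is the subalgebra whose root system consists of the roots orthogonal to $\lambda_0$. That is, there is a Lie subalgebra of $U_{\mathcal E}(g)$ (under the commutator), isomorphic to $g^{\bot}_{\lambda_0}$ and generating a copy of $U(g^{\bot}_{\lambda_0})$, all of whose elements $X$ satisfy $\Delta_{\mathcal E}(X)=X\otimes1+1\otimes X$.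
   Context: Let $\Lambda$ be the root system of $g$. The constituent roots of $\lambda_0$ are the roots in pairs $\{\lambda',\lambda''\}\subset\Lambda$ with $\lambda'+\lambda''=\lambda_0$ and $\lambda'+\lambda_0,\lambda''+\lambda_0\notin\Lambda$. Their set $\pi$ is split as $\pi=\pi'\cup\pi''$, $\pi'=\{\lambda'\}$, $\pi''=\{\lambda''\}$, one root of each pair being chosen in $\pi'$. $E_\lambda$ denotes a root vector of root $\lambda$ and $H_{\lambda_0}$ the Cartan element dual to $\lambda_0$, normalized so that for each $\lambda'\in\pi'$: $[H_{\lambda_0},E_{\lambda_0}]=E_{\lambda_0}$, $[H_{\lambda_0},E_{\lambda'}]=\frac12E_{\lambda'}$, $[H_{\lambda_0},E_{\lambda_0-\lambda'}]=\frac12E_{\lambda_0-\lambda'}$, $[E_{\lambda'},E_{\lambda_0-\lambda'}]=E_{\lambda_0}$. The twisted Hopf algebra $U_{\mathcal E}(g)$ has the multiplication of $U(g)$ and the coproduct $\Delta_{\mathcal E}(a)=\mathcal F_{\mathcal E}\Delta(a)\mathcal F_{\mathcal E}^{-1}$, with $\Delta(x)=x\otimes1+1\otimes x$ for $x\in g$. The subalgebra $g^{\bot}_{\lambda_0}$ is the regular semisimple subalgebra generated by the root vectors of the roots in $\Lambda$ orthogonal to $\lambda_0$ (for $\mathfrak{sl}(n)$ it is $\mathfrak{sl}(n-2)$, for $\mathfrak{so}(n)$ it is $\mathfrak{sl}(2)\oplus\mathfrak{so}(n-4)$, for the rank $n$ symplectic algebra it is the rank $n-1$ symplectic algebra). Formal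 interpretation: logarithms and exponentials are formal power series. One introduces a formal parameter $\xi$ by replacing, in the twist, $E_{\lambda_0}$ by $\xi E_{\lambda_0}$ and $E_{\lambda_0-\lambda'}$ by $\xi E_{\lambda_0-\lambda'}$ for $\lambda'\in\pi'$ (leaving $E_{\lambda'}$ and $H_{\lambda_0}$ unchanged, which preserves the relations above), so that $\mathcal F_{\mathcal E}\in(U(g)\otimes U(g))[[\xi]]$. The twisted Hopf algebra is the corresponding $\xi$-adically completed algebra $U(g)[[\xi]]$ over $\mathbb C[[\xi]]$, and Lie algebras and enveloping algebras are understood over $\mathbb C[[\xi]]$ accordingly. *)

theory Defs
  imports
    Complex_Main
    "HOL-Library.Poly_Mapping"
    "HOL-Library.Function_Algebras"
    "HOL-Computational_Algebra.Formal_Power_Series"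
    "Jordan_Normal_Form.Matrix"
begin

section \<open>Complex vector spaces, algebras and Lie algebras\<close>

class complex_space = ab_group_add +
  fixes scaleC :: "complex \<Rightarrow> 'a \<Rightarrow> 'a" (infixr \<open>*\<^sub>C\<close> 75)
  assumes scaleC_add_right: "c *\<^sub>C (x + y) = c *\<^sub>C x + c *\<^sub>C y"
    and scaleC_add_left: "(c + d) *\<^sub>C x = c *\<^sub>C x + d *\<^sub>C x"
    and scaleC_scaleC: "c *\<^sub>C d *\<^sub>C x = (c * d) *\<^sub>C x"
    and scaleC_one: "1 *\<^sub>C x = x"

class complex_algebra_1 = complex_space + ring_1 +
  assumes scaleC_mult_left: "(c *\<^sub>C x) * y = c *\<^sub>C (x * y)"
    and scaleC_mult_right: "x * (c *\<^sub>C y) = c *\<^sub>C (x * y)"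

class complex_lie_algebra = complex_space +
  fixes lie :: "'a \<Rightarrow> 'a \<Rightarrow> 'a"
  assumes lie_add_left: "lie (x + y) z = lie x z + lie y z"
    and lie_add_right: "lie x (y + z) = lie x y + lie x z"
    and lie_scaleC_left: "lie (c *\<^sub>C x) y = c *\<^sub>C lie x y"
    and lie_scaleC_right: "lie x (c *\<^sub>C y) = c *\<^sub>C lie x y"
    and lie_self: "lie x x = 0"
    and lie_jacobi: "lie x (lie y z) + lie y (lie z x) + lie z (lie x y) = 0"

definition commutator :: "'a \<Rightarrow> 'a \<Rightarrow> 'a::{times,minus}"
  where "commutator x y = x * y - y * x"

text \<open>
  Lie subalgebras and isomorphisms are used over \<open>\<complex>\<close> and over \<open>\<complex>[[\<xi>]]\<close>, so scalar action,
  bracket and carrier are explicit arguments. The type class constraints are minimal because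
  the type of matrices of arbitrary size is not a group.
\<close>

definition lie_subalgebra :: "('r \<Rightarrow> 'v \<Rightarrow> 'v) \<Rightarrow> ('v \<Rightarrow> 'v \<Rightarrow> 'v) \<Rightarrow> 'v::{plus,zero} set \<Rightarrow> bool"
  where "lie_subalgebra scale br L \<longleftrightarrow>
    0 \<in> L \<and> (\<forall>x\<in>L. \<forall>y\<in>L. x + y \<in> L) \<and> (\<forall>c. \<forall>x\<in>L. scale c x \<in> L) \<and>
    (\<forall>x\<in>L. \<forall>y\<in>L. br x y \<in> L)"

definition lie_generated :: "('r \<Rightarrow> 'v \<Rightarrow> 'v) \<Rightarrow> ('v \<Rightarrow> 'v \<Rightarrow> 'v) \<Rightarrow> 'v::{plus,zero} set \<Rightarrow> 'v set"
  where "lie_generated scale br X = \<Inter> {L. lie_subalgebra scale br L \<and> X \<subseteq> L}"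

definition lie_isomorphism ::
  "('r \<Rightarrow> 'v \<Rightarrow> 'v) \<Rightarrow> ('v \<Rightarrow> 'v \<Rightarrow> 'v) \<Rightarrow> 'v::plus set \<Rightarrow>
   ('r \<Rightarrow> 'w \<Rightarrow> 'w) \<Rightarrow> ('w \<Rightarrow> 'w \<Rightarrow> 'w) \<Rightarrow> 'w::plus set \<Rightarrow> ('v \<Rightarrow> 'w) \<Rightarrow> bool"
  where "lie_isomorphism scale br L scale' br' L' f \<longleftrightarrow>
    bij_betw f L L' \<and>
    (\<forall>x\<in>L. \<forall>y\<in>L. f (x + y) = f x + f y) \<and>
    (\<forall>c. \<forall>x\<in>L. f (scale c x) = scale' c (f x)) \<and>
    (\<forall>x\<in>L. \<forall>y\<in>L. f (br x y) = br' (f x) (f y))"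


section \<open>Free algebras and enveloping algebras\<close>

text \<open>Words form a monoid, written additively because the convolution product on finitely
  supported functions (\<^type>\<open>poly_mapping\<close>) uses \<open>+\<close> on the exponents.\<close>

instantiation list :: (type) monoid_add
begin
definition "0 = ([] :: 'a list)"
definition "xs + ys = (xs @ ys :: 'a list)"
instance by standard (auto simp: zero_list_def plus_list_def)
end

text \<open>The free algebra over \<open>'r\<close> on the set \<open>X\<close> is the set of finitely supported functions
  on words with letters in \<open>X\<close>.\<close>

definition free_algebra :: "'v set \<Rightarrow> ('v list \<Rightarrow>\<^sub>0 'r::comm_ring_1) set"
  where "free_algebra X = {p. Poly_Mapping.keys p \<subseteq> lists X}"

definition linear_ext :: "('r \<Rightarrow> 'a \<Rightarrow> 'a) \<Rightarrow> ('k \<Rightarrow> 'a) \<Rightarrow> ('k \<Rightarrow>\<^sub>0 'r::zero) \<Rightarrow> 'a::comm_monoid_add"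
  where "linear_ext scale F p = (\<Sum>k\<in>Poly_Mapping.keys p. scale (Poly_Mapping.lookup p k) (F k))"

definition free_eval :: "('r \<Rightarrow> 'a \<Rightarrow> 'a) \<Rightarrow> ('v \<Rightarrow> 'a) \<Rightarrow> ('v list \<Rightarrow>\<^sub>0 'r::comm_ring_1) \<Rightarrow> 'a::ring_1"
  where "free_eval scale f = linear_ext scale (\<lambda>w. prod_list (map f w))"

text \<open>The two-sided ideal of the subring \<open>A\<close> generated by \<open>R\<close>.\<close>

inductive_set ideal_gen :: "'a::ring_1 set \<Rightarrow> 'a set \<Rightarrow> 'a set" for A R
  where
    ideal_gen_zero: "0 \<in> ideal_gen A R"
  | ideal_gen_step: "x \<in> ideal_gen A R \<Longrightarrow> a \<in> A \<Longrightarrow> b \<in> A \<Longrightarrow> r \<in> R \<Longrightarrow> x + a * r * b \<in> ideal_gen A R"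

definition uea_relations ::
  "('r \<Rightarrow> 'v \<Rightarrow> 'v) \<Rightarrow> ('v \<Rightarrow> 'v \<Rightarrow> 'v) \<Rightarrow> 'v::plus set \<Rightarrow> ('v list \<Rightarrow>\<^sub>0 'r::comm_ring_1) set"
  where "uea_relations scale br L =
    {Poly_Mapping.single [x + y] 1 - Poly_Mapping.single [x] 1 - Poly_Mapping.single [y] 1 | x y.
       x \<in> L \<and> y \<in> L} \<union>
    {Poly_Mapping.single [scale c x] 1 - Poly_Mapping.single [x] c | c x. x \<in> L} \<union>
    {Poly_Mapping.single [x, y] 1 - Poly_Mapping.single [y, x] 1 - Poly_Mapping.single [br x y] 1 | x y.
       x \<in> L \<and> y \<in> L}"

text \<open>The enveloping algebra of the Lie algebra \<open>L\<close> over the commutative ring \<open>'r\<close> is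
  \<open>free_algebra L\<close> modulo the following ideal: the linear relations turn the free algebra on
  the set \<open>L\<close> into the tensor algebra of \<open>L\<close>.\<close>

definition uea_ideal ::
  "('r \<Rightarrow> 'v \<Rightarrow> 'v) \<Rightarrow> ('v \<Rightarrow> 'v \<Rightarrow> 'v) \<Rightarrow> 'v::plus set \<Rightarrow> ('v list \<Rightarrow>\<^sub>0 'r::comm_ring_1) set"
  where "uea_ideal scale br L = ideal_gen (free_algebra L) (uea_relations scale br L)"

text \<open>The algebra homomorphism from the enveloping algebra of \<open>L\<close> extending \<open>f\<close> is well
  defined and injective: the kernel of the extension of \<open>f\<close> to the free algebra is exactly
  the defining ideal. The subalgebra generated by \<open>f ` L\<close> is then a copy of the enveloping
  algebra.\<close>

definition generates_uea_copy ::
  "('r::comm_ring_1 \<Rightarrow> 'v \<Rightarrow> 'v) \<Rightarrow> ('v \<Rightarrow> 'v \<Rightarrow> 'v) \<Rightarrow> 'v::plus set \<Rightarrow>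
   ('r \<Rightarrow> 'a \<Rightarrow> 'a) \<Rightarrow> ('v \<Rightarrow> 'a::ring_1) \<Rightarrow> bool"
  where "generates_uea_copy scale br L scale' f \<longleftrightarrow>
    (\<forall>p \<in> free_algebra L. free_eval scale' f p = 0 \<longleftrightarrow> p \<in> uea_ideal scale br L)"

lemma free_algebra_UNIV [simp]: "free_algebra UNIV = UNIV"
  by (auto simp: free_algebra_def)

lemma ideal_gen_add:
  assumes "x \<in> ideal_gen A R" "y \<in> ideal_gen A R"
  shows "x + y \<in> ideal_gen A R"
  using assms(2)
proof induction
  case (ideal_gen_step y a b r)
  then have "(x + y) + a * r * b \<in> ideal_gen A R"
    by (intro ideal_gen.ideal_gen_step)
  then show ?case by (simp add: add.assoc)
qed (simp add: assms)

lemma ideal_gen_mult: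
  assumes "x \<in> ideal_gen UNIV R"
  shows "c * x * d \<in> ideal_gen UNIV R"
  using assms
proof induction
  case (ideal_gen_step x a b r)
  then have "c * x * d + (c * a) * r * (b * d) \<in> ideal_gen UNIV R"
    by (intro ideal_gen.ideal_gen_step) auto
  then show ?case by (simp add: algebra_simps)
qed (simp add: ideal_gen_zero)

lemma ideal_gen_mult_left: "x \<in> ideal_gen UNIV R \<Longrightarrow> c * x \<in> ideal_gen UNIV R"
  using ideal_gen_mult[of x R c 1] by simp

lemma ideal_gen_mult_right: "x \<in> ideal_gen UNIV R \<Longrightarrow> x * d \<in> ideal_gen UNIV R"
  using ideal_gen_mult[of x R 1 d] by simp

lemma ideal_gen_uminus: "x \<in> ideal_gen UNIV R \<Longrightarrow> - x \<in> ideal_gen UNIV R"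
  using ideal_gen_mult_left[of x R "- 1"] by simp

lemma ideal_gen_diff:
  "x \<in> ideal_gen UNIV R \<Longrightarrow> y \<in> ideal_gen UNIV R \<Longrightarrow> x - y \<in> ideal_gen UNIV R"
  using ideal_gen_add[of x UNIV R "- y"] ideal_gen_uminus[of y R] by simp

lemma ideal_gen_base: "r \<in> R \<Longrightarrow> r \<in> ideal_gen UNIV R"
  using ideal_gen_step[OF ideal_gen_zero, of 1 UNIV 1 r R] by simp

definition ideal_eq :: "'a::ring_1 set \<Rightarrow> 'a \<Rightarrow> 'a \<Rightarrow> bool"
  where "ideal_eq R x y \<longleftrightarrow> x - y \<in> ideal_gen UNIV R"

lemma equivp_ideal_eq: "equivp (ideal_eq R)"
proof (rule equivpI)
  show "reflp (ideal_eq R)" by (simp add: reflp_def ideal_eq_def ideal_gen_zero)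
  show "symp (ideal_eq R)"
  proof (rule sympI)
    fix x y assume "ideal_eq R x y"
    then show "ideal_eq R y x" using ideal_gen_uminus[of "x - y" R] by (simp add: ideal_eq_def)
  qed
  show "transp (ideal_eq R)"
  proof (rule transpI)
    fix x y z assume "ideal_eq R x y" "ideal_eq R y z"
    then show "ideal_eq R x z"
      using ideal_gen_add[of "x - y" UNIV R "y - z"] by (simp add: ideal_eq_def)
  qed
qed

lemma ideal_eq_add: "ideal_eq R x x' \<Longrightarrow> ideal_eq R y y' \<Longrightarrow> ideal_eq R (x + y) (x' + y')"
  unfolding ideal_eq_def using ideal_gen_add[of "x - x'" UNIV R "y - y'"] by (simp add: algebra_simps)

lemma ideal_eq_diff: "ideal_eq R x x' \<Longrightarrow> ideal_eq R y y' \<Longrightarrow> ideal_eq R (x - y) (x' - y')"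
  unfolding ideal_eq_def using ideal_gen_diff[of "x - x'" R "y - y'"] by (simp add: algebra_simps)

lemma ideal_eq_uminus: "ideal_eq R x x' \<Longrightarrow> ideal_eq R (- x) (- x')"
  unfolding ideal_eq_def using ideal_gen_uminus[of "x - x'" R] by (simp add: algebra_simps)

lemma ideal_eq_mult:
  assumes "ideal_eq R x x'" "ideal_eq R y y'"
  shows "ideal_eq R (x * y) (x' * y')"
proof -
  have "(x - x') * y + x' * (y - y') \<in> ideal_gen UNIV R"
    using assms by (intro ideal_gen_add ideal_gen_mult_left ideal_gen_mult_right) (auto simp: ideal_eq_def)
  then show ?thesis by (simp add: ideal_eq_def algebra_simps)
qed

lemma ideal_eq_refl: "ideal_eq R x x"
  by (simp add: ideal_eq_def ideal_gen_zero)

lemma poly_mapping_single_induct [case_names zero single_add]: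
  fixes p :: "'k \<Rightarrow>\<^sub>0 'r::ab_group_add"
  assumes "P 0" and "\<And>p k c. k \<notin> Poly_Mapping.keys p \<Longrightarrow> P p \<Longrightarrow> P (p + Poly_Mapping.single k c)"
  shows "P p"
proof (induction p rule: update_induct)
  case (update f k c)
  have "Poly_Mapping.update k c f = f + Poly_Mapping.single k c"
    using update by (intro poly_mapping_eqI) (auto simp: lookup_update lookup_add lookup_single in_keys_iff when_def)
  then show ?case using assms(2) update by simp
qed (fact assms(1))

context
  fixes scale :: "'r::comm_ring_1 \<Rightarrow> 'a::ab_group_add \<Rightarrow> 'a"
  assumes scale_add_right: "scale c (x + y) = scale c x + scale c y"
    and scale_add_left: "scale (c + d) x = scale c x + scale d x"
begin

lemma scale_zero_left: "scale 0 x = 0"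
  using scale_add_left[of 0 0 x] by simp

lemma linear_ext_zero: "linear_ext scale F 0 = 0"
  by (simp add: linear_ext_def)

lemma linear_ext_single: "linear_ext scale F (Poly_Mapping.single k c) = scale c (F k)"
  by (simp add: linear_ext_def scale_zero_left)

lemma linear_ext_add: "linear_ext scale F (p + q) = linear_ext scale F p + linear_ext scale F q"
  unfolding linear_ext_def
  by (rule setsum_keys_plus_distrib) (simp_all add: scale_zero_left scale_add_left)

lemma linear_ext_uminus: "linear_ext scale F (- p) = - linear_ext scale F p"
  using linear_ext_add[of F "- p" p] by (simp add: linear_ext_zero eq_neg_iff_add_eq_0)

lemma linear_ext_diff: "linear_ext scale F (p - q) = linear_ext scale F p - linear_ext scale F q"
  using linear_ext_add[of F p "- q"] by (simp add: linear_ext_uminus)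

end

lemma linear_ext_mult:
  fixes scale :: "'r::comm_ring_1 \<Rightarrow> 'a::ring_1 \<Rightarrow> 'a" and F :: "'k::monoid_add \<Rightarrow> 'a"
  assumes sr: "\<And>c x y. scale c (x + y) = scale c x + scale c y"
    and sl: "\<And>c d x. scale (c + d) x = scale c x + scale d x"
    and ss: "\<And>c d x y. scale c x * scale d y = scale (c * d) (x * y)"
    and F: "\<And>k l. F (k + l) = F k * F l"
  shows "linear_ext scale F (p * q) = linear_ext scale F p * linear_ext scale F q"
proof (induction p rule: poly_mapping_single_induct)
  case zero
  show ?case by (simp add: linear_ext_zero[OF sr sl])
next
  case (single_add p k c)
  have "linear_ext scale F (Poly_Mapping.single k c * q) = scale c (F k) * linear_ext scale F q"
  proof (induction q rule: poly_mapping_single_induct)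
    case zero
    show ?case by (simp add: linear_ext_zero[OF sr sl])
  next
    case (single_add q l d)
    then show ?case
      by (simp add: distrib_left mult_single linear_ext_add[OF sr sl] linear_ext_single[OF sr sl] ss F)
  qed
  with single_add show ?case
    by (simp add: distrib_right linear_ext_add[OF sr sl] linear_ext_single[OF sr sl])
qed

lemma ideal_gen_kernel:
  assumes "x \<in> ideal_gen A R" and "h 0 = 0"
    and "\<And>x y. h (x + y) = h x + h y" and "\<And>a b r. r \<in> R \<Longrightarrow> h (a * r * b) = 0"
  shows "h x = (0 :: 'b::ab_group_add)"
  using assms(1) by induction (simp_all add: assms)

lemma prod_list_map_plus: "prod_list (map f (v + w)) = prod_list (map f v) * prod_list (map f w)"
  by (simp add: plus_list_def)

lemma prod_list_map_zero: "prod_list (map f 0) = 1"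
  by (simp add: zero_list_def)

lemma free_eval_uea_ideal:
  fixes scale :: "'r::comm_ring_1 \<Rightarrow> 'a::ring_1 \<Rightarrow> 'a"
  assumes sr: "\<And>c x y. scale c (x + y) = scale c x + scale c y"
    and sl: "\<And>c d x. scale (c + d) x = scale c x + scale d x"
    and ss: "\<And>c d x y. scale c x * scale d y = scale (c * d) (x * y)"
    and s1: "\<And>x. scale 1 x = x"
    and f: "\<And>x y. x \<in> L \<Longrightarrow> y \<in> L \<Longrightarrow> f (x + y) = f x + f y"
      "\<And>c x. x \<in> L \<Longrightarrow> f (scl c x) = scale c (f x)"
      "\<And>x y. x \<in> L \<Longrightarrow> y \<in> L \<Longrightarrow> f (br x y) = f x * f y - f y * f x"
    and p: "p \<in> uea_ideal scl br L"
  shows "free_eval scale f p = 0"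
  using p unfolding uea_ideal_def
proof (rule ideal_gen_kernel)
  show "free_eval scale f 0 = 0" by (simp add: free_eval_def linear_ext_zero[OF sr sl])
  show "free_eval scale f (p + q) = free_eval scale f p + free_eval scale f q" for p q
    by (simp add: free_eval_def linear_ext_add[OF sr sl])
  have mult: "free_eval scale f (p * q) = free_eval scale f p * free_eval scale f q" for p q
    unfolding free_eval_def by (rule linear_ext_mult[OF sr sl ss prod_list_map_plus])
  have "free_eval scale f r = 0" if "r \<in> uea_relations scl br L" for r
    using that unfolding uea_relations_def free_eval_def
    by (auto simp: linear_ext_diff[OF sr sl] linear_ext_single[OF sr sl] s1 f)
  then show "free_eval scale f (a * r * b) = 0" if "r \<in> uea_relations scl br L" for a b r
    using that by (simp add: mult)
qed

lemma single_zero_central: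
  fixes p :: "'k::monoid_add \<Rightarrow>\<^sub>0 'r::comm_ring_1"
  shows "p * Poly_Mapping.single 0 c = Poly_Mapping.single 0 c * p"
  by (induction p rule: poly_mapping_single_induct)
    (simp_all add: distrib_left distrib_right mult_single mult.commute)

text \<open>The universal enveloping algebra \<open>U(g)\<close> of a Lie algebra \<open>g\<close> given as a type.\<close>

quotient_type (overloaded) 'g uea =
  "('g::complex_lie_algebra) list \<Rightarrow>\<^sub>0 complex" / "ideal_eq (uea_relations scaleC lie UNIV)"
  by (rule equivp_ideal_eq)

lemma ideal_eq_uea_iff:
  "ideal_eq (uea_relations scaleC lie UNIV) p q \<longleftrightarrow> p - q \<in> uea_ideal scaleC lie UNIV"
  by (simp add: ideal_eq_def uea_ideal_def)

instantiation uea :: (complex_lie_algebra) complex_algebra_1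
begin
lift_definition zero_uea :: "'a uea" is 0 .
lift_definition one_uea :: "'a uea" is 1 .
lift_definition plus_uea :: "'a uea \<Rightarrow> 'a uea \<Rightarrow> 'a uea" is "(+)" by (rule ideal_eq_add)
lift_definition minus_uea :: "'a uea \<Rightarrow> 'a uea \<Rightarrow> 'a uea" is "(-)" by (rule ideal_eq_diff)
lift_definition uminus_uea :: "'a uea \<Rightarrow> 'a uea" is uminus by (rule ideal_eq_uminus)
lift_definition times_uea :: "'a uea \<Rightarrow> 'a uea \<Rightarrow> 'a uea" is "(*)" by (rule ideal_eq_mult)
lift_definition scaleC_uea :: "complex \<Rightarrow> 'a uea \<Rightarrow> 'a uea"
  is "\<lambda>c p. Poly_Mapping.single 0 c * p" by (rule ideal_eq_mult[OF ideal_eq_refl])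
instance
proof
  fix x y z :: "'a uea" and c d :: complex
  let ?s = "Poly_Mapping.single (0 :: 'a list) :: complex \<Rightarrow> _"
  show "x + y + z = x + (y + z)" by transfer (simp add: add.assoc ideal_eq_refl)
  show "x + y = y + x" by transfer (simp add: add.commute ideal_eq_refl)
  show "0 + x = x" by transfer (simp add: ideal_eq_refl)
  show "- x + x = 0" by transfer (simp add: ideal_eq_refl)
  show "x - y = x + - y" by transfer (simp add: ideal_eq_refl)
  show "x * y * z = x * (y * z)" by transfer (simp add: mult.assoc ideal_eq_refl)
  show "1 * x = x" by transfer (simp add: ideal_eq_refl)
  show "x * 1 = x" by transfer (simp add: ideal_eq_refl)
  show "(x + y) * z = x * z + y * z" by transfer (simp add: distrib_right ideal_eq_refl)
  show "x * (y + z) = x * y + x * z" by transfer (simp add: distrib_left ideal_eq_refl)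
  show "c *\<^sub>C (x + y) = c *\<^sub>C x + c *\<^sub>C y" by transfer (simp add: distrib_left ideal_eq_refl)
  show "(c + d) *\<^sub>C x = c *\<^sub>C x + d *\<^sub>C x"
    by transfer (simp add: distrib_right single_add ideal_eq_refl)
  show "c *\<^sub>C d *\<^sub>C x = (c * d) *\<^sub>C x"
    by transfer (simp add: mult.assoc[symmetric] mult_single ideal_eq_refl)
  show "1 *\<^sub>C x = x" by transfer (simp add: ideal_eq_refl)
  show "(c *\<^sub>C x) * y = c *\<^sub>C (x * y)" by transfer (simp add: mult.assoc ideal_eq_refl)
  show "x * (c *\<^sub>C y) = c *\<^sub>C (x * y)"
  proof transfer
    fix p q :: "'a list \<Rightarrow>\<^sub>0 complex" and c
    have "p * (Poly_Mapping.single 0 c * q) = Poly_Mapping.single 0 c * (p * q)"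
      by (simp add: mult.assoc[symmetric] single_zero_central)
    then show "ideal_eq (uea_relations scaleC lie UNIV)
      (p * (Poly_Mapping.single 0 c * q)) (Poly_Mapping.single 0 c * (p * q))"
      by (simp add: ideal_eq_refl)
  qed
  show "(0 :: 'a uea) \<noteq> 1"
  proof transfer
    show "\<not> ideal_eq (uea_relations scaleC lie UNIV) (0 :: 'a list \<Rightarrow>\<^sub>0 complex) 1"
    proof
      let ?e = "free_eval (*) (\<lambda>_. 0) :: ('a list \<Rightarrow>\<^sub>0 complex) \<Rightarrow> complex"
      assume "ideal_eq (uea_relations scaleC lie UNIV) (0 :: 'a list \<Rightarrow>\<^sub>0 complex) 1"
      then have "?e (0 - 1) = 0"
        unfolding ideal_eq_uea_iff
        by (intro free_eval_uea_ideal[of _ UNIV _ scaleC lie]) (simp_all add: distrib_left distrib_right)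
      moreover have "?e 1 = 1"
        using linear_ext_single[of "(*) :: complex \<Rightarrow> _" "\<lambda>w. prod_list (map (\<lambda>_. 0) w)" "0 :: 'a list" 1]
        by (simp add: free_eval_def distrib_left distrib_right prod_list_map_zero)
      moreover have "?e (0 - 1) = - ?e 1"
        unfolding free_eval_def
        by (simp add: linear_ext_uminus distrib_left distrib_right)
      ultimately show False by simp
    qed
  qed
qed
end


lift_definition uea_inj :: "'g \<Rightarrow> 'g::complex_lie_algebra uea" is "\<lambda>x. Poly_Mapping.single [x] 1" .

lemma uea_inj_add: "uea_inj (x + y) = uea_inj x + uea_inj y"
proof transfer
  fix x y :: 'a
  have "Poly_Mapping.single [x + y] 1 - Poly_Mapping.single [x] 1 - Poly_Mapping.single [y] 1
      \<in> ideal_gen UNIV (uea_relations scaleC lie UNIV :: ('a list \<Rightarrow>\<^sub>0 complex) set)"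
    by (rule ideal_gen_base) (auto simp: uea_relations_def)
  then show "ideal_eq (uea_relations scaleC lie UNIV) (Poly_Mapping.single [x + y] (1 :: complex))
      (Poly_Mapping.single [x] 1 + Poly_Mapping.single [y] 1)"
    by (simp add: ideal_eq_def diff_diff_add)
qed

lemma uea_inj_scaleC: "uea_inj (c *\<^sub>C x) = c *\<^sub>C uea_inj x"
proof transfer
  fix x :: 'a and c
  have "Poly_Mapping.single [c *\<^sub>C x] 1 - Poly_Mapping.single [x] c
      \<in> ideal_gen UNIV (uea_relations scaleC lie UNIV :: ('a list \<Rightarrow>\<^sub>0 complex) set)"
    by (rule ideal_gen_base) (auto simp: uea_relations_def)
  then show "ideal_eq (uea_relations scaleC lie UNIV) (Poly_Mapping.single [c *\<^sub>C x] (1 :: complex))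
      (Poly_Mapping.single 0 c * Poly_Mapping.single [x] 1)"
    by (simp add: ideal_eq_def mult_single)
qed

lemma uea_inj_lie: "uea_inj (lie x y) = uea_inj x * uea_inj y - uea_inj y * uea_inj x"
proof transfer
  fix x y :: 'a
  have "Poly_Mapping.single [x, y] 1 - Poly_Mapping.single [y, x] 1 - Poly_Mapping.single [lie x y] 1
      \<in> ideal_gen UNIV (uea_relations scaleC lie UNIV :: ('a list \<Rightarrow>\<^sub>0 complex) set)"
    by (rule ideal_gen_base) (auto simp: uea_relations_def)
  from ideal_gen_uminus[OF this]
  show "ideal_eq (uea_relations scaleC lie UNIV) (Poly_Mapping.single [lie x y] (1 :: complex))
      (Poly_Mapping.single [x] 1 * Poly_Mapping.single [y] 1 - Poly_Mapping.single [y] 1 * Poly_Mapping.single [x] 1)"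
    by (simp add: ideal_eq_def mult_single plus_list_def)
qed


section \<open>Tensor products of algebras\<close>

text \<open>The multiplicative monoid of pairs, again written additively; its monoid algebra is the
  free vector space on pairs with the product \<open>(a, b) (a', b') = (a a', b b')\<close>.\<close>

datatype ('a, 'b) tpair = TPair 'a 'b

instantiation tpair :: (monoid_mult, monoid_mult) monoid_add
begin
definition "0 = TPair 1 1"
fun plus_tpair :: "('a, 'b) tpair \<Rightarrow> ('a, 'b) tpair \<Rightarrow> ('a, 'b) tpair"
  where "TPair a b + TPair a' b' = TPair (a * a') (b * b')"
instance
proof
  fix x y z :: "('a, 'b) tpair"
  show "x + y + z = x + (y + z)" by (cases x; cases y; cases z) (simp add: mult.assoc)
  show "0 + x = x" "x + 0 = x" by (cases x; simp add: zero_tpair_def)+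
qed
end

text \<open>The span of these relations is already a two-sided ideal, so dividing by the ideal they
  generate gives the usual tensor product.\<close>

definition tensor_relations ::
  "(('a::complex_algebra_1, 'b::complex_algebra_1) tpair \<Rightarrow>\<^sub>0 complex) set"
  where "tensor_relations =
    {Poly_Mapping.single (TPair (a + a') b) 1 - Poly_Mapping.single (TPair a b) 1
       - Poly_Mapping.single (TPair a' b) 1 | a a' b. True} \<union>
    {Poly_Mapping.single (TPair a (b + b')) 1 - Poly_Mapping.single (TPair a b) 1
       - Poly_Mapping.single (TPair a b') 1 | a b b'. True} \<union>
    {Poly_Mapping.single (TPair (c *\<^sub>C a) b) 1 - Poly_Mapping.single (TPair a b) c | c a b. True} \<union>
    {Poly_Mapping.single (TPair a (c *\<^sub>C b)) 1 - Poly_Mapping.single (TPair a b) c | c a b. True}"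

lemma complex_linear_functional:
  "\<exists>f :: 'a::complex_algebra_1 \<Rightarrow> complex.
     f 1 = 1 \<and> (\<forall>x y. f (x + y) = f x + f y) \<and> (\<forall>c x. f (c *\<^sub>C x) = c * f x)"
proof -
  interpret vector_space_pair "scaleC :: complex \<Rightarrow> 'a \<Rightarrow> 'a" "(*) :: complex \<Rightarrow> complex \<Rightarrow> complex"
    by unfold_locales
      (auto simp: scaleC_add_left scaleC_add_right scaleC_scaleC scaleC_one distrib_left distrib_right)
  have "vs1.independent {1 :: 'a}"
    by (subst vs1.independent_insert) (auto simp: vs1.independent_empty)
  from linear_independent_extend[OF this, of "\<lambda>_. 1"]
  obtain f where f: "Vector_Spaces.linear scaleC (*) f" "f (1 :: 'a) = 1" by auto
  then interpret l: Vector_Spaces.linear scaleC "(*)" f by simp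
  show ?thesis
    using f(2) l.add l.scale by blast
qed

lemma tensor_one_notin: "\<not> ideal_eq tensor_relations 0
  (1 :: ('a::complex_algebra_1, 'b::complex_algebra_1) tpair \<Rightarrow>\<^sub>0 complex)"
proof
  obtain f :: "'a \<Rightarrow> complex" where f: "f 1 = 1" "\<And>x y. f (x + y) = f x + f y" "\<And>c x. f (c *\<^sub>C x) = c * f x"
    using complex_linear_functional by blast
  obtain g :: "'b \<Rightarrow> complex" where g: "g 1 = 1" "\<And>x y. g (x + y) = g x + g y" "\<And>c x. g (c *\<^sub>C x) = c * g x"
    using complex_linear_functional by blast
  define h where "h = linear_ext (*) (\<lambda>k. case k of TPair a b \<Rightarrow> f a * g b)"
  have add: "h (p + q) = h p + h q" and diff: "h (p - q) = h p - h q" and zero: "h 0 = 0"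
    and single: "h (Poly_Mapping.single (TPair a b) c) = c * (f a * g b)" for p q a b c
    by (simp_all add: h_def linear_ext_add linear_ext_diff linear_ext_zero linear_ext_single
        distrib_left distrib_right)
  have sing: "h (Poly_Mapping.single k c * r * Poly_Mapping.single l d) = 0"
    if "r \<in> tensor_relations" for k l c d r
    using that unfolding tensor_relations_def
    by (cases k; cases l; elim UnE CollectE exE conjE; hypsubst)
      (simp_all add: left_diff_distrib right_diff_distrib mult_single diff single
        distrib_left distrib_right f g scaleC_mult_left scaleC_mult_right)
  have "h (Poly_Mapping.single k c * r * q) = 0" if "r \<in> tensor_relations" for k c r q
    by (induction q rule: poly_mapping_single_induct) (simp_all add: zero add distrib_left sing that)
  then have "h (p * r * q) = 0" if "r \<in> tensor_relations" for p r q
    by (induction p rule: poly_mapping_single_induct) (simp_all add: zero add distrib_right that)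
  then have kernel: "h x = 0" if "x \<in> ideal_gen UNIV tensor_relations" for x
    using ideal_gen_kernel[OF that, of h] by (simp add: zero add)
  assume "ideal_eq tensor_relations 0 (1 :: ('a, 'b) tpair \<Rightarrow>\<^sub>0 complex)"
  then have "h (0 - 1) = 0" unfolding ideal_eq_def by (rule kernel)
  moreover have "h 1 = 1" using single[of 1 1 1] by (simp add: f g zero_tpair_def[symmetric])
  ultimately show False by (simp add: diff zero del: diff_0)
qed

quotient_type (overloaded) ('a, 'b) tensor =
  "('a::complex_algebra_1, 'b::complex_algebra_1) tpair \<Rightarrow>\<^sub>0 complex" / "ideal_eq tensor_relations"
  by (rule equivp_ideal_eq)

instantiation tensor :: (complex_algebra_1, complex_algebra_1) complex_algebra_1
begin
lift_definition zero_tensor :: "('a, 'b) tensor" is 0 .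
lift_definition one_tensor :: "('a, 'b) tensor" is 1 .
lift_definition plus_tensor :: "('a, 'b) tensor \<Rightarrow> ('a, 'b) tensor \<Rightarrow> ('a, 'b) tensor"
  is "(+)" by (rule ideal_eq_add)
lift_definition minus_tensor :: "('a, 'b) tensor \<Rightarrow> ('a, 'b) tensor \<Rightarrow> ('a, 'b) tensor"
  is "(-)" by (rule ideal_eq_diff)
lift_definition uminus_tensor :: "('a, 'b) tensor \<Rightarrow> ('a, 'b) tensor"
  is uminus by (rule ideal_eq_uminus)
lift_definition times_tensor :: "('a, 'b) tensor \<Rightarrow> ('a, 'b) tensor \<Rightarrow> ('a, 'b) tensor"
  is "(*)" by (rule ideal_eq_mult)
lift_definition scaleC_tensor :: "complex \<Rightarrow> ('a, 'b) tensor \<Rightarrow> ('a, 'b) tensor"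
  is "\<lambda>c p. Poly_Mapping.single 0 c * p" by (rule ideal_eq_mult[OF ideal_eq_refl])
instance
proof
  fix x y z :: "('a, 'b) tensor" and c d :: complex
  show "x + y + z = x + (y + z)" by transfer (simp add: add.assoc ideal_eq_refl)
  show "x + y = y + x" by transfer (simp add: add.commute ideal_eq_refl)
  show "0 + x = x" by transfer (simp add: ideal_eq_refl)
  show "- x + x = 0" by transfer (simp add: ideal_eq_refl)
  show "x - y = x + - y" by transfer (simp add: ideal_eq_refl)
  show "x * y * z = x * (y * z)" by transfer (simp add: mult.assoc ideal_eq_refl)
  show "1 * x = x" by transfer (simp add: ideal_eq_refl)
  show "x * 1 = x" by transfer (simp add: ideal_eq_refl)
  show "(x + y) * z = x * z + y * z" by transfer (simp add: distrib_right ideal_eq_refl)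
  show "x * (y + z) = x * y + x * z" by transfer (simp add: distrib_left ideal_eq_refl)
  show "c *\<^sub>C (x + y) = c *\<^sub>C x + c *\<^sub>C y" by transfer (simp add: distrib_left ideal_eq_refl)
  show "(c + d) *\<^sub>C x = c *\<^sub>C x + d *\<^sub>C x"
    by transfer (simp add: distrib_right single_add ideal_eq_refl)
  show "c *\<^sub>C d *\<^sub>C x = (c * d) *\<^sub>C x"
    by transfer (simp add: mult.assoc[symmetric] mult_single ideal_eq_refl)
  show "1 *\<^sub>C x = x" by transfer (simp add: ideal_eq_refl)
  show "(c *\<^sub>C x) * y = c *\<^sub>C (x * y)" by transfer (simp add: mult.assoc ideal_eq_refl)
  show "x * (c *\<^sub>C y) = c *\<^sub>C (x * y)"
  proof transfer
    fix p q :: "('a, 'b) tpair \<Rightarrow>\<^sub>0 complex" and c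
    have "p * (Poly_Mapping.single 0 c * q) = Poly_Mapping.single 0 c * (p * q)"
      by (simp add: mult.assoc[symmetric] single_zero_central)
    then show "ideal_eq tensor_relations
      (p * (Poly_Mapping.single 0 c * q)) (Poly_Mapping.single 0 c * (p * q))"
      by (simp add: ideal_eq_refl)
  qed
  show "(0 :: ('a, 'b) tensor) \<noteq> 1" by transfer (rule tensor_one_notin)
qed
end

lift_definition tensor_of :: "'a \<Rightarrow> 'b \<Rightarrow> ('a::complex_algebra_1, 'b::complex_algebra_1) tensor"
    (infixl \<open>\<otimes>\<^sub>t\<close> 72)
  is "\<lambda>a b. Poly_Mapping.single (TPair a b) 1" .

lemma tensor_of_add_left: "(a + a') \<otimes>\<^sub>t b = a \<otimes>\<^sub>t b + a' \<otimes>\<^sub>t b"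
proof transfer
  fix a a' :: 'a and b :: 'b
  have "Poly_Mapping.single (TPair (a + a') b) 1 - Poly_Mapping.single (TPair a b) 1
       - Poly_Mapping.single (TPair a' b) 1 \<in> ideal_gen UNIV tensor_relations"
    unfolding tensor_relations_def by (rule ideal_gen_base) blast
  then show "ideal_eq tensor_relations (Poly_Mapping.single (TPair (a + a') b) (1 :: complex))
      (Poly_Mapping.single (TPair a b) 1 + Poly_Mapping.single (TPair a' b) 1)"
    by (simp add: ideal_eq_def diff_diff_add)
qed

lemma tensor_of_add_right: "a \<otimes>\<^sub>t (b + b') = a \<otimes>\<^sub>t b + a \<otimes>\<^sub>t b'"
proof transfer
  fix a :: 'a and b b' :: 'b
  have "Poly_Mapping.single (TPair a (b + b')) 1 - Poly_Mapping.single (TPair a b) 1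
       - Poly_Mapping.single (TPair a b') 1 \<in> ideal_gen UNIV tensor_relations"
    unfolding tensor_relations_def by (rule ideal_gen_base) blast
  then show "ideal_eq tensor_relations (Poly_Mapping.single (TPair a (b + b')) (1 :: complex))
      (Poly_Mapping.single (TPair a b) 1 + Poly_Mapping.single (TPair a b') 1)"
    by (simp add: ideal_eq_def diff_diff_add)
qed

lemma tensor_of_scaleC_left: "(c *\<^sub>C a) \<otimes>\<^sub>t b = c *\<^sub>C (a \<otimes>\<^sub>t b)"
proof transfer
  fix c and a :: 'a and b :: 'b
  have "Poly_Mapping.single (TPair (c *\<^sub>C a) b) 1 - Poly_Mapping.single (TPair a b) c
      \<in> ideal_gen UNIV tensor_relations"
    unfolding tensor_relations_def by (rule ideal_gen_base) blast
  then show "ideal_eq tensor_relations (Poly_Mapping.single (TPair (c *\<^sub>C a) b) (1 :: complex))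
      (Poly_Mapping.single 0 c * Poly_Mapping.single (TPair a b) 1)"
    by (simp add: ideal_eq_def mult_single)
qed

lemma tensor_of_scaleC_right: "a \<otimes>\<^sub>t (c *\<^sub>C b) = c *\<^sub>C (a \<otimes>\<^sub>t b)"
proof transfer
  fix c and a :: 'a and b :: 'b
  have "Poly_Mapping.single (TPair a (c *\<^sub>C b)) 1 - Poly_Mapping.single (TPair a b) c
      \<in> ideal_gen UNIV tensor_relations"
    unfolding tensor_relations_def by (rule ideal_gen_base) blast
  then show "ideal_eq tensor_relations (Poly_Mapping.single (TPair a (c *\<^sub>C b)) (1 :: complex))
      (Poly_Mapping.single 0 c * Poly_Mapping.single (TPair a b) 1)"
    by (simp add: ideal_eq_def mult_single)
qed

lemma tensor_of_mult: "(a \<otimes>\<^sub>t b) * (a' \<otimes>\<^sub>t b') = (a * a') \<otimes>\<^sub>t (b * b')"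
  by transfer (simp add: mult_single ideal_eq_refl)

lemma tensor_of_one: "1 \<otimes>\<^sub>t 1 = 1"
  by transfer (simp add: zero_tpair_def[symmetric] ideal_eq_refl)


section \<open>The coproduct of the enveloping algebra\<close>

definition primitive_coproduct :: "'g::complex_lie_algebra \<Rightarrow> ('g uea, 'g uea) tensor"
  where "primitive_coproduct x = uea_inj x \<otimes>\<^sub>t 1 + 1 \<otimes>\<^sub>t uea_inj x"

lift_definition coproduct :: "'g::complex_lie_algebra uea \<Rightarrow> ('g uea, 'g uea) tensor"
  is "free_eval scaleC primitive_coproduct"
proof -
  fix p q :: "'g list \<Rightarrow>\<^sub>0 complex"
  assume "ideal_eq (uea_relations scaleC lie UNIV) p q"
  then have "p - q \<in> uea_ideal scaleC lie UNIV" by (simp add: ideal_eq_uea_iff)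
  then have "free_eval scaleC (primitive_coproduct :: 'g \<Rightarrow> _) (p - q) = 0"
  proof (rule free_eval_uea_ideal[rotated -1])
    fix x y :: 'g and c :: complex
    show "primitive_coproduct (x + y) = primitive_coproduct x + primitive_coproduct y"
      by (simp add: primitive_coproduct_def uea_inj_add tensor_of_add_left tensor_of_add_right)
    show "primitive_coproduct (c *\<^sub>C x) = c *\<^sub>C primitive_coproduct x"
      by (simp add: primitive_coproduct_def uea_inj_scaleC tensor_of_scaleC_left
          tensor_of_scaleC_right scaleC_add_right)
    have minus_left: "(u - v) \<otimes>\<^sub>t w = u \<otimes>\<^sub>t w - v \<otimes>\<^sub>t w" for u v w :: "'g uea"
      using tensor_of_add_left[of "u - v" v w] by simp
    have minus_right: "w \<otimes>\<^sub>t (u - v) = w \<otimes>\<^sub>t u - w \<otimes>\<^sub>t v" for u v w :: "'g uea"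
      using tensor_of_add_right[of w "u - v" v] by simp
    show "primitive_coproduct (lie x y) =
        primitive_coproduct x * primitive_coproduct y - primitive_coproduct y * primitive_coproduct x"
      by (simp add: primitive_coproduct_def uea_inj_lie minus_left minus_right distrib_left
          distrib_right tensor_of_mult)
  qed (simp_all add: scaleC_add_left scaleC_add_right scaleC_one scaleC_mult_left scaleC_mult_right
      scaleC_scaleC mult.commute)
  then show "free_eval scaleC primitive_coproduct p = free_eval scaleC primitive_coproduct q"
    by (simp add: free_eval_def linear_ext_diff scaleC_add_left scaleC_add_right)
qed


section \<open>Formal power series with coefficients in vector spaces and algebras\<close>

definition fps_scale :: "complex fps \<Rightarrow> 'v::complex_space fps \<Rightarrow> 'v fps"
  where "fps_scale c x = Abs_fps (\<lambda>n. \<Sum>i=0..n. fps_nth c i *\<^sub>C fps_nth x (n - i))"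

definition fps_lie :: "'g::complex_lie_algebra fps \<Rightarrow> 'g fps \<Rightarrow> 'g fps"
  where "fps_lie x y = Abs_fps (\<lambda>n. \<Sum>i=0..n. lie (fps_nth x i) (fps_nth y (n - i)))"

text \<open>For a finite-dimensional subspace \<open>S\<close> this is the extension of scalars to
  \<open>\<complex>[[\<xi>]]\<close>.\<close>

definition fps_over :: "'v set \<Rightarrow> 'v fps set"
  where "fps_over S = {x. \<forall>n. fps_nth x n \<in> S}"

definition fps_map :: "('a \<Rightarrow> 'b) \<Rightarrow> 'a fps \<Rightarrow> 'b fps"
  where "fps_map f x = Abs_fps (\<lambda>n. f (fps_nth x n))"

definition fps_tensor :: "'a::complex_algebra_1 fps \<Rightarrow> 'b::complex_algebra_1 fps \<Rightarrow> ('a, 'b) tensor fps"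
    (infixl \<open>\<otimes>\<^sub>\<xi>\<close> 72)
  where "x \<otimes>\<^sub>\<xi> y = Abs_fps (\<lambda>n. \<Sum>i=0..n. fps_nth x i \<otimes>\<^sub>t fps_nth y (n - i))"

text \<open>The substitution \<open>f(x) = \<Sum>k. f\<^sub>k x\<^sup>k\<close>, meaningful only when the constant
  coefficient of \<open>x\<close> vanishes: then \<open>x\<^sup>k\<close> contributes to the coefficient of \<open>\<xi>\<^sup>n\<close> only for
  \<open>k \<le> n\<close>.\<close>

definition fps_subst :: "complex fps \<Rightarrow> 'a::complex_algebra_1 fps \<Rightarrow> 'a fps"
  where "fps_subst f x = Abs_fps (\<lambda>n. \<Sum>k=0..n. fps_nth f k *\<^sub>C fps_nth (x ^ k) n)"

definition formal_exp :: "'a::complex_algebra_1 fps \<Rightarrow> 'a fps"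
  where "formal_exp x = fps_subst (fps_exp 1) x"

text \<open>\<open>fps_ln 1\<close> is the series of \<open>ln (1 + X)\<close>.\<close>

definition formal_ln_1_plus :: "'a::complex_algebra_1 fps \<Rightarrow> 'a fps"
  where "formal_ln_1_plus x = fps_subst (fps_ln 1) x"

definition ring_inverse :: "'a::ring_1 \<Rightarrow> 'a"
  where "ring_inverse x = (THE y. x * y = 1 \<and> y * x = 1)"


section \<open>Classical Lie algebras with a Cartan subalgebra\<close>

definition special_linear :: "nat \<Rightarrow> complex mat set"
  where "special_linear N = {A \<in> carrier_mat N N. (\<Sum>i<N. A $$ (i, i)) = 0}"

definition preserves_form :: "nat \<Rightarrow> complex mat \<Rightarrow> complex mat set"
  where "preserves_form N J = {A \<in> carrier_mat N N. transpose_mat A * J + J * A = 0\<^sub>m N N}"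

text \<open>The forms are taken antidiagonal, so that the diagonal matrices in each algebra form a
  Cartan subalgebra.\<close>

definition orthogonal_form :: "nat \<Rightarrow> complex mat"
  where "orthogonal_form N = mat N N (\<lambda>(i, j). if i + j + 1 = N then 1 else 0)"

definition symplectic_form :: "nat \<Rightarrow> complex mat"
  where "symplectic_form r =
    mat (2 * r) (2 * r) (\<lambda>(i, j). if i + j + 1 = 2 * r then (if i < r then 1 else - 1) else 0)"

datatype classical_type = Type_A | Type_B | Type_C | Type_D

fun classical_matrices :: "classical_type \<Rightarrow> nat \<Rightarrow> complex mat set"
  where
    "classical_matrices Type_A r = special_linear (r + 1)"
  | "classical_matrices Type_B r = preserves_form (2 * r + 1) (orthogonal_form (2 * r + 1))"
  | "classical_matrices Type_C r = preserves_form (2 * r) (symplectic_form r)"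
  | "classical_matrices Type_D r = preserves_form (2 * r) (orthogonal_form (2 * r))"

text \<open>\<open>so(2)\<close> and \<open>so(4)\<close> are not simple.\<close>

definition simple_rank :: "classical_type \<Rightarrow> nat \<Rightarrow> bool"
  where "simple_rank X r \<longleftrightarrow> r \<ge> (if X = Type_D then 3 else 1)"

text \<open>The Lie algebra \<open>'g\<close> is classical simple and \<open>h\<close> is a Cartan subalgebra of it. As all
  Cartan subalgebras are conjugate, an isomorphism with a matrix algebra can be chosen to map
  \<open>h\<close> onto the diagonal matrices.\<close>

definition classical_with_cartan :: "'g::complex_lie_algebra set \<Rightarrow> bool"
  where "classical_with_cartan h \<longleftrightarrow>
    (\<exists>X r f. simple_rank X r \<and>
       lie_isomorphism scaleC lie UNIV (\<cdot>\<^sub>m) commutator (classical_matrices X r) f \<and>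
       f ` h = {A \<in> classical_matrices X r. diagonal_mat A})"

text \<open>A nondegenerate invariant symmetric bilinear form; on a simple Lie algebra it is a multiple
  of the Killing form.\<close>

definition invariant_form :: "('g::complex_lie_algebra \<Rightarrow> 'g \<Rightarrow> complex) \<Rightarrow> bool"
  where "invariant_form B \<longleftrightarrow>
    (\<forall>x y z. B (x + y) z = B x z + B y z) \<and> (\<forall>c x y. B (c *\<^sub>C x) y = c * B x y) \<and>
    (\<forall>x y. B x y = B y x) \<and> (\<forall>x y z. B (lie x y) z = B x (lie y z)) \<and>
    (\<forall>x. (\<forall>y. B x y = 0) \<longrightarrow> x = 0)"


section \<open>Roots\<close>

text \<open>Linear forms on \<open>h\<close> are represented by functions on \<open>'g\<close> vanishing outside \<open>h\<close>, so that
  sums and differences of roots can be formed pointwise.\<close>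

definition root_space :: "'g::complex_lie_algebra set \<Rightarrow> ('g \<Rightarrow> complex) \<Rightarrow> 'g set"
  where "root_space h \<alpha> = {x. \<forall>K\<in>h. lie K x = \<alpha> K *\<^sub>C x}"

definition roots :: "'g::complex_lie_algebra set \<Rightarrow> ('g \<Rightarrow> complex) set"
  where "roots h = {\<alpha>. \<alpha> \<noteq> 0 \<and> (\<forall>x. x \<notin> h \<longrightarrow> \<alpha> x = 0) \<and> root_space h \<alpha> \<noteq> {0}}"

definition simple_roots :: "'g::complex_lie_algebra set \<Rightarrow> ('g \<Rightarrow> complex) set \<Rightarrow> bool"
  where "simple_roots h D \<longleftrightarrow>
    finite D \<and> D \<subseteq> roots h \<and>
    (\<forall>c :: ('g \<Rightarrow> complex) \<Rightarrow> complex. (\<forall>K. (\<Sum>\<delta>\<in>D. c \<delta> * \<delta> K) = 0) \<longrightarrow> (\<forall>\<delta>\<in>D. c \<delta> = 0)) \<and>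
    (\<forall>\<alpha>\<in>roots h. \<exists>n :: ('g \<Rightarrow> complex) \<Rightarrow> nat.
       \<alpha> = (\<lambda>K. \<Sum>\<delta>\<in>D. of_nat (n \<delta>) * \<delta> K) \<or> - \<alpha> = (\<lambda>K. \<Sum>\<delta>\<in>D. of_nat (n \<delta>) * \<delta> K))"

definition highest_root :: "'g::complex_lie_algebra set \<Rightarrow> ('g \<Rightarrow> complex) set \<Rightarrow> ('g \<Rightarrow> complex) \<Rightarrow> bool"
  where "highest_root h D \<theta> \<longleftrightarrow>
    \<theta> \<in> roots h \<and>
    (\<forall>\<alpha>\<in>roots h. \<exists>n :: ('g \<Rightarrow> complex) \<Rightarrow> nat. \<theta> - \<alpha> = (\<lambda>K. \<Sum>\<delta>\<in>D. of_nat (n \<delta>) * \<delta> K))"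

definition dual_element ::
  "('g \<Rightarrow> 'g \<Rightarrow> complex) \<Rightarrow> 'g::complex_lie_algebra set \<Rightarrow> ('g \<Rightarrow> complex) \<Rightarrow> 'g"
  where "dual_element B h \<alpha> = (THE t. t \<in> h \<and> (\<forall>K\<in>h. B t K = \<alpha> K))"

definition root_inner ::
  "('g \<Rightarrow> 'g \<Rightarrow> complex) \<Rightarrow> 'g::complex_lie_algebra set \<Rightarrow> ('g \<Rightarrow> complex) \<Rightarrow> ('g \<Rightarrow> complex) \<Rightarrow> complex"
  where "root_inner B h \<alpha> \<beta> = B (dual_element B h \<alpha>) (dual_element B h \<beta>)"

definition constituent_roots :: "'g::complex_lie_algebra set \<Rightarrow> ('g \<Rightarrow> complex) \<Rightarrow> ('g \<Rightarrow> complex) set"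
  where "constituent_roots h \<theta> =
    {\<mu> \<in> roots h. \<theta> - \<mu> \<in> roots h \<and> \<mu> + \<theta> \<notin> roots h \<and> (\<theta> - \<mu>) + \<theta> \<notin> roots h}"

text \<open>The set \<open>P\<close>, called \<open>\<pi>'\<close> in the literature, contains exactly one root of each pair of constituent
  roots.\<close>

definition constituent_choice ::
  "'g::complex_lie_algebra set \<Rightarrow> ('g \<Rightarrow> complex) \<Rightarrow> ('g \<Rightarrow> complex) set \<Rightarrow> bool"
  where "constituent_choice h \<theta> P \<longleftrightarrow>
    P \<subseteq> constituent_roots h \<theta> \<and>
    (\<forall>\<mu>\<in>constituent_roots h \<theta>. \<mu> \<in> P \<longleftrightarrow> \<theta> - \<mu> \<notin> P)"

definition orthogonal_subalgebra ::
  "('g \<Rightarrow> 'g \<Rightarrow> complex) \<Rightarrow> 'g::complex_lie_algebra set \<Rightarrow> ('g \<Rightarrow> complex) \<Rightarrow> 'g set"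
  where "orthogonal_subalgebra B h \<theta> =
    lie_generated scaleC lie (\<Union>\<alpha>\<in>{\<alpha> \<in> roots h. root_inner B h \<alpha> \<theta> = 0}. root_space h \<alpha>)"


section \<open>The extended twist\<close>

definition sigma :: "'g::complex_lie_algebra \<Rightarrow> 'g uea fps"
  where "sigma e = formal_ln_1_plus (fps_X * fps_const (uea_inj e))"

text \<open>The factors are multiplied in the order in which \<open>ps\<close> enumerates \<open>\<pi>'\<close>.\<close>

definition extended_twist ::
  "('g \<Rightarrow> complex) \<Rightarrow> ('g \<Rightarrow> complex) list \<Rightarrow> (('g \<Rightarrow> complex) \<Rightarrow> 'g) \<Rightarrow> 'g \<Rightarrow>
   ('g::complex_lie_algebra uea, 'g uea) tensor fps"
  where "extended_twist \<theta> ps E H =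
    prod_list (map (\<lambda>\<mu>. formal_exp
      (fps_const (uea_inj (E \<mu>)) \<otimes>\<^sub>\<xi>
       (fps_X * fps_const (uea_inj (E (\<theta> - \<mu>))) *
        formal_exp (fps_scale (fps_const (- 1 / 2)) (sigma (E \<theta>)))))) ps) *
    formal_exp (fps_const (uea_inj H) \<otimes>\<^sub>\<xi> sigma (E \<theta>))"

definition twisted_coproduct ::
  "('g::complex_lie_algebra uea, 'g uea) tensor fps \<Rightarrow> 'g uea fps \<Rightarrow> ('g uea, 'g uea) tensor fps"
  where "twisted_coproduct F a = F * fps_map coproduct a * ring_inverse F"

end

theory Submission
  imports Defs
begin

text \<open>
  Write \<open>e\<^sub>i = E\<^sub>\<mu>\<close>, \<open>f\<^sub>i = E\<^bsub>\<theta> - \<mu>\<^esub>\<close> for \<open>\<mu> \<in> \<pi>'\<close>, and \<open>z = E\<^sub>\<theta>\<close>. These span a Heisenberg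
  algebra, on which an element \<open>x\<close> orthogonal to \<open>\<theta>\<close> acts by a symplectic matrix with blocks
  \<open>a, b, c, - a\<^sup>T\<close> (\<open>b\<close> and \<open>c\<close> symmetric). In general \<open>x\<close> is not primitive for the twisted coproduct,
  because \<open>\<Sum> e\<^sub>i \<otimes> f\<^sub>i\<close> is only invariant under the block \<open>a\<close>, but
  \<open>x + \<xi>/2 (\<Sum> c\<^sub>i\<^sub>j f\<^sub>i f\<^sub>j (1 + \<xi> z)\<^sup>-\<^sup>1 + \<Sum> b\<^sub>i\<^sub>j e\<^sub>i e\<^sub>j)\<close> is, and it depends on \<open>x\<close> as a Lie algebra homomorphism.

  The image generates a copy of the enveloping algebra by the Poincare-Birkhoff-Witt theorem.
  Ordered monomials are separated by the convolution products of linear forms that are dual to a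
  basis of \<open>g\<close> and vanish at 1: on monomials of the same length these products take permanents
  as values, and on shorter ones they vanish.

  The Heisenberg relations only use that there is no \<open>\<gamma> \<noteq> 0\<close> such that \<open>\<theta> + \<gamma>\<close> and \<open>\<theta> - \<gamma>\<close> are both
  roots: by this and the unbroken \<open>\<theta>\<close>-strings \<open>H\<close> has the eigenvalue 1 only on the root space of \<open>\<theta>\<close>, and
  the eigenvalue 1/2 only on the constituent roots.
\<close>

section \<open>Coefficientwise maps and formal exponentials\<close>

text \<open>The blocks \<open>b\<close> and \<open>c\<close> cannot be avoided in general: in type C
  of rank at least 2 the span of the \<open>e\<close> and \<open>f\<close> is the standard
  representation of the orthogonal subalgebra. It is irreducible, so no choice of \<pi>' makes the
  span of the E_\<mu> invariant. The shape of the correction is dictated by the twist. Conjugation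
  of x \<otimes> 1 + 1 \<otimes> x by the twist produces a single and a double commutator and then
  stops. Under the twisted coproduct the \<open>e\<close> and \<open>f\<close> are only
  skew-primitive, up to powers of the group-like element 1 + \<xi> z. Hence a quadratic expression
  in them has cross terms, and \<xi>/2 times these cancels the single commutator; the powers of 1 +
  \<xi> z leave a remainder that cancels the double one. The twist is not symmetric in
  \<open>e\<close> and \<open>f\<close>, and so only the products of the \<open>f\<close> carry a
  factor (1 + \<xi> z)^-1. The Poincare-Birkhoff-Witt argument is split between two rings. Ordered
  monomials span over any commutative ring, in particular over C[[\<xi>]]; their independence is
  used only over C.\<close>

interpretation cvs: vector_space "scaleC :: complex \<Rightarrow> 'a \<Rightarrow> 'a::complex_space"
  by unfold_locales (simp_all add: scaleC_add_right scaleC_add_left scaleC_scaleC scaleC_one)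

lemma fps_map_nth [simp]: "fps_nth (fps_map f x) n = f (fps_nth x n)"
  by (simp add: fps_map_def)

definition complex_alg_hom :: "('a::complex_algebra_1 \<Rightarrow> 'b::complex_algebra_1) \<Rightarrow> bool"
  where "complex_alg_hom \<phi> \<longleftrightarrow> (\<forall>x y. \<phi> (x + y) = \<phi> x + \<phi> y) \<and> (\<forall>c x. \<phi> (c *\<^sub>C x) = c *\<^sub>C \<phi> x) \<and>
    (\<forall>x y. \<phi> (x * y) = \<phi> x * \<phi> y) \<and> \<phi> 1 = 1"

text \<open>Instantiated by the two legs u \<mapsto> u \<otimes> 1 and u \<mapsto> 1 \<otimes> u and
  by the coproduct, which all act on power series coefficientwise.\<close>

locale coefficient_hom =
  fixes \<phi> :: "'a::complex_algebra_1 \<Rightarrow> 'b::complex_algebra_1"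
  assumes hom: "complex_alg_hom \<phi>"
begin

lemma hom_add: "\<phi> (x + y) = \<phi> x + \<phi> y" and hom_scaleC: "\<phi> (c *\<^sub>C x) = c *\<^sub>C \<phi> x"
  and hom_mult: "\<phi> (x * y) = \<phi> x * \<phi> y" and hom_one: "\<phi> 1 = 1"
  using hom by (auto simp: complex_alg_hom_def)

lemma hom_zero: "\<phi> 0 = 0"
  using hom_add[of 0 0] by simp

lemma hom_uminus: "\<phi> (- x) = - \<phi> x"
  using hom_add[of x "- x"] by (simp add: hom_zero eq_neg_iff_add_eq_0 add.commute)

lemma hom_diff: "\<phi> (x - y) = \<phi> x - \<phi> y"
  using hom_add[of x "- y"] by (simp add: hom_uminus)

lemma hom_sum: "\<phi> (sum f A) = (\<Sum>i\<in>A. \<phi> (f i))"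
  by (induction A rule: infinite_finite_induct) (simp_all add: hom_zero hom_add)

lemma map_add: "fps_map \<phi> (x + y) = fps_map \<phi> x + fps_map \<phi> y"
  by (simp add: fps_eq_iff hom_add)

lemma map_zero: "fps_map \<phi> 0 = 0"
  by (simp add: fps_eq_iff hom_zero)

lemma map_diff: "fps_map \<phi> (x - y) = fps_map \<phi> x - fps_map \<phi> y"
  by (simp add: fps_eq_iff hom_diff)

lemma map_mult: "fps_map \<phi> (x * y) = fps_map \<phi> x * fps_map \<phi> y"
  by (simp add: fps_eq_iff fps_mult_nth hom_sum hom_mult)

lemma map_one: "fps_map \<phi> 1 = 1"
  by (simp add: fps_eq_iff hom_one hom_zero)

lemma map_power: "fps_map \<phi> (x ^ k) = fps_map \<phi> x ^ k"
  by (induction k) (simp_all add: map_one map_mult)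

lemma map_sum: "fps_map \<phi> (sum f A) = (\<Sum>i\<in>A. fps_map \<phi> (f i))"
  by (induction A rule: infinite_finite_induct) (simp_all add: map_zero map_add)

lemma map_const: "fps_map \<phi> (fps_const a) = fps_const (\<phi> a)"
  by (simp add: fps_eq_iff hom_zero)

lemma map_subst: "fps_map \<phi> (fps_subst f x) = fps_subst f (fps_map \<phi> x)"
  by (simp add: fps_eq_iff fps_subst_def hom_sum hom_scaleC map_power[symmetric])

end

text \<open>Multiplication by this central element is the scalar action
  (\<open>fps_scale_conv\<close>), so module laws become ring laws.\<close>

definition fps_scalar :: "complex fps \<Rightarrow> 'a::complex_algebra_1 fps"
  where "fps_scalar = fps_map (\<lambda>z. z *\<^sub>C 1)"

lemma fps_scale_conv: "fps_scale c x = fps_scalar c * x"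
  by (simp add: fps_eq_iff fps_scale_def fps_scalar_def fps_mult_nth scaleC_mult_left)

lemma fps_scalar_nth: "fps_nth (fps_scalar c) n = fps_nth c n *\<^sub>C 1"
  by (simp add: fps_scalar_def)

lemma fps_scalar_add: "fps_scalar (c + d) = fps_scalar c + fps_scalar d"
  by (simp add: fps_eq_iff fps_scalar_nth scaleC_add_left)

lemma fps_scalar_one: "fps_scalar 1 = 1"
  by (simp add: fps_eq_iff fps_scalar_nth)

lemma fps_scalar_mult: "fps_scalar (c * d) = fps_scalar c * fps_scalar d"
  by (simp add: fps_eq_iff fps_scalar_nth fps_mult_nth cvs.scale_sum_left scaleC_mult_left scaleC_scaleC)

lemma fps_scalar_X: "fps_scalar fps_X = fps_X"
  by (simp add: fps_eq_iff fps_scalar_nth)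

lemma fps_scalar_central: "x * fps_scalar c = fps_scalar c * x"
proof (rule fps_ext)
  fix n
  have "fps_nth (x * fps_scalar c) n = (\<Sum>i=0..n. fps_nth c (n - i) *\<^sub>C fps_nth x i)"
    by (simp add: fps_mult_nth fps_scalar_nth scaleC_mult_right)
  also have "\<dots> = (\<Sum>i=0..n. fps_nth c i *\<^sub>C fps_nth x (n - i))"
    by (subst sum.atLeastAtMost_rev) simp
  finally show "fps_nth (x * fps_scalar c) n = fps_nth (fps_scalar c * x) n"
    by (simp add: fps_mult_nth fps_scalar_nth scaleC_mult_left)
qed

lemma fps_scalar_left_commute: "x * (fps_scalar c * y) = fps_scalar c * (x * y)"
  by (metis fps_scalar_central mult.assoc)

lemma fps_X_central: "x * fps_X = fps_X * (x :: 'a::ring_1 fps)"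
  using fps_mult_fps_X_power_commute[of 1 x] by simp

lemma fps_map_scalar: "complex_alg_hom \<phi> \<Longrightarrow> fps_map \<phi> (fps_scalar c) = fps_scalar c"
  by (simp add: fps_eq_iff fps_scalar_nth complex_alg_hom_def)

lemma fps_power_nth_eq_0:
  fixes x :: "'a::ring_1 fps"
  assumes "fps_nth x 0 = 0" "n < k"
  shows "fps_nth (x ^ k) n = 0"
  using assms(2)
proof (induction k arbitrary: n)
  case (Suc k)
  have "fps_nth x i * fps_nth (x ^ k) (n - i) = 0" if "i \<le> n" for i
    using Suc that assms(1) by (cases "i = 0") auto
  then show ?case by (simp add: fps_mult_nth)
qed simp

lemma fps_mult_power_nth_eq_0:
  fixes x y :: "'a::ring_1 fps"
  assumes "fps_nth x 0 = 0" "fps_nth y 0 = 0" "n < k + l"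
  shows "fps_nth (x ^ k * y ^ l) n = 0"
proof -
  have "fps_nth (x ^ k) i * fps_nth (y ^ l) (n - i) = 0" if "i \<le> n" for i
  proof (cases "i < k")
    case False
    then have "n - i < l" using that assms(3) by simp
    then show ?thesis by (simp add: fps_power_nth_eq_0 assms)
  qed (simp add: fps_power_nth_eq_0 assms)
  then show ?thesis by (simp add: fps_mult_nth)
qed

text \<open>Powers beyond n do not reach the coefficient of \<xi>^n, so any larger cutoff M serves.
  A cutoff shared by all coefficients is what permits the exchange of sums in products.\<close>

lemma fps_subst_nth:
  assumes "fps_nth x 0 = 0" "n \<le> M"
  shows "fps_nth (fps_subst f x) n = (\<Sum>k\<le>M. fps_nth f k *\<^sub>C fps_nth (x ^ k) n)"
proof -
  have "(\<Sum>k\<le>M. fps_nth f k *\<^sub>C fps_nth (x ^ k) n) = (\<Sum>k\<in>{0..n}. fps_nth f k *\<^sub>C fps_nth (x ^ k) n)"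
    using assms by (intro sum.mono_neutral_right) (auto simp: fps_power_nth_eq_0)
  then show ?thesis by (simp add: fps_subst_def)
qed

lemma mult_fps_subst_nth:
  assumes "fps_nth x 0 = 0" "n \<le> M"
  shows "fps_nth (u * fps_subst f x) n = (\<Sum>k\<le>M. fps_nth f k *\<^sub>C fps_nth (u * x ^ k) n)"
proof -
  have "fps_nth (u * fps_subst f x) n
      = (\<Sum>i=0..n. \<Sum>k\<le>M. fps_nth f k *\<^sub>C (fps_nth u i * fps_nth (x ^ k) (n - i)))"
    unfolding fps_mult_nth
    using assms by (intro sum.cong refl, subst fps_subst_nth[of x _ M])
      (auto simp: sum_distrib_left scaleC_mult_right)
  also have "\<dots> = (\<Sum>k\<le>M. \<Sum>i=0..n. fps_nth f k *\<^sub>C (fps_nth u i * fps_nth (x ^ k) (n - i)))"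
    by (rule sum.swap)
  finally show ?thesis by (simp add: fps_mult_nth cvs.scale_sum_right)
qed

lemma fps_subst_mult_nth:
  assumes "fps_nth x 0 = 0" "n \<le> M"
  shows "fps_nth (fps_subst f x * u) n = (\<Sum>k\<le>M. fps_nth f k *\<^sub>C fps_nth (x ^ k * u) n)"
proof -
  have "fps_nth (fps_subst f x * u) n
      = (\<Sum>i=0..n. \<Sum>k\<le>M. fps_nth f k *\<^sub>C (fps_nth (x ^ k) i * fps_nth u (n - i)))"
    unfolding fps_mult_nth
    using assms by (intro sum.cong refl, subst fps_subst_nth[of x _ M])
      (auto simp: sum_distrib_right scaleC_mult_left)
  also have "\<dots> = (\<Sum>k\<le>M. \<Sum>i=0..n. fps_nth f k *\<^sub>C (fps_nth (x ^ k) i * fps_nth u (n - i)))"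
    by (rule sum.swap)
  finally show ?thesis by (simp add: fps_mult_nth cvs.scale_sum_right)
qed

section \<open>Exponentials of series with noncommuting coefficients\<close>

lemma formal_exp_nth_0 [simp]: "fps_nth (formal_exp x) 0 = 1"
  by (simp add: formal_exp_def fps_subst_def)

lemma formal_exp_zero: "formal_exp 0 = 1"
  by (rule fps_ext) (simp add: formal_exp_def fps_subst_def power_0_left if_distrib if_distribR
      sum.delta cong: if_cong)

lemma of_nat_fps_mult_nth: "fps_nth (of_nat m * x) n = of_nat m *\<^sub>C fps_nth (x :: 'a::complex_algebra_1 fps) n"
  by (induction m) (simp_all add: distrib_right scaleC_add_left add.commute)

lemma binomial_commuting:
  fixes x y :: "'a::ring_1"
  assumes "x * y = y * x"
  shows "(x + y) ^ n = (\<Sum>k\<le>n. of_nat (n choose k) * (x ^ k * y ^ (n - k)))"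
proof (induction n)
  case (Suc n)
  have y: "y * x ^ k = x ^ k * y" for k
    by (metis assms power_commuting_commutes)
  have nx: "x * (of_nat m * z) = of_nat m * (x * z)" and ny: "y * (of_nat m * z) = of_nat m * (y * z)"
    for m and z :: 'a by (metis mult.assoc mult_of_nat_commute)+
  have 1: "x * (\<Sum>k\<le>n. of_nat (n choose k) * (x ^ k * y ^ (n - k)))
      = (\<Sum>k\<le>n. of_nat (n choose k) * (x ^ Suc k * y ^ (Suc n - Suc k)))"
    unfolding sum_distrib_left nx by (simp add: mult.assoc)
  have 2: "y * (\<Sum>k\<le>n. of_nat (n choose k) * (x ^ k * y ^ (n - k)))
      = (\<Sum>k\<le>n. of_nat (n choose k) * (x ^ k * y ^ (Suc n - k)))"
    unfolding sum_distrib_left ny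
  proof (rule sum.cong[OF refl])
    fix k assume "k \<in> {..n}"
    then have "y ^ (Suc n - k) = y * y ^ (n - k)" by (simp add: Suc_diff_le)
    then show "of_nat (n choose k) * (y * (x ^ k * y ^ (n - k))) = of_nat (n choose k) * (x ^ k * y ^ (Suc n - k))"
      by (metis mult.assoc y)
  qed
  have 3: "(\<Sum>k\<le>n. of_nat (n choose k) * (x ^ k * y ^ (Suc n - k)))
      = y ^ Suc n + (\<Sum>k\<le>n. of_nat (n choose Suc k) * (x ^ Suc k * y ^ (Suc n - Suc k)))"
  proof -
    have "(\<Sum>k\<le>n. of_nat (n choose k) * (x ^ k * y ^ (Suc n - k)))
      = (\<Sum>k\<le>Suc n. of_nat (n choose k) * (x ^ k * y ^ (Suc n - k)))" by (simp add: binomial_eq_0)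
    then show ?thesis unfolding sum.atMost_Suc_shift by (simp add: binomial_eq_0)
  qed
  have "(x + y) ^ Suc n = x * (x + y) ^ n + y * (x + y) ^ n" by (simp add: distrib_right)
  also have "\<dots> = y ^ Suc n + (\<Sum>k\<le>n. of_nat (Suc n choose Suc k) * (x ^ Suc k * y ^ (Suc n - Suc k)))"
    unfolding Suc 1 2 3 by (simp add: sum.distrib distrib_right)
  also have "\<dots> = (\<Sum>k\<le>Suc n. of_nat (Suc n choose k) * (x ^ k * y ^ (Suc n - k)))"
    unfolding sum.atMost_Suc_shift by simp
  finally show ?case .
qed simp

lemma formal_exp_add:
  assumes xy: "x * y = y * x" and x: "fps_nth x 0 = 0" and y: "fps_nth y 0 = 0"
  shows "formal_exp (x + y) = formal_exp x * formal_exp y"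
proof (rule fps_ext)
  fix n
  define g where "g i j = (1 / (fact i * fact j) :: complex) *\<^sub>C fps_nth (x ^ i * y ^ j) n" for i j
  have g0: "g i j = 0" if "n < i + j" for i j
    by (simp add: g_def fps_mult_power_nth_eq_0 x y that)
  have "fps_nth (formal_exp x * formal_exp y) n
      = (\<Sum>i\<le>n. (1 / fact i) *\<^sub>C fps_nth (x ^ i * formal_exp y) n)"
    unfolding formal_exp_def by (subst fps_subst_mult_nth[OF x order_refl]) simp
  also have "\<dots> = (\<Sum>i\<le>n. \<Sum>j\<le>n. g i j)"
    unfolding formal_exp_def g_def
    by (subst mult_fps_subst_nth[OF y order_refl]) (simp add: cvs.scale_sum_right)
  also have "\<dots> = (\<Sum>(i, j)\<in>{..n} \<times> {..n}. g i j)"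
    by (simp add: sum.cartesian_product)
  \<comment> \<open>The product x^i y^j starts at \<xi>^(i+j), so the square may be cut down to the
    triangle on which the binomial theorem applies.\<close>
  also have "\<dots> = (\<Sum>(i, j)\<in>{(i, j). i + j \<le> n}. g i j)"
    by (rule sum.mono_neutral_right) (auto, metis g0 leI)
  also have "\<dots> = (\<Sum>k\<le>n. \<Sum>i\<le>k. g i (k - i))"
    by (rule sum.triangle_reindex_eq)
  also have "\<dots> = (\<Sum>k\<le>n. (1 / fact k) *\<^sub>C fps_nth ((x + y) ^ k) n)"
  proof (rule sum.cong[OF refl])
    fix k
    have "(1 / fact k) *\<^sub>C fps_nth ((x + y) ^ k) n
        = (\<Sum>i\<le>k. (of_nat (k choose i) / fact k) *\<^sub>C fps_nth (x ^ i * y ^ (k - i)) n)"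
      unfolding binomial_commuting[OF xy]
      by (simp only: fps_sum_nth of_nat_fps_mult_nth cvs.scale_sum_right scaleC_scaleC) simp
    also have "\<dots> = (\<Sum>i\<le>k. g i (k - i))"
      unfolding g_def by (rule sum.cong[OF refl]) (simp add: binomial_fact)
    finally show "(\<Sum>i\<le>k. g i (k - i)) = (1 / fact k) *\<^sub>C fps_nth ((x + y) ^ k) n" by simp
  qed
  also have "\<dots> = fps_nth (formal_exp (x + y)) n"
    unfolding formal_exp_def by (subst fps_subst_nth[of _ n n]) (simp_all add: x y)
  finally show "fps_nth (formal_exp (x + y)) n = fps_nth (formal_exp x * formal_exp y) n" by simp
qed

text \<open>The intertwining relation passes to all powers, x^k u = u v^k. With v = x + y it
  describes how the Cartan factor of the twist moves past an eigenvector of H.\<close>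

lemma fps_subst_mult_commute:
  assumes "x * u = u * v" "fps_nth x 0 = 0" "fps_nth v 0 = 0"
  shows "fps_subst f x * u = u * fps_subst f v"
proof (rule fps_ext)
  fix n
  have "x ^ k * u = u * v ^ k" for k
    by (induction k) (simp, metis assms(1) mult.assoc power_Suc)
  then show "fps_nth (fps_subst f x * u) n = fps_nth (u * fps_subst f v) n"
    using assms by (simp add: fps_subst_mult_nth[of _ _ n] mult_fps_subst_nth[of _ _ n])
qed

lemma formal_exp_commute:
  assumes "x * u = u * x" "fps_nth x 0 = 0"
  shows "formal_exp x * u = u * formal_exp x"
  unfolding formal_exp_def using assms by (intro fps_subst_mult_commute)

text \<open>Leibniz rule x^n u = \<Sum> (n choose k) (ad x)^k(u) x^(n-k), which ends at k = 2
  because z = (ad x)^2(u) commutes with x. Writing n as \<open>Suc (Suc k)\<close> avoids truncated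
  subtraction in the exponents n - 1 and n - 2.\<close>

lemma power_mult_two_step:
  fixes x :: "'a::ring_1"
  assumes "x * u = u * x + w" "x * w = w * x + z" "x * z = z * x"
  shows "x ^ Suc (Suc k) * u = u * x ^ Suc (Suc k) + of_nat (Suc (Suc k)) * (w * x ^ Suc k)
           + of_nat (Suc (Suc k) choose 2) * (z * x ^ k)" (is "?P k")
proof -
  have n: "x * (of_nat m * y) = of_nat m * (x * y)" for m y
    by (metis mult.assoc mult_of_nat_commute)
  have step: "x * (u * y) = u * (x * y) + w * y" "x * (w * y) = w * (x * y) + z * y" "x * (z * y) = z * (x * y)" for y
    by (simp_all add: mult.assoc[symmetric] assms distrib_right)
  have c: "Suc m choose 2 = (m choose 2) + m" for m by (simp add: numeral_2_eq_2)
  show ?thesis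
  proof (induction k)
    case 0
    have "Suc (Suc 0) choose 2 = 1" by (simp add: numeral_2_eq_2)
    then show ?case by (simp add: mult.assoc assms distrib_left distrib_right step mult_2)
  next
    case (Suc k)
    have "x ^ Suc (Suc (Suc k)) * u = x * (x ^ Suc (Suc k) * u)" by (simp add: mult.assoc)
    also have "\<dots> = u * x ^ Suc (Suc (Suc k)) + w * x ^ Suc (Suc k)
        + of_nat (Suc (Suc k)) * (w * x ^ Suc (Suc k) + z * x ^ Suc k)
        + of_nat (Suc (Suc k) choose 2) * (z * x ^ Suc k)"
      unfolding Suc by (simp only: distrib_left n step power_Suc)
    also have "\<dots> = u * x ^ Suc (Suc (Suc k)) + of_nat (Suc (Suc (Suc k))) * (w * x ^ Suc (Suc k))
           + of_nat (Suc (Suc (Suc k)) choose 2) * (z * x ^ Suc k)"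
      unfolding c[of "Suc (Suc k)"]
      by (simp only: of_nat_Suc of_nat_add distrib_left distrib_right mult_1_left) (simp only: ac_simps)
    finally show ?case .
  qed
qed

text \<open>This is exp(x) u exp(-x) = exp(ad x)(u) with (ad x)^3(u) = 0: division by n! turns the
  factors n and (n choose 2) into 1/(n-1)! and 1/2 times 1/(n-2)!.\<close>

lemma formal_exp_two_step:
  assumes x: "fps_nth x 0 = 0"
    and u: "x * u = u * x + w" and w: "x * w = w * x + z" and z: "x * z = z * x"
  shows "formal_exp x * u = (u + w + fps_scalar (fps_const (1 / 2)) * z) * formal_exp x"
proof (rule fps_ext)
  fix n
  let ?p = "\<lambda>k y. fps_nth (y * x ^ k) n"
  have A: "(\<Sum>k\<le>n. (1 / fact (Suc (Suc k)) :: complex) *\<^sub>C ?p (Suc (Suc k)) u)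
      = fps_nth (u * formal_exp x) n - ?p 0 u - ?p 1 u"
    unfolding formal_exp_def
    by (subst mult_fps_subst_nth[OF x, of n "Suc (Suc n)"])
      (simp_all add: sum.atMost_Suc_shift del: fact_Suc sum.atMost_Suc)
  have B: "(\<Sum>k\<le>n. (of_nat (Suc (Suc k)) / fact (Suc (Suc k)) :: complex) *\<^sub>C ?p (Suc k) w)
      = fps_nth (w * formal_exp x) n - ?p 0 w"
    unfolding formal_exp_def
    by (subst mult_fps_subst_nth[OF x, of n "Suc n"])
      (simp_all add: sum.atMost_Suc_shift fact_Suc[of "Suc _"] del: fact_Suc sum.atMost_Suc of_nat_Suc)
  have ch: "of_nat (Suc (Suc k) choose 2) / fact (Suc (Suc k)) = (1 / 2 * (1 / fact k) :: complex)" for k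
    by (subst binomial_fact) (simp_all add: fact_2 del: fact_Suc)
  have C: "(\<Sum>k\<le>n. (of_nat (Suc (Suc k) choose 2) / fact (Suc (Suc k)) :: complex) *\<^sub>C ?p k z)
      = (1 / 2) *\<^sub>C fps_nth (z * formal_exp x) n"
    unfolding formal_exp_def ch
    by (subst mult_fps_subst_nth[OF x, of n n])
      (simp_all add: cvs.scale_sum_right scaleC_scaleC)
  have "fps_nth (formal_exp x * u) n = (\<Sum>k\<le>Suc (Suc n). (1 / fact k) *\<^sub>C fps_nth (x ^ k * u) n)"
    unfolding formal_exp_def by (subst fps_subst_mult_nth[OF x, of n "Suc (Suc n)"]) simp_all
  also have "\<dots> = ?p 0 u + (?p 1 u + ?p 0 w) + (\<Sum>k\<le>n. (1 / fact (Suc (Suc k))) *\<^sub>C fps_nth (x ^ Suc (Suc k) * u) n)"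
    by (simp only: sum.atMost_Suc_shift) (simp add: u del: fact_Suc power_Suc)
  also have "(\<Sum>k\<le>n. (1 / fact (Suc (Suc k)) :: complex) *\<^sub>C fps_nth (x ^ Suc (Suc k) * u) n)
     = (\<Sum>k\<le>n. (1 / fact (Suc (Suc k)) :: complex) *\<^sub>C ?p (Suc (Suc k)) u)
     + (\<Sum>k\<le>n. (of_nat (Suc (Suc k)) / fact (Suc (Suc k)) :: complex) *\<^sub>C ?p (Suc k) w)
     + (\<Sum>k\<le>n. (of_nat (Suc (Suc k) choose 2) / fact (Suc (Suc k)) :: complex) *\<^sub>C ?p k z)"
    unfolding power_mult_two_step[OF u w z]
    by (simp only: fps_add_nth of_nat_fps_mult_nth scaleC_add_right scaleC_scaleC sum.distrib
        times_divide_eq_left mult_1_left)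
  also have "?p 0 u + (?p 1 u + ?p 0 w) + \<dots> = fps_nth ((u + w + fps_scalar (fps_const (1 / 2)) * z) * formal_exp x) n"
  proof -
    have "fps_nth (fps_scalar (fps_const (1 / 2)) * y) n = (1 / 2) *\<^sub>C fps_nth y n" for y :: "'a fps"
    proof -
      have "fps_scalar (fps_const (1 / 2)) = fps_const ((1 / 2) *\<^sub>C (1::'a))"
        by (simp add: fps_eq_iff fps_scalar_nth)
      then show ?thesis by (simp add: scaleC_mult_left)
    qed
    then show ?thesis unfolding A B C by (simp add: distrib_right mult.assoc)
  qed
  finally show "fps_nth (formal_exp x * u) n = fps_nth ((u + w + fps_scalar (fps_const (1 / 2)) * z) * formal_exp x) n" .
qed

lemma formal_exp_one_step:
  assumes "fps_nth x 0 = 0" "x * u = u * x + w" "x * w = w * x"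
  shows "formal_exp x * u = (u + w) * formal_exp x"
  using formal_exp_two_step[of x u w 0] assms by simp

lemma prod_formal_exp:
  assumes "\<And>k l. k \<in> set ks \<Longrightarrow> l \<in> set ks \<Longrightarrow> t k * t l = t l * t k"
    and "\<And>k. k \<in> set ks \<Longrightarrow> fps_nth (t k) 0 = 0"
  shows "prod_list (map (\<lambda>k. formal_exp (t k)) ks) = formal_exp (sum_list (map t ks))"
  using assms
proof (induction ks)
  case (Cons k ks)
  have "fps_nth (sum_list (map t ks)) 0 = 0"
    using Cons.prems(2) by (induction ks) auto
  moreover have "t k * sum_list (map t ks) = sum_list (map t ks) * t k"
    using Cons.prems(1) by (induction ks) (auto simp: distrib_left distrib_right)
  ultimately show ?case
    using Cons by (simp add: formal_exp_add)
qed (simp add: formal_exp_zero)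

text \<open>\<open>ring_inverse\<close> is a definite description, so uniqueness matters as well.
  Over a noncommutative ring the left and the right inverse series are constructed separately, and
  every left inverse equals the right one.\<close>

lemma fps_ring_inverse:
  fixes F :: "'a::ring_1 fps"
  assumes "fps_nth F 0 = 1"
  shows "F * ring_inverse F = 1" "ring_inverse F * F = 1"
proof -
  let ?l = "fps_left_inverse F 1" and ?r = "fps_right_inverse F 1"
  have l: "?l * F = 1" and r: "F * ?r = 1"
    using assms by (auto intro: fps_left_inverse fps_right_inverse)
  have eq: "y = ?r" if "y * F = 1" for y
  proof -
    have "y = y * (F * ?r)" by (simp add: r)
    also have "\<dots> = ?r" unfolding mult.assoc[symmetric] that by simp
    finally show ?thesis .
  qed
  have "\<exists>!y. F * y = 1 \<and> y * F = 1" using eq l r by metis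
  then have "F * ring_inverse F = 1 \<and> ring_inverse F * F = 1"
    unfolding ring_inverse_def by (rule theI')
  then show "F * ring_inverse F = 1" "ring_inverse F * F = 1" by auto
qed

section \<open>Power series in one algebra element\<close>

text \<open>The algebra homomorphism from C[[X]] with X \<mapsto> \<xi> a. It reduces identities
  between \<open>sigma\<close> and its exponentials to identities of scalar series.\<close>

definition fps_eval_at :: "'a::complex_algebra_1 \<Rightarrow> complex fps \<Rightarrow> 'a fps"
  where "fps_eval_at a f = Abs_fps (\<lambda>n. fps_nth f n *\<^sub>C a ^ n)"

lemma fps_eval_at_mult: "fps_eval_at a (f * g) = fps_eval_at a f * fps_eval_at a g"
proof (rule fps_ext)
  fix n
  have "fps_nth f i *\<^sub>C a ^ i * fps_nth g (n - i) *\<^sub>C a ^ (n - i) = (fps_nth f i * fps_nth g (n - i)) *\<^sub>C a ^ n"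
    if "i \<le> n" for i
    using that by (simp add: scaleC_mult_left scaleC_mult_right scaleC_scaleC power_add[symmetric])
  then show "fps_nth (fps_eval_at a (f * g)) n = fps_nth (fps_eval_at a f * fps_eval_at a g) n"
    by (simp add: fps_eval_at_def fps_mult_nth cvs.scale_sum_left)
qed

lemma fps_eval_at_one: "fps_eval_at a 1 = 1"
  by (simp add: fps_eq_iff fps_eval_at_def)

lemma fps_eval_at_add: "fps_eval_at a (f + g) = fps_eval_at a f + fps_eval_at a g"
  by (simp add: fps_eq_iff fps_eval_at_def scaleC_add_left)

lemma fps_eval_at_X: "fps_eval_at a fps_X = fps_X * fps_const a"
  by (simp add: fps_eq_iff fps_eval_at_def)

lemma fps_eval_at_power: "fps_eval_at a (f ^ k) = fps_eval_at a f ^ k"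
  by (induction k) (simp_all add: fps_eval_at_one fps_eval_at_mult)

lemma fps_eval_at_scale: "fps_scale (fps_const c) (fps_eval_at a f) = fps_eval_at a (fps_const c * f)"
  by (simp add: fps_eq_iff fps_eval_at_def fps_scale_def if_distrib if_distribR sum.delta scaleC_scaleC cong: if_cong)

lemma fps_subst_eval_at: "fps_subst f (fps_eval_at a g) = fps_eval_at a (f oo g)"
  by (rule fps_ext) (simp add: fps_subst_def fps_eval_at_power[symmetric],
      simp add: fps_eval_at_def fps_compose_nth cvs.scale_sum_left)

lemma fps_eval_at_map_commute:
  assumes "\<And>n. a * fps_nth x n = fps_nth x n * a"
  shows "fps_eval_at a f * x = x * fps_eval_at a f"
proof (rule fps_ext)
  fix n
  have *: "a ^ k * fps_nth x n = fps_nth x n * a ^ k" for n k by (metis assms power_commuting_commutes)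
  have "fps_nth (x * fps_eval_at a f) n = (\<Sum>i=0..n. fps_nth x (n - i) * fps_nth (fps_eval_at a f) i)"
    unfolding fps_mult_nth by (subst sum.atLeastAtMost_rev) simp
  then show "fps_nth (fps_eval_at a f * x) n = fps_nth (x * fps_eval_at a f) n"
    by (simp add: fps_mult_nth fps_eval_at_def scaleC_mult_left scaleC_mult_right *)
qed

lemma formal_exp_eval_at: "formal_exp (fps_eval_at a g) = fps_eval_at a (fps_exp 1 oo g)"
  by (simp add: formal_exp_def fps_subst_eval_at)

lemma fps_exp_compose_ln:
  "fps_exp 1 oo (fps_const c * fps_ln 1) = fps_exp c oo (fps_ln 1 :: complex fps)"
proof -
  have "fps_exp 1 oo (fps_const c * fps_X) oo fps_ln 1
      = fps_exp 1 oo ((fps_const c * fps_X) oo (fps_ln 1 :: complex fps))"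
    by (rule fps_compose_assoc[symmetric]) simp_all
  moreover have "(fps_const c * fps_X) oo fps_ln 1 = fps_const c * (fps_ln 1 :: complex fps)"
    by (subst fps_compose_mult_distrib) simp_all
  ultimately show ?thesis by simp
qed

lemma fps_exp_ln: "fps_exp 1 oo fps_ln 1 = (1 + fps_X :: complex fps)"
proof -
  have "(fps_exp 1 - 1 :: complex fps) oo fps_ln 1 = fps_X"
    unfolding fps_ln_fps_exp_inv[OF one_neq_zero] by (rule fps_inv_right) simp_all
  then show ?thesis by (simp add: fps_compose_sub_distrib algebra_simps)
qed

lemma sigma_eval_at: "sigma e = fps_eval_at (uea_inj e) (fps_ln 1)"
  unfolding sigma_def formal_ln_1_plus_def fps_eval_at_X[symmetric] fps_subst_eval_at by simp

text \<open>The power (1 + \<xi> e)^c, which is e^(c \<sigma>) by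
  \<open>formal_exp_sigma\<close>.\<close>

definition root_exp :: "complex \<Rightarrow> 'g::complex_lie_algebra \<Rightarrow> 'g uea fps"
  where "root_exp c e = fps_eval_at (uea_inj e) (fps_exp c oo fps_ln 1)"

lemma formal_exp_sigma: "formal_exp (fps_scale (fps_const c) (sigma e)) = root_exp c e"
  by (simp add: sigma_eval_at fps_eval_at_scale formal_exp_eval_at fps_exp_compose_ln root_exp_def)

lemma root_exp_add: "root_exp (c + d) e = root_exp c e * root_exp d e"
  by (simp add: root_exp_def fps_exp_add_mult fps_compose_mult_distrib fps_eval_at_mult)

lemma root_exp_0: "root_exp 0 e = 1"
  by (simp add: root_exp_def fps_eval_at_one)

lemma root_exp_1: "root_exp 1 e = 1 + fps_X * fps_const (uea_inj e)"
  by (simp add: root_exp_def fps_exp_ln fps_eval_at_add fps_eval_at_one fps_eval_at_X)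

section \<open>The tensor square\<close>

lemma alg_hom_left: "complex_alg_hom (\<lambda>u. u \<otimes>\<^sub>t 1)"
  by (simp add: complex_alg_hom_def tensor_of_add_left tensor_of_scaleC_left tensor_of_mult tensor_of_one)

lemma alg_hom_right: "complex_alg_hom (\<lambda>u. 1 \<otimes>\<^sub>t u)"
  by (simp add: complex_alg_hom_def tensor_of_add_right tensor_of_scaleC_right tensor_of_mult tensor_of_one)

abbreviation left_leg :: "'a::complex_algebra_1 fps \<Rightarrow> ('a, 'a) tensor fps"
  where "left_leg \<equiv> fps_map (\<lambda>u. u \<otimes>\<^sub>t 1)"

abbreviation right_leg :: "'a::complex_algebra_1 fps \<Rightarrow> ('a, 'a) tensor fps"
  where "right_leg \<equiv> fps_map (\<lambda>u. 1 \<otimes>\<^sub>t u)"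

interpretation left: coefficient_hom "\<lambda>u. u \<otimes>\<^sub>t 1" by unfold_locales (rule alg_hom_left)
interpretation right: coefficient_hom "\<lambda>u. 1 \<otimes>\<^sub>t u" by unfold_locales (rule alg_hom_right)

lemma fps_tensor_conv: "x \<otimes>\<^sub>\<xi> y = left_leg x * right_leg y"
  by (simp add: fps_eq_iff fps_tensor_def fps_mult_nth tensor_of_mult)

lemma fps_tensor_one: "x \<otimes>\<^sub>\<xi> 1 = left_leg x" "1 \<otimes>\<^sub>\<xi> x = right_leg x"
  by (simp_all add: fps_tensor_conv left.map_one right.map_one)

lemma legs_commute: "right_leg y * left_leg x = left_leg x * right_leg y"
proof (rule fps_ext)
  fix n
  have "fps_nth (right_leg y * left_leg x) n = (\<Sum>i=0..n. fps_nth (right_leg y) (n - i) * fps_nth (left_leg x) i)"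
    unfolding fps_mult_nth by (subst sum.atLeastAtMost_rev) simp
  then show "fps_nth (right_leg y * left_leg x) n = fps_nth (left_leg x * right_leg y) n"
    by (simp add: fps_mult_nth tensor_of_mult)
qed

lemma free_eval_add: "free_eval scaleC F (p + q) = free_eval scaleC F p + free_eval scaleC F q"
  for F :: "'k \<Rightarrow> 'a::complex_algebra_1"
  unfolding free_eval_def by (rule linear_ext_add) (simp_all add: scaleC_add_left scaleC_add_right)

lemma free_eval_mult: "free_eval scaleC F (p * q) = free_eval scaleC F p * free_eval scaleC F q"
  for F :: "'k \<Rightarrow> 'a::complex_algebra_1"
  unfolding free_eval_def
  by (rule linear_ext_mult) (simp_all add: scaleC_add_left scaleC_add_right prod_list_map_plus
      scaleC_mult_left scaleC_mult_right scaleC_scaleC mult.commute)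

lemma free_eval_single: "free_eval scaleC F (Poly_Mapping.single w c) = c *\<^sub>C prod_list (map F w)"
  for F :: "'k \<Rightarrow> 'a::complex_algebra_1"
  unfolding free_eval_def by (rule linear_ext_single) (simp_all add: scaleC_add_left scaleC_add_right)

lemma coproduct_hom: "complex_alg_hom (coproduct :: 'g::complex_lie_algebra uea \<Rightarrow> _)"
  unfolding complex_alg_hom_def
proof (intro conjI allI)
  fix x y :: "'g uea" and c
  show "coproduct (x + y) = coproduct x + coproduct y"
    by transfer (rule free_eval_add)
  show "coproduct (x * y) = coproduct x * coproduct y"
    by transfer (rule free_eval_mult)
  show "coproduct (c *\<^sub>C x) = c *\<^sub>C coproduct x"
    by transfer (simp add: free_eval_mult free_eval_single prod_list_map_zero scaleC_mult_left)
  have "free_eval scaleC primitive_coproduct (1 :: 'g list \<Rightarrow>\<^sub>0 complex) = 1"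
    using free_eval_single[of primitive_coproduct "0 :: 'g list" 1]
    by (simp add: prod_list_map_zero)
  then show "coproduct (1 :: 'g uea) = 1" by transfer
qed

interpretation coproduct: coefficient_hom coproduct by unfold_locales (rule coproduct_hom)

lemma coproduct_inj: "coproduct (uea_inj x) = uea_inj x \<otimes>\<^sub>t 1 + 1 \<otimes>\<^sub>t uea_inj x"
  by transfer (simp add: free_eval_single primitive_coproduct_def)

section \<open>Functionals on the enveloping algebra\<close>

definition functional :: "('a::complex_space \<Rightarrow> complex) \<Rightarrow> bool"
  where "functional \<phi> \<longleftrightarrow> (\<forall>x y. \<phi> (x + y) = \<phi> x + \<phi> y) \<and> (\<forall>c x. \<phi> (c *\<^sub>C x) = c * \<phi> x)"

lemma functional_add: "functional \<phi> \<Longrightarrow> \<phi> (x + y) = \<phi> x + \<phi> y"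
  and functional_scaleC: "functional \<phi> \<Longrightarrow> \<phi> (c *\<^sub>C x) = c * \<phi> x"
  by (auto simp: functional_def)

lemma functional_zero: "functional \<phi> \<Longrightarrow> \<phi> 0 = 0"
  using functional_scaleC[of \<phi> 0 0] by simp

lemma functional_sum: "functional \<phi> \<Longrightarrow> \<phi> (sum f A) = (\<Sum>i\<in>A. \<phi> (f i))"
  by (induction A rule: infinite_finite_induct) (simp_all add: functional_zero functional_add)

lemma functional_left_mult: "functional \<phi> \<Longrightarrow> functional (\<lambda>u. \<phi> (a * u))"
  for \<phi> :: "'a::complex_algebra_1 \<Rightarrow> complex"
  by (simp add: functional_def distrib_left scaleC_mult_right)

lemma functional_extend:
  assumes "cvs.independent (B :: 'a::complex_space set)"
  obtains \<phi> where "functional \<phi>" "\<And>b. b \<in> B \<Longrightarrow> \<phi> b = \<psi> b"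
proof -
  interpret vector_space_pair "scaleC :: complex \<Rightarrow> 'a \<Rightarrow> 'a" "(*) :: complex \<Rightarrow> complex \<Rightarrow> complex"
    by unfold_locales (auto simp: distrib_left distrib_right)
  from linear_independent_extend[OF assms, of \<psi>]
  obtain f where f: "Vector_Spaces.linear scaleC (*) f" "\<And>b. b \<in> B \<Longrightarrow> f b = \<psi> b" by auto
  then interpret l: Vector_Spaces.linear scaleC "(*)" f by simp
  show ?thesis by (rule that[of f]) (auto simp: functional_def l.add l.scale f)
qed

lemma functional_separates:
  assumes "(x :: 'a::complex_space) \<noteq> 0"
  obtains \<phi> where "functional \<phi>" "\<phi> x \<noteq> 0"
proof -
  have "cvs.independent {x}" using assms by (simp add: cvs.independent_insert)
  then have "\<exists>\<phi>. functional \<phi> \<and> \<phi> x = 1"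
    using functional_extend[of "{x}" "\<lambda>_. 1"] by (metis singletonI)
  then show ?thesis using that by auto
qed

definition word :: "'g list \<Rightarrow> 'g::complex_lie_algebra uea"
  where "word w = prod_list (map uea_inj w)"

lemma word_simps [simp]: "word [] = 1" "word (x # w) = uea_inj x * word w"
  by (simp_all add: word_def)

text \<open>The universal property in terms of words: the hypotheses say that the linear extension
  of G vanishes on every defining relation placed between two words, hence on the whole
  ideal.\<close>

lemma uea_functional:
  fixes G :: "'g::complex_lie_algebra list \<Rightarrow> complex"
  assumes add: "\<And>u v x y. G (u @ (x + y) # v) = G (u @ x # v) + G (u @ y # v)"
    and scale: "\<And>u v x c. G (u @ (c *\<^sub>C x) # v) = c * G (u @ x # v)"
    and lie: "\<And>u v x y. G (u @ lie x y # v) = G (u @ x # y # v) - G (u @ y # x # v)"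
  obtains \<phi> where "functional \<phi>" "\<And>w. \<phi> (word w) = G w"
proof -
  define h where "h = linear_ext (*) G"
  have hadd: "h (p + q) = h p + h q" and hdiff: "h (p - q) = h p - h q" and hzero: "h 0 = 0"
    and hsingle: "h (Poly_Mapping.single w c) = c * G w" for p q w c
    by (simp_all add: h_def linear_ext_add linear_ext_diff linear_ext_zero linear_ext_single
        distrib_left distrib_right)
  have sing: "h (Poly_Mapping.single k c * r * Poly_Mapping.single l d) = 0"
    if "r \<in> uea_relations scaleC lie UNIV" for k l c d r
    using that unfolding uea_relations_def
    by (elim UnE CollectE exE conjE; hypsubst)
      (simp_all add: left_diff_distrib right_diff_distrib mult_single hdiff hsingle plus_list_def
        add scale lie distrib_left mult_ac)
  have "h (Poly_Mapping.single k c * r * q) = 0" if "r \<in> uea_relations scaleC lie UNIV" for k c r q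
    by (induction q rule: poly_mapping_single_induct) (simp_all add: hzero hadd distrib_left sing that)
  then have "h (p * r * q) = 0" if "r \<in> uea_relations scaleC lie UNIV" for p r q
    by (induction p rule: poly_mapping_single_induct) (simp_all add: hzero hadd distrib_right that)
  then have kernel: "h x = 0" if "x \<in> ideal_gen UNIV (uea_relations scaleC lie UNIV)" for x
    using ideal_gen_kernel[OF that, of h] by (simp add: hzero hadd)
  define \<phi> where "\<phi> u = h (rep_uea u)" for u
  have abs: "\<phi> (abs_uea p) = h p" for p
  proof -
    have "ideal_eq (uea_relations scaleC lie UNIV) (rep_uea (abs_uea p)) p"
      by (rule Quotient3_rep_abs[OF Quotient3_uea]) (rule ideal_eq_refl)
    then show ?thesis using kernel[of "rep_uea (abs_uea p) - p"] by (simp add: ideal_eq_def hdiff \<phi>_def)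
  qed
  have ex: "\<exists>p. u = abs_uea p" for u :: "'g uea"
    by (rule exI[of _ "rep_uea u"]) (simp add: Quotient3_abs_rep[OF Quotient3_uea])
  have "functional \<phi>"
    unfolding functional_def
  proof (intro conjI allI)
    fix u v :: "'g uea" and c
    obtain p q where "u = abs_uea p" "v = abs_uea q" using ex by blast
    then show "\<phi> (u + v) = \<phi> u + \<phi> v" by (simp add: plus_uea.abs_eq abs hadd)
  next
    fix u :: "'g uea" and c
    obtain p where p: "u = abs_uea p" using ex by blast
    have "h (Poly_Mapping.single 0 c * p) = c * h p"
      by (induction p rule: poly_mapping_single_induct)
        (simp_all add: hzero hadd distrib_left hsingle mult_single)
    then show "\<phi> (c *\<^sub>C u) = c * \<phi> u" by (simp add: p scaleC_uea.abs_eq abs)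
  qed
  moreover have word_abs: "word w = abs_uea (Poly_Mapping.single w 1)" for w :: "'g list"
  proof (induction w)
    case Nil
    have "Poly_Mapping.single ([] :: 'g list) (1 :: complex) = 1"
      unfolding zero_list_def[symmetric] by simp
    then show ?case by (simp add: one_uea.abs_eq[symmetric])
  next
    case (Cons x w)
    then show ?case by (simp add: uea_inj.abs_eq times_uea.abs_eq mult_single plus_list_def)
  qed
  then have "\<phi> (word w) = G w" for w
    by (simp add: abs hsingle)
  ultimately show ?thesis by (rule that)
qed

text \<open>The augmentation, whose existence comes from \<open>uea_functional\<close>. It separates
  1 from the image of the Lie algebra and is the empty convolution product below.\<close>

definition counit :: "'g::complex_lie_algebra uea \<Rightarrow> complex"
  where "counit = (SOME \<phi>. functional \<phi> \<and> (\<forall>w. \<phi> (word w) = (if w = [] then 1 else 0)))"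

lemma counit: "functional (counit :: 'g::complex_lie_algebra uea \<Rightarrow> _)"
    "counit (word w :: 'g uea) = (if w = [] then 1 else 0)"
proof -
  have "\<exists>\<phi> :: 'g uea \<Rightarrow> complex. functional \<phi> \<and> (\<forall>w. \<phi> (word w) = (if w = [] then 1 else 0))"
    by (rule uea_functional[of "\<lambda>w. if w = [] then 1 else 0"]) (simp, simp, simp, blast)
  from someI_ex[OF this] show "functional (counit :: 'g uea \<Rightarrow> _)"
    "counit (word w :: 'g uea) = (if w = [] then 1 else 0)"
    by (auto simp: counit_def)
qed

lemma uea_inj_linear: "Vector_Spaces.linear scaleC scaleC (uea_inj :: 'g::complex_lie_algebra \<Rightarrow> _)"
  by unfold_locales (simp_all add: uea_inj_add uea_inj_scaleC)

text \<open>The functionals \<open>x \<mapsto> \<phi> [x, z]\<close> extend to the enveloping algebra through the adjoint action.\<close>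

lemma uea_inj_eq_0:
  fixes x :: "'g::complex_lie_algebra"
  assumes centre: "\<And>x :: 'g. (\<And>z. lie x z = 0) \<Longrightarrow> x = 0" and x: "uea_inj x = 0"
  shows "x = 0"
proof (rule centre, rule ccontr)
  fix z assume "lie x z \<noteq> 0"
  then obtain \<psi> where \<psi>: "functional \<psi>" "\<psi> (lie x z) \<noteq> 0" by (rule functional_separates)
  have lie_zero: "lie u 0 = 0" for u :: 'g
    using lie_scaleC_right[of u 0 0] by simp
  have fa: "foldr lie u (a + b) = foldr lie u a + foldr lie u b" for u and a b :: 'g
    by (induction u) (simp_all add: lie_add_right)
  have fs: "foldr lie u (c *\<^sub>C a) = c *\<^sub>C foldr lie u a" for u c and a :: 'g
    by (induction u) (simp_all add: lie_scaleC_right)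
  have anti: "lie a b = - lie b a" for a b :: 'g
    using lie_self[of "a + b"] unfolding lie_add_left lie_add_right
    by (simp add: lie_self eq_neg_iff_add_eq_0 add.commute)
  have jac: "lie a (lie b c) = lie (lie a b) c + lie b (lie a c)" for a b c :: 'g
  proof -
    have "lie b (lie c a) = - lie b (lie a c)"
      using lie_scaleC_right[of b "- 1" "lie a c"] by (simp add: anti[of c a])
    then show ?thesis using lie_jacobi[of a b c] anti[of c "lie a b"]
      by (simp add: algebra_simps)
  qed
  obtain \<phi> where "functional \<phi>" "\<And>w. \<phi> (word w) = \<psi> (foldr lie w z)"
  proof (rule uea_functional[of "\<lambda>w. \<psi> (foldr lie w z)"])
    fix u v :: "'g list" and x y c
    show "\<psi> (foldr lie (u @ (x + y) # v) z) = \<psi> (foldr lie (u @ x # v) z) + \<psi> (foldr lie (u @ y # v) z)"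
      by (simp add: lie_add_left fa functional_add \<psi>)
    show "\<psi> (foldr lie (u @ (c *\<^sub>C x) # v) z) = c * \<psi> (foldr lie (u @ x # v) z)"
      by (simp add: lie_scaleC_left fs functional_scaleC \<psi>)
    have "foldr lie (u @ x # y # v) z = foldr lie (u @ lie x y # v) z + foldr lie (u @ y # x # v) z"
      by (simp add: jac[of x y] fa)
    then show "\<psi> (foldr lie (u @ lie x y # v) z)
       = \<psi> (foldr lie (u @ x # y # v) z) - \<psi> (foldr lie (u @ y # x # v) z)"
      by (simp add: functional_add \<psi>)
  qed blast
  from this(2)[of "[x]"] this(1) show False using \<psi>(2) by (simp add: x functional_zero)
qed

text \<open>The images of B are independent because \<open>uea_inj\<close> is injective, and the
  counit, which vanishes on them and not at 1, shows that 1 is independent of them. So the value at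
  1 can be prescribed to be 0 as well.\<close>

lemma dual_functional:
  fixes B :: "'g::complex_lie_algebra set"
  assumes centre: "\<And>x :: 'g. (\<And>z. lie x z = 0) \<Longrightarrow> x = 0"
    and B: "cvs.independent B"
  obtains \<phi> :: "'g uea \<Rightarrow> complex"
  where "functional \<phi>" "\<phi> 1 = 0" "\<And>b'. b' \<in> B \<Longrightarrow> \<phi> (uea_inj b') = (if b' = b then 1 else 0)"
proof -
  interpret l: Vector_Spaces.linear scaleC scaleC "uea_inj :: 'g \<Rightarrow> 'g uea" by (rule uea_inj_linear)
  have inj: "inj (uea_inj :: 'g \<Rightarrow> 'g uea)"
    using uea_inj_eq_0[OF centre] by (auto simp: l.inj_iff_eq_0)
  then have ind: "cvs.independent ((uea_inj :: 'g \<Rightarrow> 'g uea) ` B)"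
    by (intro l.independent_injective_image[OF B]) (auto simp: inj_on_def)
  have "counit u = 0" if "u \<in> cvs.span ((uea_inj :: 'g \<Rightarrow> 'g uea) ` B)" for u
    using that
  proof (induction rule: cvs.span_induct_alt)
    case (step c x y)
    then obtain b where "x = word [b]" by auto
    then show ?case using step counit(2)[of "[b]"] by (simp add: functional_add functional_scaleC counit)
  qed (simp add: functional_zero counit)
  from this[of 1] have "(1 :: 'g uea) \<notin> cvs.span (uea_inj ` B)"
    using counit(2)[of "[] :: 'g list"] by auto
  then have ind1: "cvs.independent (insert 1 ((uea_inj :: 'g \<Rightarrow> 'g uea) ` B))"
    using ind by (simp add: cvs.independent_insert cvs.span_base)
  obtain \<phi> :: "'g uea \<Rightarrow> complex" where \<phi>: "functional \<phi>"
    "\<And>u. u \<in> insert 1 (uea_inj ` B) \<Longrightarrow> \<phi> u = (if u = uea_inj b then 1 else 0) * (if u = 1 then 0 else 1)"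
    by (rule functional_extend[OF ind1, where \<psi> = "\<lambda>u. (if u = uea_inj b then 1 else 0) * (if u = 1 then 0 else 1)"]) (rule that)
  have "uea_inj b' \<noteq> (1 :: 'g uea)" for b'
    using counit(2)[of "[b']"] counit(2)[of "[] :: 'g list"] by auto
  then show ?thesis
    using that[of \<phi>] \<phi> inj by (auto simp: inj_eq)
qed

section \<open>Products of functionals on a tensor product\<close>

lemma abs_tensor_single: "abs_tensor (Poly_Mapping.single (TPair a b) c) = c *\<^sub>C (a \<otimes>\<^sub>t b)"
  by (simp add: tensor_of.abs_eq scaleC_tensor.abs_eq mult_single)

lemma tensor_induct [case_names zero add]:
  assumes "P 0" "\<And>t a b. P t \<Longrightarrow> P (t + a \<otimes>\<^sub>t b)"
  shows "P t"
proof -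
  have "P (abs_tensor p)" for p
  proof (induction p rule: poly_mapping_single_induct)
    case zero
    then show ?case using assms(1) by (simp add: zero_tensor_def)
  next
    case (single_add p k c)
    obtain a b where "k = TPair a b" by (cases k)
    then have "abs_tensor (p + Poly_Mapping.single k c) = abs_tensor p + (c *\<^sub>C a) \<otimes>\<^sub>t b"
      by (simp add: plus_tensor.abs_eq[symmetric] abs_tensor_single tensor_of_scaleC_left)
    then show ?case using assms(2) single_add by simp
  qed
  moreover have "t = abs_tensor (rep_tensor t)"
    by (simp add: Quotient3_abs_rep[OF Quotient3_tensor])
  ultimately show ?thesis by metis
qed

text \<open>The functional \<phi> \<otimes> \<psi>, evaluated on a chosen representative; for linear
  \<phi> and \<psi> the value does not depend on the choice.\<close>

definition tensor_functional ::
  "('a::complex_algebra_1 \<Rightarrow> complex) \<Rightarrow> ('b::complex_algebra_1 \<Rightarrow> complex) \<Rightarrow> ('a, 'b) tensor \<Rightarrow> complex"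
  where "tensor_functional \<phi> \<psi> t = linear_ext (*) (\<lambda>k. case k of TPair a b \<Rightarrow> \<phi> a * \<psi> b) (rep_tensor t)"

lemma tensor_functional:
  fixes \<phi> :: "'a::complex_algebra_1 \<Rightarrow> complex" and \<psi> :: "'b::complex_algebra_1 \<Rightarrow> complex"
  assumes \<phi>: "functional \<phi>" and \<psi>: "functional \<psi>"
  shows "functional (tensor_functional \<phi> \<psi>)" "tensor_functional \<phi> \<psi> (a \<otimes>\<^sub>t b) = \<phi> a * \<psi> b"
proof -
  define h where "h = linear_ext (*) (\<lambda>k. case k of TPair a b \<Rightarrow> \<phi> a * \<psi> b)"
  have hadd: "h (p + q) = h p + h q" and hdiff: "h (p - q) = h p - h q" and hzero: "h 0 = 0"
    and hsingle: "h (Poly_Mapping.single (TPair a b) c) = c * (\<phi> a * \<psi> b)" for p q a b c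
    by (simp_all add: h_def linear_ext_add linear_ext_diff linear_ext_zero linear_ext_single
        distrib_left distrib_right)
  have sing: "h (Poly_Mapping.single k c * r * Poly_Mapping.single l d) = 0"
    if "r \<in> tensor_relations" for k l c d r
    using that unfolding tensor_relations_def
    by (cases k; cases l; elim UnE CollectE exE conjE; hypsubst)
      (simp_all add: left_diff_distrib right_diff_distrib mult_single hdiff hsingle
        distrib_left distrib_right functional_add[OF \<phi>] functional_add[OF \<psi>]
        functional_scaleC[OF \<phi>] functional_scaleC[OF \<psi>] scaleC_mult_left scaleC_mult_right)
  have "h (Poly_Mapping.single k c * r * q) = 0" if "r \<in> tensor_relations" for k c r q
    by (induction q rule: poly_mapping_single_induct) (simp_all add: hzero hadd distrib_left sing that)
  then have "h (p * r * q) = 0" if "r \<in> tensor_relations" for p r q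
    by (induction p rule: poly_mapping_single_induct) (simp_all add: hzero hadd distrib_right that)
  then have kernel: "h x = 0" if "x \<in> ideal_gen UNIV tensor_relations" for x
    using ideal_gen_kernel[OF that, of h] by (simp add: hzero hadd)
  have tf: "tensor_functional \<phi> \<psi> t = h (rep_tensor t)" for t
    by (simp add: tensor_functional_def h_def)
  have abs: "tensor_functional \<phi> \<psi> (abs_tensor p) = h p" for p
  proof -
    have "ideal_eq tensor_relations (rep_tensor (abs_tensor p)) p"
      by (rule Quotient3_rep_abs[OF Quotient3_tensor]) (rule ideal_eq_refl)
    then show ?thesis using kernel[of "rep_tensor (abs_tensor p) - p"]
      by (simp add: ideal_eq_def hdiff tf)
  qed
  have ex: "\<exists>p. u = abs_tensor p" for u :: "('a, 'b) tensor"
    by (rule exI[of _ "rep_tensor u"]) (simp add: Quotient3_abs_rep[OF Quotient3_tensor])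
  show "functional (tensor_functional \<phi> \<psi>)"
    unfolding functional_def
  proof (intro conjI allI)
    fix u v :: "('a, 'b) tensor"
    obtain p q where "u = abs_tensor p" "v = abs_tensor q" using ex by blast
    then show "tensor_functional \<phi> \<psi> (u + v) = tensor_functional \<phi> \<psi> u + tensor_functional \<phi> \<psi> v"
      by (simp add: plus_tensor.abs_eq abs hadd)
  next
    fix u :: "('a, 'b) tensor" and c
    obtain p where p: "u = abs_tensor p" using ex by blast
    have "h (Poly_Mapping.single 0 c * p) = c * h p"
    proof (induction p rule: poly_mapping_single_induct)
      case (single_add p k d)
      then show ?case by (cases k) (simp add: hadd distrib_left hsingle mult_single)
    qed (simp add: hzero)
    then show "tensor_functional \<phi> \<psi> (c *\<^sub>C u) = c * tensor_functional \<phi> \<psi> u"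
      by (simp add: p scaleC_tensor.abs_eq abs)
  qed
  show "tensor_functional \<phi> \<psi> (a \<otimes>\<^sub>t b) = \<phi> a * \<psi> b"
    by (simp add: tensor_of.abs_eq abs hsingle)
qed

lemma tensor_functional_left_mult:
  assumes \<phi>: "functional \<phi>" and \<psi>: "functional \<psi>"
  shows "tensor_functional \<phi> \<psi> ((a \<otimes>\<^sub>t b) * t) = tensor_functional (\<lambda>u. \<phi> (a * u)) (\<lambda>u. \<psi> (b * u)) t"
proof (induction t rule: tensor_induct)
  case zero
  then show ?case
    by (simp add: functional_zero tensor_functional functional_left_mult \<phi> \<psi>)
next
  case (add t c d)
  then show ?case
    by (simp add: distrib_left tensor_of_mult functional_add tensor_functional functional_left_mult \<phi> \<psi>)
qed

section \<open>The Poincare-Birkhoff-Witt theorem\<close>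

text \<open>The product that the coproduct induces on the dual space of U(g).\<close>

definition convolution :: "('g::complex_lie_algebra uea \<Rightarrow> complex) \<Rightarrow> ('g uea \<Rightarrow> complex) \<Rightarrow> 'g uea \<Rightarrow> complex"
  where "convolution \<phi> \<psi> u = tensor_functional \<phi> \<psi> (coproduct u)"

lemma functional_convolution: "functional \<phi> \<Longrightarrow> functional \<psi> \<Longrightarrow> functional (convolution \<phi> \<psi>)"
  using tensor_functional(1)[of \<phi> \<psi>]
  by (auto simp: functional_def convolution_def coproduct.hom_add coproduct.hom_scaleC)

lemma convolution_one: "functional \<phi> \<Longrightarrow> functional \<psi> \<Longrightarrow> convolution \<phi> \<psi> 1 = \<phi> 1 * \<psi> 1"
  by (simp add: convolution_def coproduct.hom_one tensor_of_one[symmetric] tensor_functional)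

text \<open>Since x is primitive, the transpose of left multiplication by x is a derivation of the
  convolution product.\<close>

lemma convolution_inj_mult:
  assumes "functional \<phi>" "functional \<psi>"
  shows "convolution \<phi> \<psi> (uea_inj x * u)
    = convolution (\<lambda>v. \<phi> (uea_inj x * v)) \<psi> u + convolution \<phi> (\<lambda>v. \<psi> (uea_inj x * v)) u"
  using assms
  by (simp add: convolution_def coproduct.hom_mult coproduct_inj distrib_right functional_add
      tensor_functional tensor_functional_left_mult)

text \<open>The coproduct distributes the letters of w over \<phi> and \<psi> in all ways. As \<psi>
  vanishes on words with fewer than k letters, it has to receive all k of them.\<close>

lemma convolution_word_short:
  assumes "functional \<phi>" "functional \<psi>" "\<And>v. length v < k \<Longrightarrow> \<psi> (word v) = 0"
  shows "(length w < k \<longrightarrow> convolution \<phi> \<psi> (word w) = 0) \<and>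
    (length w = k \<longrightarrow> convolution \<phi> \<psi> (word w) = \<phi> 1 * \<psi> (word w))"
  using assms
proof (induction w arbitrary: \<phi> \<psi> k)
  case Nil
  then show ?case using Nil.prems(3)[of "[]"] by (auto simp: convolution_one)
next
  case (Cons x w)
  note IH1 = Cons.IH[OF functional_left_mult[OF Cons.prems(1)] Cons.prems(2,3), of k "uea_inj x"]
  have "\<psi> (uea_inj x * word v) = 0" if "length v < k - 1" for v
    using Cons.prems(3)[of "x # v"] that by simp
  note IH2 = Cons.IH[OF Cons.prems(1) functional_left_mult[OF Cons.prems(2)] this, of "k - 1"]
  show ?case
    using IH1 IH2 by (auto simp: convolution_inj_mult Cons.prems)
qed

text \<open>Of the k + 1 letters \<psi> has to receive at least k, and \<phi> at least one because
  \<phi> 1 = 0. So exactly one letter goes to \<phi>.\<close>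

lemma convolution_word:
  assumes "functional \<phi>" "functional \<psi>" "\<phi> 1 = 0" "\<And>v. length v < k \<Longrightarrow> \<psi> (word v) = 0"
    and "length w = Suc k"
  shows "convolution \<phi> \<psi> (word w)
    = (\<Sum>i<length w. \<phi> (uea_inj (w ! i)) * \<psi> (word (take i w @ drop (Suc i) w)))"
  using assms
proof (induction w arbitrary: \<psi> k)
  case (Cons x w)
  have 1: "convolution (\<lambda>v. \<phi> (uea_inj x * v)) \<psi> (word w) = \<phi> (uea_inj x) * \<psi> (word w)"
    using convolution_word_short[OF functional_left_mult[OF Cons.prems(1)] Cons.prems(2,4), of k w] Cons.prems(5)
    by simp
  have 2: "convolution \<phi> (\<lambda>v. \<psi> (uea_inj x * v)) (word w)
    = (\<Sum>i<length w. \<phi> (uea_inj (w ! i)) * \<psi> (uea_inj x * word (take i w @ drop (Suc i) w)))"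
  proof (cases w)
    case Nil
    then show ?thesis
      using Cons.prems by (simp add: convolution_one functional_left_mult)
  next
    case (Cons y w')
    have "\<psi> (uea_inj x * word v) = 0" if "length v < k - 1" for v
      using Cons.prems(4)[of "x # v"] that by simp
    then show ?thesis
      using Cons Cons.prems by (intro Cons.IH[where k = "k - 1"]) (auto simp: functional_left_mult)
  qed
  show ?case
    using Cons.prems by (simp add: convolution_inj_mult 1 2 lessThan_Suc_eq_insert_0 sum.reindex)
qed simp

primrec multi_convolution :: "('g::complex_lie_algebra uea \<Rightarrow> complex) list \<Rightarrow> 'g uea \<Rightarrow> complex"
  where
    "multi_convolution [] = counit"
  | "multi_convolution (\<phi> # \<phi>s) = convolution \<phi> (multi_convolution \<phi>s)"

lemma functional_multi_convolution:
  "(\<And>\<phi>. \<phi> \<in> set \<phi>s \<Longrightarrow> functional \<phi>) \<Longrightarrow> functional (multi_convolution \<phi>s)"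
  by (induction \<phi>s) (auto simp: counit functional_convolution)

lemma multi_convolution_short:
  assumes "\<And>\<phi>. \<phi> \<in> set \<phi>s \<Longrightarrow> functional \<phi> \<and> \<phi> 1 = 0" "length w < length \<phi>s"
  shows "multi_convolution \<phi>s (word w) = 0"
  using assms
proof (induction \<phi>s arbitrary: w)
  case (Cons \<phi> \<phi>s)
  have *: "(length w < length \<phi>s \<longrightarrow> convolution \<phi> (multi_convolution \<phi>s) (word w) = 0) \<and>
    (length w = length \<phi>s \<longrightarrow> convolution \<phi> (multi_convolution \<phi>s) (word w)
       = \<phi> 1 * multi_convolution \<phi>s (word w))"
    using Cons by (intro convolution_word_short functional_multi_convolution) auto
  show ?case using * Cons.prems by (auto simp: less_Suc_eq)
qed simp

text \<open>The value is the permanent of a 0-1 matrix, which is nonzero exactly if some permutation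
  matches the two index words.\<close>

lemma multi_convolution_basis:
  fixes \<phi> :: "nat \<Rightarrow> 'g::complex_lie_algebra uea \<Rightarrow> complex"
  assumes \<phi>: "\<And>i. i \<in> I \<Longrightarrow> functional (\<phi> i) \<and> \<phi> i 1 = 0"
    and b: "\<And>i j. i \<in> I \<Longrightarrow> j \<in> I \<Longrightarrow> \<phi> i (uea_inj (b j)) = (if i = j then 1 else 0)"
  shows "length v = length w \<Longrightarrow> set v \<subseteq> I \<Longrightarrow> set w \<subseteq> I \<Longrightarrow>
    \<exists>k :: nat. multi_convolution (map \<phi> v) (word (map b w)) = of_nat k \<and> (k > 0 \<longleftrightarrow> mset v = mset w)"
proof (induction v arbitrary: w)
  case Nil
  have "multi_convolution (map \<phi> []) (word (map b w)) = of_nat 1" using Nil by (simp add: counit(2)[of "[]", simplified])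
  then show ?case using Nil by (intro exI[of _ 1]) auto
next
  case (Cons i v)
  define del where "del p = take p w @ drop (Suc p) w" for p
  have mset_del: "add_mset (w ! p) (mset (del p)) = mset w" if "p < length w" for p
    using arg_cong[OF id_take_nth_drop[OF that], of mset] by (simp add: del_def)
  have del: "length v = length (del p)" "set (del p) \<subseteq> I" if "p < length w" for p
    using that Cons.prems by (auto simp: del_def dest: in_set_takeD in_set_dropD)
  have "\<forall>p. p < length w \<longrightarrow> (\<exists>k :: nat. multi_convolution (map \<phi> v) (word (map b (del p))) = of_nat k \<and>
      (k > 0 \<longleftrightarrow> mset v = mset (del p)))"
    using Cons.IH del Cons.prems by auto
  then obtain K :: "nat \<Rightarrow> nat" where K: "\<And>p. p < length w \<Longrightarrow>
      multi_convolution (map \<phi> v) (word (map b (del p))) = of_nat (K p) \<and> (K p > 0 \<longleftrightarrow> mset v = mset (del p))"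
    by metis
  have "multi_convolution (map \<phi> (i # v)) (word (map b w))
    = (\<Sum>p<length (map b w). \<phi> i (uea_inj (map b w ! p)) *
        multi_convolution (map \<phi> v) (word (take p (map b w) @ drop (Suc p) (map b w))))"
    unfolding list.map multi_convolution.simps
    using Cons.prems \<phi>
    by (intro convolution_word[where k = "length v"] functional_multi_convolution multi_convolution_short) auto
  also have "\<dots> = (\<Sum>p<length w. of_nat (if w ! p = i then K p else 0))"
  proof (intro sum.cong)
    fix p assume "p \<in> {..<length w}"
    then have p: "p < length w" by simp
    have "take p (map b w) @ drop (Suc p) (map b w) = map b (del p)"
      by (simp add: del_def take_map drop_map)
    moreover have "\<phi> i (uea_inj (b (w ! p))) = (if w ! p = i then 1 else 0)"
      using Cons.prems p b[of i "w ! p"] by (auto simp: subset_iff)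
    ultimately show "\<phi> i (uea_inj (map b w ! p)) *
        multi_convolution (map \<phi> v) (word (take p (map b w) @ drop (Suc p) (map b w)))
        = of_nat (if w ! p = i then K p else 0)"
      using K[OF p] p by simp
  qed simp
  also have "\<dots> = of_nat (\<Sum>p<length w. if w ! p = i then K p else 0)" by simp
  finally have eq: "multi_convolution (map \<phi> (i # v)) (word (map b w))
    = of_nat (\<Sum>p<length w. if w ! p = i then K p else 0)" .
  have "(\<Sum>p<length w. if w ! p = i then K p else 0) > 0 \<longleftrightarrow> (\<exists>p<length w. w ! p = i \<and> mset v = mset (del p))"
    using K by (auto simp: sum_eq_0_iff simp flip: neq0_conv split: if_splits)
  also have "\<dots> \<longleftrightarrow> mset (i # v) = mset w"
  proof
    assume "mset (i # v) = mset w"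
    then have "i \<in> set w" by (metis list.set_intros(1) set_mset_mset)
    then obtain p where "p < length w" "w ! p = i" by (auto simp: in_set_conv_nth)
    then show "\<exists>p<length w. w ! p = i \<and> mset v = mset (del p)"
      using mset_del[of p] \<open>mset (i # v) = mset w\<close> by (intro exI[of _ p]) (auto simp flip: \<open>mset (i # v) = mset w\<close>)
  qed (auto simp: mset_del)
  finally have pos: "(\<Sum>p<length w. if w ! p = i then K p else 0) > 0 \<longleftrightarrow> mset (i # v) = mset w" .
  show ?case by (rule exI, rule conjI, rule eq, rule pos)
qed

lemma sorted_words_independent:
  fixes b :: "nat \<Rightarrow> 'g::complex_lie_algebra"
  assumes centre: "\<And>x :: 'g. (\<And>z. lie x z = 0) \<Longrightarrow> x = 0"
    and b: "cvs.independent (b ` I)" "inj_on b I"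
    and W: "finite W" "\<And>w. w \<in> W \<Longrightarrow> sorted w \<and> set w \<subseteq> I"
    and zero: "(\<Sum>w\<in>W. c w *\<^sub>C word (map b w)) = 0"
  shows "\<forall>w\<in>W. c w = 0"
proof (rule ccontr)
  assume "\<not> (\<forall>w\<in>W. c w = 0)"
  then have ne: "finite {w\<in>W. c w \<noteq> 0}" "{w\<in>W. c w \<noteq> 0} \<noteq> {}" using W(1) by auto
  \<comment> \<open>At maximal length every other word with nonzero coefficient is shorter than v,
    and then killed by M, or equally long and, being sorted, not a permutation of v.\<close>
  define n where "n = Max (length ` {w\<in>W. c w \<noteq> 0})"
  have "n \<in> length ` {w\<in>W. c w \<noteq> 0}" unfolding n_def using ne by (intro Max_in) auto
  then obtain v where v: "v \<in> W" "c v \<noteq> 0" "length v = n" by auto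
  have le: "length w \<le> n" if "w \<in> W" "c w \<noteq> 0" for w
    unfolding n_def using that ne by (intro Max_ge) auto
  have "\<forall>i. \<exists>\<phi> :: 'g uea \<Rightarrow> complex. functional \<phi> \<and> \<phi> 1 = 0 \<and> (\<forall>j\<in>I. i \<in> I \<longrightarrow> \<phi> (uea_inj (b j)) = (if i = j then 1 else 0))"
  proof
    fix i
    obtain \<phi> :: "'g uea \<Rightarrow> complex" where "functional \<phi>" "\<phi> 1 = 0"
      "\<And>b'. b' \<in> b ` I \<Longrightarrow> \<phi> (uea_inj b') = (if b' = b i then 1 else 0)"
      by (rule dual_functional[where B = "b ` I" and b = "b i"]) (rule centre, blast, rule b(1), rule that)
    then show "\<exists>\<phi> :: 'g uea \<Rightarrow> complex. functional \<phi> \<and> \<phi> 1 = 0 \<and> (\<forall>j\<in>I. i \<in> I \<longrightarrow> \<phi> (uea_inj (b j)) = (if i = j then 1 else 0))"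
      using b(2) by (intro exI[of _ \<phi>]) (auto simp: inj_on_eq_iff)
  qed
  then obtain \<phi> :: "nat \<Rightarrow> 'g uea \<Rightarrow> complex" where \<phi>: "\<And>i. functional (\<phi> i) \<and> \<phi> i 1 = 0"
    "\<And>i j. i \<in> I \<Longrightarrow> j \<in> I \<Longrightarrow> \<phi> i (uea_inj (b j)) = (if i = j then 1 else 0)"
    by metis
  define M where "M = multi_convolution (map \<phi> v)"
  have M: "functional M" unfolding M_def using \<phi> by (intro functional_multi_convolution) auto
  have other: "c w * M (word (map b w)) = 0" if w: "w \<in> W" "w \<noteq> v" for w
  proof (cases "c w = 0 \<or> length w < n")
    case True
    then show ?thesis using v \<phi> by (auto simp: M_def intro!: multi_convolution_short)
  next
    case False
    then have len: "length v = length w" using le w v by force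
    have "mset v \<noteq> mset w"
      using W(2) w v by (metis properties_for_sort)
    then show ?thesis
      using multi_convolution_basis[of I \<phi> b v w] \<phi> W(2) w v len by (auto simp: M_def)
  qed
  have rest: "(\<Sum>w\<in>W - {v}. c w * M (word (map b w))) = 0"
    by (rule sum.neutral) (use other in blast)
  have "0 = M (\<Sum>w\<in>W. c w *\<^sub>C word (map b w))" by (simp add: zero functional_zero M)
  also have "\<dots> = (\<Sum>w\<in>W. c w * M (word (map b w)))" by (simp add: functional_sum functional_scaleC M)
  also have "\<dots> = c v * M (word (map b v))"
    using W(1) v rest by (subst sum.remove[of _ v]) auto
  finally have "M (word (map b v)) = 0" using v by simp
  \<comment> \<open>The value at v itself is a positive integer, hence nonzero as a complex
    number.\<close>
  then show False
    using multi_convolution_basis[of I \<phi> b v v] \<phi> W(2) v by (auto simp: M_def)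
qed

section \<open>Ordered monomials span the enveloping algebra\<close>

lemma poly_mapping_keys_induct [consumes 1, case_names zero add single]:
  fixes p :: "'k \<Rightarrow>\<^sub>0 'r::ab_group_add"
  assumes "Poly_Mapping.keys p \<subseteq> A" and "P 0" and "\<And>p q. P p \<Longrightarrow> P q \<Longrightarrow> P (p + q)"
    and "\<And>k c. k \<in> A \<Longrightarrow> P (Poly_Mapping.single k c)"
  shows "P p"
  using assms(1)
proof (induction p rule: poly_mapping_single_induct)
  case (single_add p k c)
  show ?case
  proof (cases "c = 0")
    case False
    have "Poly_Mapping.keys (p + Poly_Mapping.single k c) = insert k (Poly_Mapping.keys p)"
      using single_add.hyps False
      by (auto simp: in_keys_iff lookup_add lookup_single when_def split: if_splits)
    then show ?thesis using single_add assms(3,4) by auto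
  qed (use single_add in simp)
qed (simp add: assms)

lemma keys_add_subset: "Poly_Mapping.keys p \<subseteq> A \<Longrightarrow> Poly_Mapping.keys q \<subseteq> A \<Longrightarrow> Poly_Mapping.keys (p + q) \<subseteq> A"
  using keys_add[of p q] by blast

text \<open>A general commutative ring, since the spanning half of the theorem is applied over
  C[[\<xi>]] with \<open>b\<close> a finite generating family of constant series. The computation
  stays in the free algebra modulo \<open>J\<close> because \<open>generates_uea_copy\<close> speaks
  about a kernel there.\<close>

locale uea_relation_ideal =
  fixes scale :: "'r::comm_ring_1 \<Rightarrow> 'v \<Rightarrow> 'v::ab_group_add" and br :: "'v \<Rightarrow> 'v \<Rightarrow> 'v" and L :: "'v set"
    and b :: "nat \<Rightarrow> 'v" and d :: nat
  assumes closed: "0 \<in> L" "\<And>x y. x \<in> L \<Longrightarrow> y \<in> L \<Longrightarrow> x + y \<in> L" "\<And>c x. x \<in> L \<Longrightarrow> scale c x \<in> L"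
      "\<And>x y. x \<in> L \<Longrightarrow> y \<in> L \<Longrightarrow> br x y \<in> L"
    and scale_0: "scale 0 0 = 0"
    and b: "\<And>i. i < d \<Longrightarrow> b i \<in> L"
    and expand: "\<And>x. x \<in> L \<Longrightarrow> \<exists>c. x = (\<Sum>i<d. scale (c i) (b i))"
begin

abbreviation "F \<equiv> free_algebra L :: ('v list \<Rightarrow>\<^sub>0 'r) set"
abbreviation "J \<equiv> uea_ideal scale br L"

lemma F_mult: "p \<in> F \<Longrightarrow> q \<in> F \<Longrightarrow> p * q \<in> F"
  using keys_mult[of p q] unfolding free_algebra_def plus_list_def by fastforce

lemma F_single: "w \<in> lists L \<Longrightarrow> Poly_Mapping.single w c \<in> F"
  by (auto simp: free_algebra_def)

lemma F_scalar: "Poly_Mapping.single 0 c \<in> F"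
  by (auto simp: free_algebra_def zero_list_def)

lemma J_base: "r \<in> uea_relations scale br L \<Longrightarrow> r \<in> J"
  using ideal_gen_step[OF ideal_gen_zero, of 1 F 1 r] F_scalar[of 1] by (simp add: uea_ideal_def)

lemma J_zero: "0 \<in> J"
  by (simp add: uea_ideal_def ideal_gen_zero)

lemma J_add: "x \<in> J \<Longrightarrow> y \<in> J \<Longrightarrow> x + y \<in> J"
  by (simp add: uea_ideal_def ideal_gen_add)

lemma J_mult:
  assumes "x \<in> J" "p \<in> F" "q \<in> F" shows "p * x * q \<in> J"
  unfolding uea_ideal_def
  using assms(1)[unfolded uea_ideal_def]
proof (induction rule: ideal_gen.induct)
  case (ideal_gen_step x a c r)
  then have "p * x * q + (p * a) * r * (c * q) \<in> ideal_gen F (uea_relations scale br L)"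
    using assms by (intro ideal_gen.ideal_gen_step F_mult) auto
  then show ?case by (simp add: algebra_simps)
qed (simp add: ideal_gen_zero)

lemma J_mult_left: "x \<in> J \<Longrightarrow> p \<in> F \<Longrightarrow> p * x \<in> J"
  using J_mult[of x p 1] F_scalar[of 1] by simp

lemma J_mult_right: "x \<in> J \<Longrightarrow> p \<in> F \<Longrightarrow> x * p \<in> J"
  using J_mult[of x 1 p] F_scalar[of 1] by simp

abbreviation letter :: "'v \<Rightarrow> 'v list \<Rightarrow>\<^sub>0 'r" where "letter x \<equiv> Poly_Mapping.single [x] 1"

lemma letter_add:
  assumes "x \<in> L" "y \<in> L" shows "letter (x + y) - (letter x + letter y) \<in> J"
proof -
  have "letter (x + y) - letter x - letter y \<in> J"
    using assms by (intro J_base) (auto simp: uea_relations_def)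
  then show ?thesis by (simp add: diff_diff_add)
qed

lemma letter_scale: "x \<in> L \<Longrightarrow> letter (scale c x) - Poly_Mapping.single [x] c \<in> J"
  by (rule J_base) (auto simp: uea_relations_def)

lemma letter_sum:
  assumes "\<And>i. i < (k :: nat) \<Longrightarrow> x i \<in> L"
  shows "(\<Sum>i<k. scale (c i) (x i)) \<in> L \<and>
    letter (\<Sum>i<k. scale (c i) (x i)) - (\<Sum>i<k. Poly_Mapping.single [x i] (c i)) \<in> J"
  using assms
proof (induction k)
  case 0
  \<comment> \<open>The one-letter word of the vector 0 is not the zero of the free algebra; the
    relation for the scalar 0 puts it into \<open>J\<close>.\<close>
  then show ?case using letter_scale[of 0 0] closed(1) by (simp add: scale_0)
next
  case (Suc k)
  then have IH: "(\<Sum>i<k. scale (c i) (x i)) \<in> L"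
    "letter (\<Sum>i<k. scale (c i) (x i)) - (\<Sum>i<k. Poly_Mapping.single [x i] (c i)) \<in> J" and x: "x k \<in> L" by auto
  have "letter (\<Sum>i<Suc k. scale (c i) (x i)) - (\<Sum>i<Suc k. Poly_Mapping.single [x i] (c i))
    = (letter ((\<Sum>i<k. scale (c i) (x i)) + scale (c k) (x k))
        - (letter (\<Sum>i<k. scale (c i) (x i)) + letter (scale (c k) (x k))))
     + (letter (\<Sum>i<k. scale (c i) (x i)) - (\<Sum>i<k. Poly_Mapping.single [x i] (c i)))
     + (letter (scale (c k) (x k)) - Poly_Mapping.single [x k] (c k))"
    by simp
  also have "\<dots> \<in> J"
    using IH x by (intro J_add letter_add letter_scale closed)
  finally show ?case using IH x closed by simp
qed

definition basis_words :: "nat \<Rightarrow> 'v list set"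
  where "basis_words n = map b ` {w. set w \<subseteq> {..<d} \<and> length w \<le> n}"

definition sorted_basis_words :: "nat \<Rightarrow> 'v list set"
  where "sorted_basis_words n = map b ` {w. sorted w \<and> set w \<subseteq> {..<d} \<and> length w \<le> n}"

text \<open>The standard filtration of the enveloping algebra, pulled back to the free
  algebra.\<close>

definition filtered :: "nat \<Rightarrow> ('v list \<Rightarrow>\<^sub>0 'r) set"
  where "filtered n = {p. \<exists>q. Poly_Mapping.keys q \<subseteq> basis_words n \<and> p - q \<in> J}"

lemma filteredI: "Poly_Mapping.keys q \<subseteq> basis_words n \<Longrightarrow> p - q \<in> J \<Longrightarrow> p \<in> filtered n"
  by (auto simp: filtered_def)

lemma filtered_J: "p \<in> J \<Longrightarrow> p \<in> filtered n"
  by (rule filteredI[of 0]) auto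

lemma filtered_add:
  assumes "p \<in> filtered n" "q \<in> filtered n" shows "p + q \<in> filtered n"
proof -
  obtain p' q' where *: "Poly_Mapping.keys p' \<subseteq> basis_words n" "Poly_Mapping.keys q' \<subseteq> basis_words n"
    "p - p' \<in> J" "q - q' \<in> J" using assms by (auto simp: filtered_def)
  then have "(p - p') + (q - q') \<in> J" by (intro J_add)
  then have "p + q - (p' + q') \<in> J" by (simp add: algebra_simps)
  with * show ?thesis by (intro filteredI[of "p' + q'"] keys_add_subset)
qed

lemma filtered_scalar:
  assumes "p \<in> filtered n" shows "Poly_Mapping.single 0 c * p \<in> filtered n"
proof -
  obtain q where q: "Poly_Mapping.keys q \<subseteq> basis_words n" "p - q \<in> J"
    using assms by (auto simp: filtered_def)
  have "Poly_Mapping.keys (Poly_Mapping.single 0 c * q) \<subseteq> basis_words n"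
    using keys_mult[of "Poly_Mapping.single 0 c" q] q(1) by (auto split: if_splits)
  moreover have "Poly_Mapping.single 0 c * p - Poly_Mapping.single 0 c * q \<in> J"
    using J_mult_left[OF q(2) F_scalar] by (simp add: right_diff_distrib)
  ultimately show ?thesis by (rule filteredI)
qed

lemma filtered_single: "w \<in> basis_words n \<Longrightarrow> Poly_Mapping.single w c \<in> filtered n"
  by (rule filteredI[of "Poly_Mapping.single w c"]) (auto simp: J_zero)

lemma filtered_sum: "(\<And>i. i \<in> A \<Longrightarrow> p i \<in> filtered n) \<Longrightarrow> sum p A \<in> filtered n"
  by (induction A rule: infinite_finite_induct) (auto intro: filtered_add filtered_J J_zero)

lemma filtered_basis_mult:
  assumes "p \<in> filtered n" "i < d" shows "Poly_Mapping.single [b i] c * p \<in> filtered (Suc n)"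
proof -
  obtain q where q: "Poly_Mapping.keys q \<subseteq> basis_words n" "p - q \<in> J"
    using assms by (auto simp: filtered_def)
  have "b i # w \<in> basis_words (Suc n)" if w: "w \<in> basis_words n" for w
  proof -
    obtain v where "w = map b v" "set v \<subseteq> {..<d}" "length v \<le> n"
      using w unfolding basis_words_def by blast
    then show ?thesis using assms(2) unfolding basis_words_def by (intro image_eqI[of _ _ "i # v"]) auto
  qed
  then have "Poly_Mapping.keys (Poly_Mapping.single [b i] c * q) \<subseteq> basis_words (Suc n)"
    using keys_mult[of "Poly_Mapping.single [b i] c" q] q(1)
    by (cases "c = 0") (simp, simp add: plus_list_def, blast)
  moreover have "Poly_Mapping.single [b i] c * p - Poly_Mapping.single [b i] c * q \<in> J"
    using J_mult_left[OF q(2) F_single, of "[b i]" c] b[OF assms(2)] by (simp add: right_diff_distrib)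
  ultimately show ?thesis by (rule filteredI)
qed

lemma filtered_letter_mult:
  assumes "x \<in> L" "p \<in> filtered n" "p \<in> F" shows "letter x * p \<in> filtered (Suc n)"
proof -
  obtain c where c: "x = (\<Sum>i<d. scale (c i) (b i))" using expand[OF assms(1)] by blast
  have "letter x * p = (letter x - (\<Sum>i<d. Poly_Mapping.single [b i] (c i))) * p
     + (\<Sum>i<d. Poly_Mapping.single [b i] (c i) * p)"
    by (simp add: algebra_simps sum_distrib_right)
  also have "\<dots> \<in> filtered (Suc n)"
  proof (rule filtered_add)
    have "letter x - (\<Sum>i<d. Poly_Mapping.single [b i] (c i)) \<in> J"
      using letter_sum[of d b c] b by (simp add: c)
    then show "(letter x - (\<Sum>i<d. Poly_Mapping.single [b i] (c i))) * p \<in> filtered (Suc n)"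
      by (intro filtered_J J_mult_right assms)
  qed (use assms in \<open>auto intro!: filtered_sum filtered_basis_mult\<close>)
  finally show ?thesis .
qed

lemma free_algebra_filtered: "p \<in> F \<Longrightarrow> \<exists>n. p \<in> filtered n"
proof -
  have mono: "filtered m \<subseteq> filtered n" if "m \<le> n" for m n
    using that by (fastforce simp: filtered_def basis_words_def)
  have word: "\<exists>n. Poly_Mapping.single w (1::'r) \<in> filtered n" if "w \<in> lists L" for w
    using that
  proof (induction w)
    case Nil
    then show ?case by (intro exI[of _ 0] filtered_single) (auto simp: basis_words_def)
  next
    case (Cons x w)
    then obtain n where "Poly_Mapping.single w (1::'r) \<in> filtered n" by auto
    then have "letter x * Poly_Mapping.single w 1 \<in> filtered (Suc n)"
      using Cons by (intro filtered_letter_mult F_single) auto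
    then show ?case by (auto simp: mult_single plus_list_def)
  qed
  assume "p \<in> F"
  then have "Poly_Mapping.keys p \<subseteq> lists L" by (simp add: free_algebra_def)
  then show ?thesis
  proof (induction rule: poly_mapping_keys_induct)
    case zero
    then show ?case using filtered_J J_zero by blast
  next
    case (add p q)
    then obtain m n where "p \<in> filtered m" "q \<in> filtered n" by blast
    then show ?case
      using mono[of m "max m n"] mono[of n "max m n"] by (intro exI[of _ "max m n"] filtered_add) auto
  next
    case (single w c)
    then obtain n where "Poly_Mapping.single w (1::'r) \<in> filtered n" using word by blast
    from filtered_scalar[OF this, of c] show ?case by (auto simp: mult_single)
  qed
qed

abbreviation mono_of :: "nat list \<Rightarrow> 'v list \<Rightarrow>\<^sub>0 'r"
  where "mono_of w \<equiv> Poly_Mapping.single (map b w) 1"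

lemma mono_of_Cons: "mono_of (i # w) = letter (b i) * mono_of w"
  by (simp add: mult_single plus_list_def)

lemma mono_of_F: "set w \<subseteq> {..<d} \<Longrightarrow> mono_of w \<in> F"
  using b by (intro F_single) (auto simp: subset_iff)

text \<open>Modulo \<open>J\<close> an exchange of neighbours costs the letter of their bracket,
  which replaces two letters by one. Insertion sort therefore changes a word only by terms of
  smaller length.\<close>

lemma swap_filtered:
  assumes "i < d" "j < d" "set w \<subseteq> {..<d}"
  shows "mono_of (i # j # w) - mono_of (j # i # w) \<in> filtered (Suc (length w))"
proof -
  let ?r = "Poly_Mapping.single [b i, b j] 1 - Poly_Mapping.single [b j, b i] 1 - letter (br (b i) (b j))"
  have "?r \<in> J"
    using b[OF assms(1)] b[OF assms(2)]
    by (intro J_base) (unfold uea_relations_def, rule UnI2, blast)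
  moreover have "mono_of (i # j # w) - mono_of (j # i # w) = ?r * mono_of w + letter (br (b i) (b j)) * mono_of w"
    by (simp add: left_diff_distrib mult_single plus_list_def)
  moreover have "letter (br (b i) (b j)) * mono_of w \<in> filtered (Suc (length w))"
    using assms b closed
    by (intro filtered_letter_mult filtered_single mono_of_F) (auto simp: basis_words_def)
  ultimately show ?thesis
    using filtered_add[OF filtered_J[OF J_mult_right[OF _ mono_of_F[OF assms(3)]]]] by simp
qed

lemma insort_filtered:
  "i < d \<Longrightarrow> set w \<subseteq> {..<d} \<Longrightarrow> mono_of (i # w) - mono_of (insort i w) \<in> filtered (length w)"
proof (induction w)
  case Nil
  then show ?case using filtered_J J_zero by simp
next
  case (Cons j w)
  show ?case
  proof (cases "i \<le> j")
    case True
    then show ?thesis using filtered_J J_zero by simp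
  next
    case False
    have "mono_of (i # j # w) - mono_of (insort i (j # w))
      = (mono_of (i # j # w) - mono_of (j # i # w))
        + letter (b j) * (mono_of (i # w) - mono_of (insort i w))"
      using False by (simp add: mono_of_Cons right_diff_distrib mult_single plus_list_def)
    also have "\<dots> \<in> filtered (length (j # w))"
      using Cons swap_filtered[of i j w] filtered_basis_mult[of _ "length w" j 1]
      by (auto intro!: filtered_add)
    finally show ?thesis .
  qed
qed

lemma sort_filtered:
  "set w \<subseteq> {..<d} \<Longrightarrow> mono_of w - mono_of (sort w) \<in> filtered (length w - 1)"
proof (induction w)
  case Nil
  then show ?case using filtered_J J_zero by simp
next
  case (Cons i w)
  have 1: "letter (b i) * (mono_of w - mono_of (sort w)) \<in> filtered (length w)"
  \<comment> \<open>For empty w the truncated bound \<open>length w - 1\<close> is 0, and the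
    general estimate would give \<open>filtered 1\<close> in place of
    \<open>filtered 0\<close>.\<close>
  proof (cases w)
    case Nil
    then show ?thesis using filtered_J J_zero by simp
  next
    case (Cons j v)
    then show ?thesis using Cons.IH Cons.prems filtered_basis_mult[of _ "length w - 1" i 1] by auto
  qed
  have "mono_of (i # w) - mono_of (sort (i # w))
    = letter (b i) * (mono_of w - mono_of (sort w)) + (mono_of (i # sort w) - mono_of (insort i (sort w)))"
    by (simp add: right_diff_distrib mult_single plus_list_def)
  also have "\<dots> \<in> filtered (length w)"
    using 1 insort_filtered[of i "sort w"] Cons by (auto intro!: filtered_add)
  finally show ?case by simp
qed

text \<open>Sorting a word of length n + 1 leaves an error of length at most n, to which the
  induction hypothesis applies.\<close>

lemma sorted_words_span:
  "Poly_Mapping.keys p \<subseteq> basis_words n \<Longrightarrow> \<exists>q. Poly_Mapping.keys q \<subseteq> sorted_basis_words n \<and> p - q \<in> J"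
proof (induction n arbitrary: p)
  case 0
  have "basis_words 0 = sorted_basis_words 0" by (auto simp: basis_words_def sorted_basis_words_def)
  then show ?case using 0 J_zero by (intro exI[of _ p]) auto
next
  case (Suc n)
  have mono: "sorted_basis_words n \<subseteq> sorted_basis_words (Suc n)"
    by (auto simp: sorted_basis_words_def)
  show ?case using Suc.prems
  proof (induction rule: poly_mapping_keys_induct)
    case zero
    then show ?case using J_zero by (intro exI[of _ 0]) auto
  next
    case (add p q)
    then obtain p' q' where *: "Poly_Mapping.keys p' \<subseteq> sorted_basis_words (Suc n)"
      "Poly_Mapping.keys q' \<subseteq> sorted_basis_words (Suc n)" "p - p' \<in> J" "q - q' \<in> J" by blast
    then have "(p - p') + (q - q') \<in> J" by (intro J_add)
    then have "p + q - (p' + q') \<in> J" by (simp add: algebra_simps)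
    with * show ?case by (intro exI[of _ "p' + q'"] conjI keys_add_subset)
  next
    case (single k c)
    then obtain w where w: "k = map b w" "set w \<subseteq> {..<d}" "length w \<le> Suc n"
      by (auto simp: basis_words_def)
    have "mono_of w - mono_of (sort w) \<in> filtered (length w - 1)" by (rule sort_filtered[OF w(2)])
    then have "Poly_Mapping.single 0 c * (mono_of w - mono_of (sort w)) \<in> filtered (length w - 1)"
      by (rule filtered_scalar)
    then obtain q where q: "Poly_Mapping.keys q \<subseteq> basis_words (length w - 1)"
      "Poly_Mapping.single (map b w) c - Poly_Mapping.single (map b (sort w)) c - q \<in> J"
      by (auto simp: filtered_def right_diff_distrib mult_single)
    have "basis_words (length w - 1) \<subseteq> basis_words n" using w(3) by (auto simp: basis_words_def)
    then obtain q' where q': "Poly_Mapping.keys q' \<subseteq> sorted_basis_words n" "q - q' \<in> J"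
      using Suc.IH[of q] q(1) by blast
    have "map b (sort w) \<in> sorted_basis_words (Suc n)"
      using w by (auto simp: sorted_basis_words_def)
    then have "Poly_Mapping.keys (Poly_Mapping.single (map b (sort w)) c + q') \<subseteq> sorted_basis_words (Suc n)"
      using q'(1) mono by (intro keys_add_subset) auto
    moreover have "Poly_Mapping.single k c - (Poly_Mapping.single (map b (sort w)) c + q') \<in> J"
      using J_add[OF q(2) q'(2)] by (simp add: w(1) algebra_simps)
    ultimately show ?case by blast
  qed
qed

lemma normal_form: "p \<in> F \<Longrightarrow> \<exists>n q. Poly_Mapping.keys q \<subseteq> sorted_basis_words n \<and> p - q \<in> J"
proof -
  assume "p \<in> F"
  then obtain n where "p \<in> filtered n" using free_algebra_filtered by blast
  then obtain q where q: "Poly_Mapping.keys q \<subseteq> basis_words n" "p - q \<in> J"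
    unfolding filtered_def by blast
  obtain q' where "Poly_Mapping.keys q' \<subseteq> sorted_basis_words n" "q - q' \<in> J"
    using sorted_words_span[OF q(1)] by blast
  then show ?thesis using J_add[OF q(2), of "q - q'"] by (intro exI[of _ n] exI[of _ q']) simp
qed

end

section \<open>Deformed copies of the enveloping algebra of a subalgebra\<close>

lemma fps_lie_nth: "fps_nth (fps_lie x y) n = (\<Sum>i=0..n. lie (fps_nth x i) (fps_nth y (n - i)))"
  by (simp add: fps_lie_def)

lemma fps_scale_nth: "fps_nth (fps_scale c x) n = (\<Sum>i=0..n. fps_nth c i *\<^sub>C fps_nth x (n - i))"
  by (simp add: fps_scale_def)

lemma lie_subalgebra_subspace:
  assumes "lie_subalgebra scaleC lie (S :: 'g::complex_lie_algebra set)"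
  shows "cvs.subspace S"
  using assms unfolding lie_subalgebra_def by (intro cvs.subspaceI) blast+

lemma fps_over_closed:
  assumes S: "lie_subalgebra scaleC lie (S :: 'g::complex_lie_algebra set)"
  shows "0 \<in> fps_over S" "x \<in> fps_over S \<Longrightarrow> y \<in> fps_over S \<Longrightarrow> x + y \<in> fps_over S"
    "x \<in> fps_over S \<Longrightarrow> fps_scale c x \<in> fps_over S"
    "x \<in> fps_over S \<Longrightarrow> y \<in> fps_over S \<Longrightarrow> fps_lie x y \<in> fps_over S"
proof -
  have *: "0 \<in> S" "\<And>x y. x \<in> S \<Longrightarrow> y \<in> S \<Longrightarrow> x + y \<in> S" "\<And>c x. x \<in> S \<Longrightarrow> c *\<^sub>C x \<in> S"
    "\<And>x y. x \<in> S \<Longrightarrow> y \<in> S \<Longrightarrow> lie x y \<in> S"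
    using S unfolding lie_subalgebra_def by blast+
  note sum = cvs.subspace_sum[OF lie_subalgebra_subspace[OF S]]
  show "0 \<in> fps_over S" by (simp add: fps_over_def *(1))
  show "x \<in> fps_over S \<Longrightarrow> y \<in> fps_over S \<Longrightarrow> x + y \<in> fps_over S" by (simp add: fps_over_def *(2))
  show "x \<in> fps_over S \<Longrightarrow> fps_scale c x \<in> fps_over S"
    by (auto simp: fps_over_def fps_scale_nth intro!: sum *(3))
  show "x \<in> fps_over S \<Longrightarrow> y \<in> fps_over S \<Longrightarrow> fps_lie x y \<in> fps_over S"
    by (auto simp: fps_over_def fps_lie_nth intro!: sum *(4))
qed

lemma fps_prod_list_nth_0: "fps_nth (prod_list xs) 0 = prod_list (map (\<lambda>x. fps_nth x 0) xs)"
  for xs :: "'a::ring_1 fps list"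
  by (induction xs) simp_all

text \<open>As \<open>f\<close> is the identity modulo \<open>\<xi>\<close>, the lowest coefficient of a combination of ordered
  monomials in the image is the same combination in \<open>U(g)\<close>.\<close>

theorem deformed_uea_copy:
  fixes S :: "'g::complex_lie_algebra set" and f :: "'g fps \<Rightarrow> 'g uea fps"
  assumes centre: "\<And>x :: 'g. (\<And>z. lie x z = 0) \<Longrightarrow> x = 0"
    and S: "lie_subalgebra scaleC lie S"
    and fin: "finite (C :: 'g set)" "S \<subseteq> cvs.span C"
    and f: "\<And>x y. x \<in> fps_over S \<Longrightarrow> y \<in> fps_over S \<Longrightarrow> f (x + y) = f x + f y"
      "\<And>c x. x \<in> fps_over S \<Longrightarrow> f (fps_scale c x) = fps_scale c (f x)"
      "\<And>x y. x \<in> fps_over S \<Longrightarrow> y \<in> fps_over S \<Longrightarrow> f (fps_lie x y) = commutator (f x) (f y)"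
    and f0: "\<And>x. x \<in> fps_over S \<Longrightarrow> fps_nth (f x) 0 = uea_inj (fps_nth x 0)"
  shows "generates_uea_copy fps_scale fps_lie (fps_over S) fps_scale f"
proof -
  have sub: "cvs.subspace S" by (rule lie_subalgebra_subspace[OF S])
  obtain Bs where Bs: "Bs \<subseteq> S" "cvs.independent Bs" "S \<subseteq> cvs.span Bs"
    using cvs.maximal_independent_subset by blast
  have "finite Bs"
    using cvs.independent_span_bound[OF fin(1) Bs(2)] Bs(1) fin(2) by blast
  then obtain b d where bd: "Bs = b ` {..<d::nat}" "inj_on b {..<d}"
    using finite_imp_nat_seg_image_inj_on[of Bs] by (auto simp: lessThan_def)
  have coord: "\<exists>c. x = (\<Sum>i<d. c i *\<^sub>C b i)" if "x \<in> S" for x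
  proof -
    have "x \<in> cvs.span (b ` {..<d})" using that Bs bd by auto
    then obtain c where "x = (\<Sum>v\<in>b ` {..<d}. c v *\<^sub>C v)"
      by (auto simp: cvs.span_finite)
    then show ?thesis using bd(2) by (intro exI[of _ "c \<circ> b"]) (simp add: sum.reindex)
  qed
  have expand: "\<exists>c. x = (\<Sum>i<d. fps_scale (c i) (fps_const (b i)))" if "x \<in> fps_over S" for x
  proof -
    have "\<forall>n. \<exists>c. fps_nth x n = (\<Sum>i<d. c i *\<^sub>C b i)"
      using coord that by (auto simp: fps_over_def)
    from choice[OF this] obtain c where c: "\<And>n. fps_nth x n = (\<Sum>i<d. c n i *\<^sub>C b i)" by blast
    have "fps_nth (fps_scale (Abs_fps (\<lambda>n. c n i)) (fps_const (b i))) n = c n i *\<^sub>C b i" for i n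
    proof -
      have "fps_nth (fps_scale (Abs_fps (\<lambda>n. c n i)) (fps_const (b i))) n
        = (\<Sum>k=0..n. if k = n then c k i *\<^sub>C b i else 0)"
        unfolding fps_scale_nth by (intro sum.cong) auto
      then show ?thesis by simp
    qed
    then have "x = (\<Sum>i<d. fps_scale (Abs_fps (\<lambda>n. c n i)) (fps_const (b i)))"
      by (simp add: fps_eq_iff fps_sum_nth c)
    then show ?thesis by (rule exI[of _ "\<lambda>i. Abs_fps (\<lambda>n. c n i)"])
  qed
  interpret I: uea_relation_ideal fps_scale fps_lie "fps_over S" "\<lambda>i. fps_const (b i)" d
  proof
    show "fps_scale 0 (0 :: 'g fps) = 0" by (simp add: fps_eq_iff fps_scale_nth)
    show "fps_const (b i) \<in> fps_over S" if "i < d" for i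
      using that Bs bd cvs.subspace_0[OF sub] by (auto simp: fps_over_def)
  qed (use fps_over_closed[OF S] expand in auto)
  have sr: "fps_scale c (x + y) = fps_scale c x + fps_scale c y"
    and sl: "fps_scale (c + c') x = fps_scale c x + fps_scale c' x"
    and ss: "fps_scale c x * fps_scale c' y = fps_scale (c * c') (x * y)"
    and s1: "fps_scale 1 x = x"
    for c c' and x y :: "'g uea fps"
    using fps_scalar_left_commute[of x c' y]
    by (simp_all add: fps_scale_conv fps_scalar_add fps_scalar_mult fps_scalar_one distrib_left
        distrib_right mult.assoc)
  let ?ev = "free_eval fps_scale f"
  have diff: "?ev (p - q) = ?ev p - ?ev q" for p q
    unfolding free_eval_def by (rule linear_ext_diff[OF sr sl])
  have zero: "?ev p = 0" if "p \<in> uea_ideal fps_scale fps_lie (fps_over S)" for p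
    by (rule free_eval_uea_ideal[OF sr sl ss s1 f(1) f(2) f(3)[unfolded commutator_def] that])
  have "p \<in> uea_ideal fps_scale fps_lie (fps_over S)" if p: "p \<in> free_algebra (fps_over S)" "?ev p = 0" for p
  proof -
    obtain n q where q: "Poly_Mapping.keys q \<subseteq> I.sorted_basis_words n"
      "p - q \<in> uea_ideal fps_scale fps_lie (fps_over S)"
      using I.normal_form[OF p(1)] by blast
    then have "?ev q = 0" using zero[OF q(2)] p(2) diff[of p q] by simp
    let ?b = "map (\<lambda>i. fps_const (b i))"
    define W where "W = {w. sorted w \<and> set w \<subseteq> {..<d} \<and> ?b w \<in> Poly_Mapping.keys q}"
    have "inj_on (\<lambda>i. fps_const (b i)) {..<d}"
      using bd(2) by (auto simp: inj_on_def fps_eq_iff)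
    then have "inj_on ?b (lists {..<d})" by (rule inj_on_map_lists)
    then have inj: "inj_on ?b W" by (rule inj_on_subset) (auto simp: W_def)
    have keys: "Poly_Mapping.keys q = ?b ` W"
      using q(1) by (auto simp: W_def I.sorted_basis_words_def)
    then have finW: "finite W" using inj by (metis finite_imageD finite_keys)
    define c where "c w = Poly_Mapping.lookup q (?b w)" for w
    have ev: "?ev q = (\<Sum>w\<in>W. fps_scale (c w) (prod_list (map f (?b w))))"
      unfolding free_eval_def linear_ext_def keys by (simp add: sum.reindex[OF inj] c_def)
    have word0: "fps_nth (prod_list (map f (?b w))) 0 = word (map b w)" if "w \<in> W" for w
    proof -
      have "fps_nth (f (fps_const (b i))) 0 = uea_inj (b i)" if "i \<in> set w" for i
        using that \<open>w \<in> W\<close> f0[of "fps_const (b i)"] I.b[of i] by (auto simp: W_def)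
      then show ?thesis
        unfolding fps_prod_list_nth_0 word_def by (auto intro!: arg_cong[of _ _ prod_list])
    qed
    have "\<forall>w\<in>W. fps_nth (c w) m = 0" for m
    proof (induction m rule: less_induct)
      case (less m)
      have "fps_nth (fps_scale (c w) x) m = fps_nth (c w) m *\<^sub>C fps_nth x 0" if "w \<in> W" for w and x :: "'g uea fps"
      proof -
        have "fps_nth (fps_scale (c w) x) m = (\<Sum>i=0..m. if i = m then fps_nth (c w) m *\<^sub>C fps_nth x 0 else 0)"
          unfolding fps_scale_nth using less that by (intro sum.cong) auto
        then show ?thesis by simp
      qed
      then have "(\<Sum>w\<in>W. fps_nth (c w) m *\<^sub>C word (map b w)) = fps_nth (?ev q) m"
        by (simp add: ev fps_sum_nth word0 del: map_map)
      also have "\<dots> = 0" by (simp add: \<open>?ev q = 0\<close>)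
      finally show ?case
        by (intro sorted_words_independent[OF _ _ bd(2) finW])
          (use centre Bs(2) bd(1) in \<open>auto simp: W_def\<close>)
    qed
    then have "c w = 0" if "w \<in> W" for w using that by (simp add: fps_eq_iff)
    then have "W = {}" by (auto simp: W_def c_def in_keys_iff)
    then have "q = 0" using keys by simp
    then show ?thesis using q(2) by simp
  qed
  then show ?thesis using zero by (auto simp: generates_uea_copy_def)
qed

section \<open>Root strings\<close>

lemma lie_zero [simp]: "lie 0 x = 0" "lie x 0 = 0" for x :: "'g::complex_lie_algebra"
  using lie_scaleC_left[of 0 0 x] lie_scaleC_right[of x 0 0] by simp_all

lemma lie_sum_right: "lie x (sum f A) = (\<Sum>i\<in>A. lie x (f i))" for x :: "'g::complex_lie_algebra"
  by (induction A rule: infinite_finite_induct) (simp_all add: lie_add_right)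

lemma lie_anti: "lie x y = - lie y x" for x y :: "'g::complex_lie_algebra"
  using lie_self[of "x + y"] unfolding lie_add_left lie_add_right
  by (simp add: lie_self eq_neg_iff_add_eq_0 add.commute)

lemma lie_minus_left: "lie (- x) y = - lie x y" for x y :: "'g::complex_lie_algebra"
  using lie_scaleC_left[of "- 1" x y] by simp

lemma lie_minus_right: "lie x (- y) = - lie x y" for x y :: "'g::complex_lie_algebra"
  using lie_scaleC_right[of x "- 1" y] by simp

lemma lie_diff_right: "lie x (y - z) = lie x y - lie x z" for x y :: "'g::complex_lie_algebra"
  using lie_add_right[of x y "- z"] by (simp add: lie_minus_right)

lemma lie_leibniz: "lie x (lie y z) = lie (lie x y) z + lie y (lie x z)" for x y z :: "'g::complex_lie_algebra"
proof -
  have "lie y (lie z x) = - lie y (lie x z)" by (subst lie_anti[of z x]) (simp add: lie_minus_right)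
  moreover have "lie z (lie x y) = - lie (lie x y) z" by (rule lie_anti)
  ultimately show ?thesis using lie_jacobi[of x y z] by (simp add: algebra_simps)
qed

text \<open>T - ev \<beta> removes the summand of \<beta> and multiplies the sum by l - ev \<beta>,
  which is nonzero; this is an induction on the number of summands. The ev \<alpha> may coincide, as
  distinct roots may agree at one Cartan element.\<close>

lemma eigenvector_sum_zero:
  fixes T :: "'a::complex_space \<Rightarrow> 'a"
  assumes T: "\<And>x y. T (x + y) = T x + T y" "\<And>c x. T (c *\<^sub>C x) = c *\<^sub>C T x"
    and "finite R" "\<And>\<alpha>. \<alpha> \<in> R \<Longrightarrow> T (u \<alpha>) = ev \<alpha> *\<^sub>C u \<alpha> \<and> ev \<alpha> \<noteq> l"
    and "T (sum u R) = l *\<^sub>C sum u R"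
  shows "sum u R = 0"
  using assms(3-5)
proof (induction R arbitrary: u rule: finite_induct)
  case (insert \<beta> R)
  have Tm: "T (- x) = - T x" for x using T(2)[of "- 1" x] by simp
  have Ts: "T (sum f A) = (\<Sum>i\<in>A. T (f i))" for f :: "'b \<Rightarrow> 'a" and A
    using T(1) T(2)[of 0 0] by (induction A rule: infinite_finite_induct) simp_all
  let ?w = "\<lambda>\<alpha>. (ev \<alpha> - ev \<beta>) *\<^sub>C u \<alpha>"
  have "sum ?w R = sum ?w (insert \<beta> R)" using insert by simp
  also have "\<dots> = (\<Sum>\<alpha>\<in>insert \<beta> R. T (u \<alpha>) - ev \<beta> *\<^sub>C u \<alpha>)"
    by (rule sum.cong) (use insert.prems(1) in \<open>auto simp: cvs.scale_left_diff_distrib\<close>)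
  also have "\<dots> = T (sum u (insert \<beta> R)) - ev \<beta> *\<^sub>C sum u (insert \<beta> R)"
    by (simp only: Ts cvs.scale_sum_right sum_subtractf)
  also have "\<dots> = (l - ev \<beta>) *\<^sub>C sum u (insert \<beta> R)"
    by (simp add: insert.prems cvs.scale_left_diff_distrib)
  finally have w: "sum ?w R = (l - ev \<beta>) *\<^sub>C sum u (insert \<beta> R)" .
  have "sum ?w R = 0"
  proof (rule insert.IH)
    show "T (?w \<alpha>) = ev \<alpha> *\<^sub>C ?w \<alpha> \<and> ev \<alpha> \<noteq> l" if "\<alpha> \<in> R" for \<alpha>
      using insert.prems(1)[of \<alpha>] that by (simp add: T(2) mult.commute)
    show "T (sum ?w R) = l *\<^sub>C sum ?w R"
      unfolding w by (simp only: T(2) insert.prems(2)) (simp add: mult.commute)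
  qed
  then show ?case using w insert.prems(1)[of \<beta>] by auto
qed simp

text \<open>These are the facts about h that are read off from matrices; the structure of root
  strings is derived from them and the form alone.\<close>

locale cartan_roots =
  fixes h :: "'g::complex_lie_algebra set" and B :: "'g \<Rightarrow> 'g \<Rightarrow> complex"
  assumes h_subspace: "cvs.subspace h"
    and abelian: "K \<in> h \<Longrightarrow> K' \<in> h \<Longrightarrow> lie K K' = 0"
    and self_centralizing: "(\<And>K. K \<in> h \<Longrightarrow> lie K x = 0) \<Longrightarrow> x \<in> h"
    and decomposition: "x \<in> cvs.span (h \<union> (\<Union>\<alpha>\<in>roots h. root_space h \<alpha>))"
    and finite_roots: "finite (roots h)"
    and roots_separate: "K \<in> h \<Longrightarrow> (\<And>\<alpha>. \<alpha> \<in> roots h \<Longrightarrow> \<alpha> K = 0) \<Longrightarrow> K = 0"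
    and form: "invariant_form B"
begin

definition weight :: "('g \<Rightarrow> complex) \<Rightarrow> bool"
  where "weight \<alpha> \<longleftrightarrow> (\<forall>x. x \<notin> h \<longrightarrow> \<alpha> x = 0)"

lemma weight_0: "weight 0"
  and weight_add: "weight \<alpha> \<Longrightarrow> weight \<beta> \<Longrightarrow> weight (\<alpha> + \<beta>)"
  and weight_minus: "weight \<alpha> \<Longrightarrow> weight (- \<alpha>)"
  and weight_root: "\<alpha> \<in> roots h \<Longrightarrow> weight \<alpha>"
  by (auto simp: weight_def roots_def)

lemma weight_ext: "weight \<alpha> \<Longrightarrow> weight \<beta> \<Longrightarrow> (\<And>K. K \<in> h \<Longrightarrow> \<alpha> K = \<beta> K) \<Longrightarrow> \<alpha> = \<beta>"
  by (rule ext) (metis weight_def)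

lemma root_spaceD: "x \<in> root_space h \<alpha> \<Longrightarrow> K \<in> h \<Longrightarrow> lie K x = \<alpha> K *\<^sub>C x"
  by (simp add: root_space_def)

lemma root_space_subspace: "cvs.subspace (root_space h \<alpha>)"
  by (rule cvs.subspaceI) (auto simp: root_space_def lie_add_right lie_scaleC_right
      scaleC_add_right mult.commute)

lemma root_space_0: "root_space h 0 = h"
  using abelian self_centralizing by (auto simp: root_space_def)

lemma root_space_unique:
  assumes "weight \<alpha>" "weight \<beta>" "x \<in> root_space h \<alpha>" "x \<in> root_space h \<beta>" "x \<noteq> 0"
  shows "\<alpha> = \<beta>"
proof (rule weight_ext[OF assms(1,2)])
  fix K assume "K \<in> h"
  then have "\<alpha> K *\<^sub>C x = \<beta> K *\<^sub>C x" using assms(3,4) by (metis root_spaceD)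
  then show "\<alpha> K = \<beta> K" using assms(5) by simp
qed

lemma weight_vector_cases:
  assumes "weight \<alpha>" "x \<in> root_space h \<alpha>" "x \<noteq> 0"
  shows "\<alpha> \<in> insert 0 (roots h)"
  using assms by (auto simp: roots_def weight_def)

lemma root_vector_exists:
  assumes "\<alpha> \<in> roots h" obtains x where "x \<in> root_space h \<alpha>" "x \<noteq> 0"
proof -
  have "0 \<in> root_space h \<alpha>" by (rule cvs.subspace_0[OF root_space_subspace])
  then show ?thesis using assms that by (auto simp: roots_def)
qed

lemma lie_root_space:
  assumes "x \<in> root_space h \<alpha>" "y \<in> root_space h \<beta>"
  shows "lie x y \<in> root_space h (\<alpha> + \<beta>)"
  using assms by (auto simp: root_space_def lie_leibniz[of _ x y] lie_scaleC_left lie_scaleC_right scaleC_add_left)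

lemma decompose:
  obtains u where "\<And>\<alpha>. \<alpha> \<in> insert 0 (roots h) \<Longrightarrow> u \<alpha> \<in> root_space h \<alpha>"
    "x = sum u (insert 0 (roots h))"
proof -
  let ?R = "insert 0 (roots h)"
  have "\<exists>u. (\<forall>\<alpha>\<in>?R. u \<alpha> \<in> root_space h \<alpha>) \<and> x = sum u ?R"
    using decomposition
  proof (induction x rule: cvs.span_induct_alt)
    case base
    then show ?case
      using cvs.subspace_0[OF root_space_subspace] by (intro exI[of _ "\<lambda>_. 0"]) auto
  next
    case (step c x y)
    then obtain u where u: "\<forall>\<alpha>\<in>?R. u \<alpha> \<in> root_space h \<alpha>" "y = sum u ?R" by blast
    obtain \<beta> where \<beta>: "\<beta> \<in> ?R" "x \<in> root_space h \<beta>" using step(1) root_space_0 by auto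
    let ?u = "\<lambda>\<alpha>. (if \<alpha> = \<beta> then c *\<^sub>C x else 0) + u \<alpha>"
    have "\<forall>\<alpha>\<in>?R. ?u \<alpha> \<in> root_space h \<alpha>"
      using u(1) \<beta> by (auto intro!: cvs.subspace_add[OF root_space_subspace] cvs.subspace_scale[OF root_space_subspace])
    moreover have "c *\<^sub>C x + y = sum ?u ?R"
      using \<beta>(1) finite_roots by (simp only: sum.distrib u(2)[symmetric] sum.delta finite_insert if_True)
    ultimately show ?case by (intro exI[of _ ?u]) blast
  qed
  then show ?thesis using that by blast
qed

lemma form_add: "B (x + y) z = B x z + B y z" and form_scale: "B (c *\<^sub>C x) y = c * B x y"
  and form_sym: "B x y = B y x" and form_lie: "B (lie x y) z = B x (lie y z)"
  and form_nondegenerate: "(\<And>y. B x y = 0) \<Longrightarrow> x = 0"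
  using form unfolding invariant_form_def by blast+

lemma form_add_right: "B z (x + y) = B z x + B z y" and form_scale_right: "B x (c *\<^sub>C y) = c * B x y"
  using form_add form_scale form_sym by metis+

lemma form_zero: "B 0 x = 0" "B x 0 = 0"
  using form_scale[of 0 0 x] form_scale_right[of x 0 0] by simp_all

lemma form_sum_right: "B x (sum u A) = (\<Sum>i\<in>A. B x (u i))"
  by (induction A rule: infinite_finite_induct) (simp_all add: form_add_right form_zero)

lemma form_orthogonal:
  assumes "x \<in> root_space h \<alpha>" "y \<in> root_space h \<beta>" "K \<in> h" "\<alpha> K + \<beta> K \<noteq> 0"
  shows "B x y = 0"
proof -
  have "B (lie x K) y = B x (lie K y)" by (rule form_lie)
  moreover have "B (lie x K) y = - (\<alpha> K * B x y)"
    using assms form_scale[of "- 1" "\<alpha> K *\<^sub>C x" y] by (subst lie_anti) (simp add: root_spaceD form_scale)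
  moreover have "B x (lie K y) = \<beta> K * B x y" using assms by (simp add: root_spaceD form_scale_right)
  ultimately have "\<beta> K * B x y = - (\<alpha> K * B x y)" by simp
  then have "(\<alpha> K + \<beta> K) * B x y = 0" by (simp add: distrib_right)
  then show ?thesis using assms by simp
qed

text \<open>By nondegeneracy x pairs nontrivially with some weight component of some vector, and
  orthogonality leaves only the weight -\<alpha>.\<close>

lemma form_pairing:
  assumes "weight \<alpha>" "x \<in> root_space h \<alpha>" "x \<noteq> 0"
  obtains y where "y \<in> root_space h (- \<alpha>)" "B x y = 1"
proof -
  obtain z where z: "B x z \<noteq> 0" using form_nondegenerate assms(3) by blast
  obtain u where u: "\<And>\<beta>. \<beta> \<in> insert 0 (roots h) \<Longrightarrow> u \<beta> \<in> root_space h \<beta>"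
    "z = sum u (insert 0 (roots h))" by (rule decompose[of z]) (rule that)
  obtain \<beta> where \<beta>: "\<beta> \<in> insert 0 (roots h)" "B x (u \<beta>) \<noteq> 0"
    using z unfolding u(2) form_sum_right by (meson sum.neutral)
  have "\<beta> = - \<alpha>"
  proof (rule weight_ext)
    show "weight \<beta>" using \<beta>(1) weight_root weight_0 by auto
    fix K assume "K \<in> h"
    then have "\<alpha> K + \<beta> K = 0" using form_orthogonal[OF assms(2) u(1)] \<beta> by blast
    then show "\<beta> K = (- \<alpha>) K" by (simp add: eq_neg_iff_add_eq_0 add.commute)
  qed (rule weight_minus[OF assms(1)])
  then have "u \<beta> \<in> root_space h (- \<alpha>)" using u(1) \<beta>(1) by auto
  then show ?thesis
    using that[of "(1 / B x (u \<beta>)) *\<^sub>C u \<beta>"] \<beta>(2)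
    by (simp add: form_scale_right cvs.subspace_scale[OF root_space_subspace])
qed

lemma root_uminus:
  assumes "\<alpha> \<in> roots h" shows "- \<alpha> \<in> roots h"
proof -
  obtain x where "x \<in> root_space h \<alpha>" "x \<noteq> 0" using root_vector_exists[OF assms] .
  then obtain y where y: "y \<in> root_space h (- \<alpha>)" "B x y = 1"
    using form_pairing[OF weight_root[OF assms]] by blast
  then have "y \<noteq> 0" by (auto simp: form_zero)
  then show ?thesis
    using weight_vector_cases[OF weight_minus[OF weight_root[OF assms]] y(1)] assms
    by (auto simp: roots_def)
qed

lemma form_nondegenerate_on_h:
  assumes "t \<in> h" "\<And>K. K \<in> h \<Longrightarrow> B t K = 0" shows "t = 0"
proof (rule ccontr)
  assume "t \<noteq> 0"
  then obtain y where "y \<in> root_space h (- 0)" "B t y = 1"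
    using form_pairing[of 0 t] weight_0 root_space_0 assms(1) by blast
  then show False using assms(2) root_space_0 by simp
qed

lemma lie_opposite:
  assumes "x \<in> root_space h \<alpha>" "y \<in> root_space h (- \<alpha>)"
  shows "lie x y \<in> h" "K \<in> h \<Longrightarrow> B (lie x y) K = \<alpha> K * B x y"
proof -
  show "lie x y \<in> h" using lie_root_space[OF assms] root_space_0 by simp
  assume "K \<in> h"
  then have "lie y K = \<alpha> K *\<^sub>C y" using assms by (subst lie_anti) (simp add: root_spaceD)
  then show "B (lie x y) K = \<alpha> K * B x y" by (simp add: form_lie form_scale_right)
qed

lemma dual_element_eq:
  assumes "t \<in> h" "\<And>K. K \<in> h \<Longrightarrow> B t K = \<alpha> K"
  shows "dual_element B h \<alpha> = t"
  unfolding dual_element_def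
proof (rule the_equality)
  fix s assume s: "s \<in> h \<and> (\<forall>K\<in>h. B s K = \<alpha> K)"
  have "s - t = 0"
  proof (rule form_nondegenerate_on_h)
    show "s - t \<in> h" using s assms(1) by (intro cvs.subspace_diff[OF h_subspace]) auto
    show "B (s - t) K = 0" if "K \<in> h" for K
      using form_add[of "s - t" t K] s assms(2) that by simp
  qed
  then show "s = t" by simp
qed (use assms in blast)

text \<open>The dual element exists because it is the bracket of two opposite root vectors with B x
  y = 1; nondegeneracy of B on h makes it the one that the definite description selects.\<close>

lemma dual_element_root:
  assumes "\<alpha> \<in> roots h"
  shows "dual_element B h \<alpha> \<in> h" "K \<in> h \<Longrightarrow> B (dual_element B h \<alpha>) K = \<alpha> K"
proof -
  obtain x where x: "x \<in> root_space h \<alpha>" "x \<noteq> 0" using root_vector_exists[OF assms] .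
  then obtain y where y: "y \<in> root_space h (- \<alpha>)" "B x y = 1"
    using form_pairing[OF weight_root[OF assms]] by blast
  have "dual_element B h \<alpha> = lie x y"
    using lie_opposite[OF x(1) y(1)] y(2) by (intro dual_element_eq) auto
  then show "dual_element B h \<alpha> \<in> h" "K \<in> h \<Longrightarrow> B (dual_element B h \<alpha>) K = \<alpha> K"
    using lie_opposite[OF x(1) y(1)] y(2) by auto
qed

lemma lie_opposite_dual:
  assumes "\<alpha> \<in> roots h" "x \<in> root_space h \<alpha>" "y \<in> root_space h (- \<alpha>)" "B x y = 1"
  shows "lie x y = dual_element B h \<alpha>"
  using lie_opposite[OF assms(2,3)] assms(4) dual_element_eq[of "lie x y" \<alpha>] by simp

section \<open>Ladders of root vectors\<close>

abbreviation shift :: "('g \<Rightarrow> complex) \<Rightarrow> complex \<Rightarrow> ('g \<Rightarrow> complex) \<Rightarrow> 'g \<Rightarrow> complex"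
  where "shift \<beta> c \<gamma> \<equiv> \<lambda>K. \<beta> K + c * \<gamma> K"

lemma weight_shift: "weight \<beta> \<Longrightarrow> weight \<gamma> \<Longrightarrow> weight (shift \<beta> c \<gamma>)"
  by (auto simp: weight_def)

lemma funpow_root_space:
  assumes "x \<in> root_space h \<gamma>" "v \<in> root_space h \<beta>"
  shows "(lie x ^^ k) v \<in> root_space h (shift \<beta> (of_nat k) \<gamma>)"
proof (induction k)
  case (Suc k)
  have "\<gamma> + shift \<beta> (of_nat k) \<gamma> = shift \<beta> (of_nat (Suc k)) \<gamma>"
    by (auto simp: fun_eq_iff algebra_simps)
  then show ?case using lie_root_space[OF assms(1) Suc] by simp
qed (use assms in simp)

text \<open>The weights \<beta> + k \<gamma> are pairwise different, and each one carried by a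
  nonzero vector is 0 or one of the finitely many roots.\<close>

lemma funpow_terminates:
  assumes "\<gamma> \<in> roots h" "x \<in> root_space h \<gamma>" "weight \<beta>" "v \<in> root_space h \<beta>" "v \<noteq> 0"
  obtains k where "(lie x ^^ k) v \<noteq> 0" "lie x ((lie x ^^ k) v) = 0"
proof -
  have "\<exists>k. (lie x ^^ k) v = 0"
  proof (rule ccontr)
    assume "\<not> (\<exists>k. (lie x ^^ k) v = 0)"
    then have "range (\<lambda>k. shift \<beta> (of_nat k) \<gamma>) \<subseteq> insert 0 (roots h)"
      using weight_vector_cases weight_shift[OF assms(3) weight_root[OF assms(1)]] funpow_root_space[OF assms(2,4)]
      by blast
    then have "finite (range (\<lambda>k. shift \<beta> (of_nat k) \<gamma>))"
      using finite_roots finite_subset by blast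
    moreover have "inj (\<lambda>k. shift \<beta> (of_nat k) \<gamma>)"
    proof (rule injI)
      fix k l assume eq: "shift \<beta> (of_nat k) \<gamma> = shift \<beta> (of_nat l) \<gamma>"
      obtain K where "\<gamma> K \<noteq> 0" using assms(1) by (auto simp: roots_def fun_eq_iff)
      then show "k = l" using fun_cong[OF eq, of K] by simp
    qed
    ultimately show False by (simp add: finite_image_iff)
  qed
  then have "(LEAST k. (lie x ^^ k) v = 0) \<noteq> 0" using assms(5) by (metis (mono_tags) LeastI funpow_0)
  then obtain k where k: "(LEAST k. (lie x ^^ k) v = 0) = Suc k" using not0_implies_Suc by blast
  have "(lie x ^^ k) v \<noteq> 0" using not_less_Least[of k "\<lambda>k. (lie x ^^ k) v = 0"] k by simp
  moreover have "(lie x ^^ Suc k) v = 0" using \<open>\<exists>k. (lie x ^^ k) v = 0\<close> k by (metis (mono_tags) LeastI)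
  ultimately show ?thesis using that by simp
qed

text \<open>The sl(2) ladder formula with t = [e, f] not rescaled to a coroot. In this form it also
  covers \<gamma>(t) = 0, the case that \<open>root_dual_nonzero\<close> has to exclude.\<close>

lemma lie_funpow_primitive:
  assumes e: "e \<in> root_space h \<gamma>" and f: "f \<in> root_space h (- \<gamma>)"
    and w: "w \<in> root_space h \<beta>" "lie e w = 0"
  shows "lie e ((lie f ^^ Suc j) w)
    = (of_nat (Suc j) * (\<beta> (lie e f) - of_nat j / 2 * \<gamma> (lie e f))) *\<^sub>C (lie f ^^ j) w"
proof (induction j)
  case 0
  have "lie e (lie f w) = lie (lie e f) w" using w(2) by (simp add: lie_leibniz[of e f w])
  then show ?case using w(1) lie_opposite(1)[OF e f] by (simp add: root_spaceD)
next
  case (Suc j)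
  let ?t = "lie e f" and ?v = "(lie f ^^ Suc j) w"
  have "?v \<in> root_space h (shift \<beta> (of_nat (Suc j)) (- \<gamma>))" by (rule funpow_root_space[OF f w(1)])
  then have "lie ?t ?v = (\<beta> ?t - of_nat (Suc j) * \<gamma> ?t) *\<^sub>C ?v"
    using lie_opposite(1)[OF e f] by (simp only: root_spaceD) simp
  moreover have "lie e ((lie f ^^ Suc (Suc j)) w) = lie ?t ?v + lie f (lie e ?v)"
    using lie_leibniz[of e f ?v] by simp
  ultimately have "lie e ((lie f ^^ Suc (Suc j)) w) = (\<beta> ?t - of_nat (Suc j) * \<gamma> ?t) *\<^sub>C ?v
      + (of_nat (Suc j) * (\<beta> ?t - of_nat j / 2 * \<gamma> ?t)) *\<^sub>C ?v"
    unfolding Suc by (simp add: lie_scaleC_right)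
  also have "\<dots> = (of_nat (Suc (Suc j)) * (\<beta> ?t - of_nat (Suc j) / 2 * \<gamma> ?t)) *\<^sub>C ?v"
    unfolding scaleC_add_left[symmetric] by (rule arg_cong[where f = "\<lambda>c. c *\<^sub>C ?v"]) (simp add: field_simps)
  finally show ?case .
qed

text \<open>Let f^m w be the last nonzero vector. Applying e to f^(m+1) w = 0 kills the coefficient
  of the ladder formula at j = m; for \<gamma>(t) \<noteq> 0, where t = [e, f], this is the
  integrality of a highest weight.\<close>

lemma primitive_string:
  assumes \<gamma>: "\<gamma> \<in> roots h" and e: "e \<in> root_space h \<gamma>" and f: "f \<in> root_space h (- \<gamma>)"
    and w: "weight \<beta>" "w \<in> root_space h \<beta>" "w \<noteq> 0" "lie e w = 0"
  obtains m :: nat where "2 * \<beta> (lie e f) = of_nat m * \<gamma> (lie e f)"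
    "\<And>j. j \<le> m \<Longrightarrow> (lie f ^^ j) w \<noteq> 0"
proof -
  obtain m where m: "(lie f ^^ m) w \<noteq> 0" "lie f ((lie f ^^ m) w) = 0"
    using funpow_terminates[OF root_uminus[OF \<gamma>] f w(1-3)] .
  have "(of_nat (Suc m) * (\<beta> (lie e f) - of_nat m / 2 * \<gamma> (lie e f))) *\<^sub>C (lie f ^^ m) w = 0"
    using lie_funpow_primitive[OF e f w(2,4), of m] m(2) by simp
  then have "\<beta> (lie e f) - of_nat m / 2 * \<gamma> (lie e f) = 0" using m(1) by (simp del: of_nat_Suc)
  then have "2 * \<beta> (lie e f) = of_nat m * \<gamma> (lie e f)" by (simp add: field_simps)
  moreover have "(lie f ^^ j) w \<noteq> 0" if "j \<le> m" for j
  proof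
    assume "(lie f ^^ j) w = 0"
    moreover have "(lie f ^^ m) w = (lie f ^^ (m - j)) ((lie f ^^ j) w)"
      using that by (simp flip: funpow_add comp_apply[of "lie f ^^ (m - j)"])
    moreover have "(lie f ^^ i) 0 = 0" for i by (induction i) auto
    ultimately show False using m(1) by simp
  qed
  ultimately show ?thesis by (rule that)
qed

text \<open>The ladder climbs k steps from \<beta> to a vector killed by e and descends m steps from
  there, which explains the index k - j.\<close>

lemma root_string:
  assumes \<gamma>: "\<gamma> \<in> roots h" and e: "e \<in> root_space h \<gamma>" and f: "f \<in> root_space h (- \<gamma>)"
    and \<beta>: "\<beta> \<in> roots h"
  obtains k m :: nat where "2 * (\<beta> (lie e f) + of_nat k * \<gamma> (lie e f)) = of_nat m * \<gamma> (lie e f)"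
    "\<And>j. j \<le> m \<Longrightarrow> shift \<beta> (of_nat k - of_nat j) \<gamma> \<in> insert 0 (roots h)"
proof -
  obtain v where v: "v \<in> root_space h \<beta>" "v \<noteq> 0" using root_vector_exists[OF \<beta>] .
  obtain k where k: "(lie e ^^ k) v \<noteq> 0" "lie e ((lie e ^^ k) v) = 0"
    using funpow_terminates[OF \<gamma> e weight_root[OF \<beta>] v] .
  let ?w = "(lie e ^^ k) v"
  have w: "weight (shift \<beta> (of_nat k) \<gamma>)" "?w \<in> root_space h (shift \<beta> (of_nat k) \<gamma>)"
    using funpow_root_space[OF e v(1)] weight_shift weight_root \<gamma> \<beta> by auto
  obtain m where m: "2 * (\<beta> (lie e f) + of_nat k * \<gamma> (lie e f)) = of_nat m * \<gamma> (lie e f)"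
    "\<And>j. j \<le> m \<Longrightarrow> (lie f ^^ j) ?w \<noteq> 0"
    using primitive_string[OF \<gamma> e f w k] by blast
  have "shift \<beta> (of_nat k - of_nat j) \<gamma> \<in> insert 0 (roots h)" if "j \<le> m" for j
  proof -
    have eq: "shift (shift \<beta> (of_nat k) \<gamma>) (of_nat j) (- \<gamma>) = shift \<beta> (of_nat k - of_nat j) \<gamma>"
      by (auto simp: fun_eq_iff algebra_simps)
    show ?thesis
      using funpow_root_space[OF f w(2), of j] m(2)[OF that] weight_vector_cases weight_shift weight_root \<gamma> \<beta>
      unfolding eq by blast
  qed
  with m(1) show ?thesis by (rule that)
qed

text \<open>If \<open>\<alpha>\<close> vanished at its dual element \<open>t\<close>, then two opposite root vectors and \<open>t\<close> would span a
  Heisenberg algebra, whose central element \<open>t\<close> acts by zero on every finite string.\<close>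

lemma root_dual_nonzero:
  assumes \<alpha>: "\<alpha> \<in> roots h" shows "\<alpha> (dual_element B h \<alpha>) \<noteq> 0"
proof
  let ?t = "dual_element B h \<alpha>"
  assume 0: "\<alpha> ?t = 0"
  obtain x where x: "x \<in> root_space h \<alpha>" "x \<noteq> 0" using root_vector_exists[OF \<alpha>] .
  then obtain y where y: "y \<in> root_space h (- \<alpha>)" "B x y = 1"
    using form_pairing[OF weight_root[OF \<alpha>]] by blast
  have t: "lie x y = ?t" using lie_opposite_dual \<alpha> x y by blast
  have "\<beta> ?t = 0" if "\<beta> \<in> roots h" for \<beta>
    using root_string[OF \<alpha> x(1) y(1) that] unfolding t 0 by auto
  then have "?t = 0" using roots_separate dual_element_root(1)[OF \<alpha>] by blast
  then have "\<alpha> K = 0" if "K \<in> h" for K using dual_element_root(2)[OF \<alpha> that] by (simp add: form_zero)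
  then have "\<alpha> = 0" using weight_ext[OF weight_root[OF \<alpha>] weight_0] by simp
  then show False using \<alpha> by (simp add: roots_def)
qed

text \<open>A vector of weight \<open>\<alpha>\<close> killed by the opposite root vector \<open>y\<close> would start an infinite string.\<close>

lemma root_space_one_dim:
  assumes \<alpha>: "\<alpha> \<in> roots h" and x: "x \<in> root_space h \<alpha>" "x \<noteq> 0" and v: "v \<in> root_space h \<alpha>"
  obtains c where "v = c *\<^sub>C x"
proof -
  obtain y where y: "y \<in> root_space h (- \<alpha>)" "B x y = 1"
    using form_pairing[OF weight_root[OF \<alpha>] x] .
  let ?t = "dual_element B h \<alpha>" and ?w = "v - B v y *\<^sub>C x"
  have t: "lie x y = ?t" using lie_opposite_dual \<alpha> x y by blast
  have w: "?w \<in> root_space h \<alpha>"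
    using x v by (intro cvs.subspace_diff[OF root_space_subspace] cvs.subspace_scale[OF root_space_subspace])
  have yx: "lie y x = - ?t" unfolding t[symmetric] by (rule lie_anti)
  have "B ?w y = 0"
    using form_add[of ?w "B v y *\<^sub>C x" y] y(2) by (simp add: form_scale)
  then have "lie ?w y = 0"
    using lie_opposite[OF w y(1)] form_nondegenerate_on_h by simp
  then have yw: "lie y ?w = 0" by (subst lie_anti) simp
  have "?w = 0"
  proof (rule ccontr)
    assume "?w \<noteq> 0"
    have x': "x \<in> root_space h (- (- \<alpha>))" using x by simp
    obtain m :: nat where "2 * \<alpha> (lie y x) = of_nat m * (- \<alpha>) (lie y x)"
      using primitive_string[OF root_uminus[OF \<alpha>] y(1) x' weight_root[OF \<alpha>] w \<open>?w \<noteq> 0\<close> yw] .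
    then have "(of_nat (m + 2)) * \<alpha> (lie y x) = 0" by (simp add: algebra_simps)
    then have "\<alpha> (- ?t) = 0" unfolding yx using of_nat_eq_0_iff[of "m + 2", where 'a = complex] by (simp del: of_nat_add)
    moreover have "\<alpha> (- ?t) = - \<alpha> ?t"
    proof -
      have "- ?t \<in> h" using dual_element_root(1)[OF \<alpha>] cvs.subspace_neg[OF h_subspace] by blast
      then have "\<alpha> (- ?t) *\<^sub>C x = - \<alpha> ?t *\<^sub>C x"
        using root_spaceD[OF x(1)] dual_element_root(1)[OF \<alpha>] lie_minus_left[of ?t x] by (metis cvs.scale_minus_left)
      then show ?thesis using x(2) by (metis cvs.scale_right_imp_eq)
    qed
    ultimately show False using root_dual_nonzero[OF \<alpha>] by simp
  qed
  then show ?thesis using that[of "B v y"] by simp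
qed

lemma centre_trivial:
  assumes "\<And>z. lie (x :: 'g) z = 0" shows "x = 0"
proof -
  have x: "x \<in> h" using assms by (intro self_centralizing) (metis lie_anti neg_0_equal_iff_equal)
  show ?thesis
  proof (rule roots_separate[OF x])
    fix \<alpha> assume "\<alpha> \<in> roots h"
    then obtain v where "v \<in> root_space h \<alpha>" "v \<noteq> 0" by (rule root_vector_exists)
    then show "\<alpha> x = 0" using root_spaceD[of v \<alpha> x] x assms[of v] by auto
  qed
qed

text \<open>The definition of \<open>roots\<close> speaks of arbitrary functions; linearity on h is
  inherited from the bracket by evaluating on a root vector.\<close>

lemma weight_linear:
  assumes "\<alpha> \<in> roots h" "K \<in> h" shows "\<alpha> (c *\<^sub>C K) = c * \<alpha> K"
proof -
  obtain x where x: "x \<in> root_space h \<alpha>" "x \<noteq> 0" using root_vector_exists[OF assms(1)] .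
  have "\<alpha> (c *\<^sub>C K) *\<^sub>C x = (c * \<alpha> K) *\<^sub>C x"
    using root_spaceD[OF x(1)] assms(2) cvs.subspace_scale[OF h_subspace assms(2), of c] lie_scaleC_left[of c K x]
    by (metis scaleC_scaleC)
  then show ?thesis using x(2) by simp
qed

lemma eigenspace_span:
  assumes K: "K \<in> h" and v: "lie K v = l *\<^sub>C v" "l \<noteq> 0"
  shows "v \<in> cvs.span (\<Union>\<alpha>\<in>{\<alpha> \<in> roots h. \<alpha> K = l}. root_space h \<alpha>)"
proof -
  let ?R = "insert 0 (roots h)"
  obtain u where u: "\<And>\<alpha>. \<alpha> \<in> ?R \<Longrightarrow> u \<alpha> \<in> root_space h \<alpha>" "v = sum u ?R" by (rule decompose[of v]) (rule that)
  let ?A = "{\<alpha> \<in> ?R. \<alpha> K = l}" and ?C = "{\<alpha> \<in> ?R. \<alpha> K \<noteq> l}"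
  have fin: "finite ?R" using finite_roots by simp
  have split: "v = sum u ?A + sum u ?C"
    unfolding u(2) using fin by (subst sum.union_disjoint[symmetric]) (auto intro!: sum.cong)
  have A: "lie K (sum u ?A) = l *\<^sub>C sum u ?A"
    unfolding lie_sum_right cvs.scale_sum_right using u(1) K v(2) by (intro sum.cong) (auto simp: root_spaceD)
  have "sum u ?C = 0"
  proof (rule eigenvector_sum_zero[where T = "lie K" and ev = "\<lambda>\<alpha>. \<alpha> K" and l = l])
    show "lie K (sum u ?C) = l *\<^sub>C sum u ?C"
      using v(1) A unfolding split by (simp add: lie_add_right scaleC_add_right)
    show "lie K (u \<alpha>) = \<alpha> K *\<^sub>C u \<alpha> \<and> \<alpha> K \<noteq> l" if "\<alpha> \<in> ?C" for \<alpha>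
      using that u(1) K root_spaceD by blast
  qed (use fin in \<open>auto simp: lie_add_right lie_scaleC_right\<close>)
  moreover have "?A = {\<alpha> \<in> roots h. \<alpha> K = l}" using v(2) by auto
  ultimately have "v = sum u {\<alpha> \<in> roots h. \<alpha> K = l}" using split by simp
  also have "\<dots> \<in> cvs.span (\<Union>\<alpha>\<in>{\<alpha> \<in> roots h. \<alpha> K = l}. root_space h \<alpha>)"
    using u(1) by (intro cvs.span_sum cvs.span_base) auto
  finally show ?thesis .
qed

end

section \<open>The grading by the coroot of the highest root\<close>

locale extremal_root = cartan_roots h B
  for h :: "'g::complex_lie_algebra set" and B +
  fixes D :: "('g \<Rightarrow> complex) set" and \<theta> :: "'g \<Rightarrow> complex" and E :: "('g \<Rightarrow> complex) \<Rightarrow> 'g"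
    and H :: 'g and P :: "('g \<Rightarrow> complex) set"
  assumes simple: "simple_roots h D" and highest: "highest_root h D \<theta>"
    and choice: "constituent_choice h \<theta> P"
    and E: "\<alpha> \<in> roots h \<Longrightarrow> E \<alpha> \<in> root_space h \<alpha> \<and> E \<alpha> \<noteq> 0"
    and H_dual: "\<exists>c. H = c *\<^sub>C dual_element B h \<theta>"
    and H_E: "lie H (E \<theta>) = E \<theta>"
    and E_pair: "\<mu> \<in> P \<Longrightarrow> lie (E \<mu>) (E (\<theta> - \<mu>)) = E \<theta>"
begin

lemma \<theta>: "\<theta> \<in> roots h" using highest by (simp add: highest_root_def)

lemma H: "H \<in> h"
  using H_dual dual_element_root(1)[OF \<theta>] cvs.subspace_scale[OF h_subspace] by auto

lemma \<theta>_H: "\<theta> H = 1"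
proof -
  have "\<theta> H *\<^sub>C E \<theta> = 1 *\<^sub>C E \<theta>" using root_spaceD[OF _ H, of "E \<theta>" \<theta>] E[OF \<theta>] H_E by simp
  then show ?thesis using E[OF \<theta>] by (simp del: cvs.scale_one)
qed

text \<open>In types \<open>A\<close> and \<open>D\<close> every root has this property, in types \<open>B\<close> and \<open>C\<close> of rank at
  least 2 exactly the long ones.\<close>

lemma extremal:
  assumes "\<theta> + \<gamma> \<in> roots h" "\<theta> - \<gamma> \<in> roots h" shows "\<gamma> = 0"
proof -
  have D: "finite D"
    "\<And>c. (\<And>K. (\<Sum>\<delta>\<in>D. c \<delta> * \<delta> K) = (0 :: complex)) \<Longrightarrow> \<forall>\<delta>\<in>D. c \<delta> = 0"
    using simple unfolding simple_roots_def by blast+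
  obtain m :: "('g \<Rightarrow> complex) \<Rightarrow> nat" where m: "\<theta> - (\<theta> + \<gamma>) = (\<lambda>K. \<Sum>\<delta>\<in>D. of_nat (m \<delta>) * \<delta> K)"
    using highest assms(1) unfolding highest_root_def by blast
  obtain n :: "('g \<Rightarrow> complex) \<Rightarrow> nat" where n: "\<theta> - (\<theta> - \<gamma>) = (\<lambda>K. \<Sum>\<delta>\<in>D. of_nat (n \<delta>) * \<delta> K)"
    using highest assms(2) unfolding highest_root_def by blast
  \<comment> \<open>\<open>m\<close> expands -\<gamma> and \<open>n\<close> expands \<gamma>.
    Independence of D makes the sums of their coefficients 0, and natural numbers with sum 0 are
    0.\<close>
  have "\<forall>\<delta>\<in>D. (of_nat (m \<delta>) + of_nat (n \<delta>) :: complex) = 0"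
  proof (rule D(2))
    fix K
    show "(\<Sum>\<delta>\<in>D. (of_nat (m \<delta>) + of_nat (n \<delta>)) * \<delta> K) = 0"
      using fun_cong[OF m[symmetric], of K] fun_cong[OF n[symmetric], of K]
      by (simp add: distrib_right sum.distrib)
  qed
  then have "\<forall>\<delta>\<in>D. n \<delta> = 0" by (metis add_is_0 of_nat_add of_nat_eq_0_iff)
  then show ?thesis using n by (simp add: fun_eq_iff)
qed

text \<open>The string relation at [E \<theta>, f], rescaled to H: there \<theta> takes the value 1,
  so that the number of downward steps is 2 (\<beta>(H) + k).\<close>

lemma \<theta>_string:
  assumes "\<beta> \<in> roots h"
  obtains k m :: nat where "2 * (\<beta> H + of_nat k) = of_nat m"
    "\<And>j. j \<le> m \<Longrightarrow> shift \<beta> (of_nat k - of_nat j) \<theta> \<in> insert 0 (roots h)"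
proof -
  let ?t = "dual_element B h \<theta>"
  obtain f where f: "f \<in> root_space h (- \<theta>)" "B (E \<theta>) f = 1"
    using form_pairing[OF weight_root[OF \<theta>]] E[OF \<theta>] by blast
  have t: "lie (E \<theta>) f = ?t" using lie_opposite_dual[OF \<theta>] E[OF \<theta>] f by blast
  obtain k m :: nat where km: "2 * (\<beta> ?t + of_nat k * \<theta> ?t) = of_nat m * \<theta> ?t"
    "\<And>j. j \<le> m \<Longrightarrow> shift \<beta> (of_nat k - of_nat j) \<theta> \<in> insert 0 (roots h)"
    using root_string[OF \<theta> _ f(1) assms, of "E \<theta>"] E[OF \<theta>] unfolding t by blast
  obtain c where c: "H = c *\<^sub>C ?t" using H_dual by blast
  have "\<beta> H = c * \<beta> ?t" "1 = c * \<theta> ?t"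
    using weight_linear[OF assms dual_element_root(1)[OF \<theta>]] weight_linear[OF \<theta> dual_element_root(1)[OF \<theta>]] c \<theta>_H
    by metis+
  moreover have "2 * (c * \<beta> ?t + of_nat k * (c * \<theta> ?t)) = of_nat m * (c * \<theta> ?t)"
    using arg_cong[OF km(1), of "(*) c"] by (simp only: algebra_simps)
  ultimately have "2 * (\<beta> H + of_nat k) = of_nat m" by simp
  then show ?thesis using km(2) by (rule that)
qed

lemma nonzero_root: "\<alpha> \<in> insert 0 (roots h) \<Longrightarrow> \<alpha> K \<noteq> 0 \<Longrightarrow> \<alpha> \<in> roots h"
  by auto

text \<open>Here m = n + 2 k is at least k + 2, so the string reaches \<beta> - 2 \<theta>, which is
  nonzero at H and thus a root. Its negative is \<theta> - (\<beta> - \<theta>), while \<beta> is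
  \<theta> + (\<beta> - \<theta>), and \<open>extremal\<close> applies to \<beta> -
  \<theta>.\<close>

lemma root_H_unless:
  assumes \<beta>: "\<beta> \<in> roots h" "2 * \<beta> H = of_nat n" "n \<in> {2, 3}"
  shows "\<beta> = \<theta>"
proof -
  obtain k m :: nat where km: "2 * (\<beta> H + of_nat k) = of_nat m"
    "\<And>j. j \<le> m \<Longrightarrow> shift \<beta> (of_nat k - of_nat j) \<theta> \<in> insert 0 (roots h)"
    by (rule \<theta>_string[OF \<beta>(1)]) (rule that)
  have "of_nat m = (of_nat (n + 2 * k) :: complex)" using km(1) \<beta>(2) by (simp add: algebra_simps)
  then have "m = n + 2 * k" by (simp only: of_nat_eq_iff)
  then have "shift \<beta> (of_nat k - of_nat (k + 2)) \<theta> \<in> insert 0 (roots h)"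
    using \<beta>(3) by (intro km(2)) auto
  moreover have "shift \<beta> (of_nat k - of_nat (k + 2)) \<theta> H = \<beta> H - 2" by (simp add: \<theta>_H)
  moreover have "\<beta> H - 2 \<noteq> 0" using \<beta>(2,3) by auto
  ultimately have "shift \<beta> (of_nat k - of_nat (k + 2)) \<theta> \<in> roots h" by (metis nonzero_root)
  then have "- shift \<beta> (of_nat k - of_nat (k + 2)) \<theta> \<in> roots h" by (rule root_uminus)
  moreover have "- shift \<beta> (of_nat k - of_nat (k + 2)) \<theta> = \<theta> - (\<beta> - \<theta>)" by (auto simp: fun_eq_iff)
  ultimately have "\<beta> - \<theta> = 0" using \<beta>(1) by (intro extremal) simp_all
  then show ?thesis by simp
qed

lemma root_H_one: "\<beta> \<in> roots h \<Longrightarrow> \<beta> H = 1 \<Longrightarrow> \<beta> = \<theta>"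
  by (rule root_H_unless[of _ 2]) auto

lemma no_root_three_halves:
  assumes "\<beta> \<in> roots h" shows "\<beta> H \<noteq> 3 / 2"
proof
  assume H: "\<beta> H = 3 / 2"
  have "2 * \<beta> H = of_nat 3" unfolding H by simp
  then have "\<beta> = \<theta>" using assms by (intro root_H_unless[of _ 3]) auto
  then show False using H \<theta>_H by simp
qed

text \<open>The string has m = 2 k + 1 \<ge> k + 1 downward steps and so reaches \<beta> - \<theta>.
  The sums excluded in \<open>constituent_roots\<close> would be roots with the value 3/2 at
  H.\<close>

lemma root_H_half:
  assumes \<beta>: "\<beta> \<in> roots h" "\<beta> H = 1 / 2"
  shows "\<beta> \<in> constituent_roots h \<theta>"
proof -
  obtain k m :: nat where km: "2 * (\<beta> H + of_nat k) = of_nat m"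
    "\<And>j. j \<le> m \<Longrightarrow> shift \<beta> (of_nat k - of_nat j) \<theta> \<in> insert 0 (roots h)"
    by (rule \<theta>_string[OF \<beta>(1)]) (rule that)
  have "of_nat m = (of_nat (1 + 2 * k) :: complex)" using km(1) \<beta>(2) by (simp add: algebra_simps)
  then have "m = 1 + 2 * k" by (simp only: of_nat_eq_iff)
  then have "shift \<beta> (of_nat k - of_nat (k + 1)) \<theta> \<in> insert 0 (roots h)"
    by (intro km(2)) auto
  moreover have "shift \<beta> (of_nat k - of_nat (k + 1)) \<theta> H \<noteq> 0" by (simp add: \<theta>_H \<beta>)
  ultimately have "shift \<beta> (of_nat k - of_nat (k + 1)) \<theta> \<in> roots h" by (metis nonzero_root)
  then have "- shift \<beta> (of_nat k - of_nat (k + 1)) \<theta> \<in> roots h" by (rule root_uminus)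
  moreover have "- shift \<beta> (of_nat k - of_nat (k + 1)) \<theta> = \<theta> - \<beta>" by (auto simp: fun_eq_iff)
  moreover have "(\<beta> + \<theta>) H = 3 / 2" "(\<theta> - \<beta> + \<theta>) H = 3 / 2" by (simp_all add: \<theta>_H \<beta>)
  then have "\<beta> + \<theta> \<notin> roots h" "\<theta> - \<beta> + \<theta> \<notin> roots h" using no_root_three_halves by blast+
  ultimately show ?thesis using \<beta>(1) by (simp add: constituent_roots_def)
qed

lemma P_constituent: "\<mu> \<in> P \<Longrightarrow> \<mu> \<in> constituent_roots h \<theta>"
  using choice by (auto simp: constituent_choice_def)

lemma P_roots: "\<mu> \<in> P \<Longrightarrow> \<mu> \<in> roots h" "\<mu> \<in> P \<Longrightarrow> \<theta> - \<mu> \<in> roots h"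
  using P_constituent by (auto simp: constituent_roots_def)

lemma P_disjoint: "\<mu> \<in> P \<Longrightarrow> \<theta> - \<mu> \<notin> P"
  using choice by (auto simp: constituent_choice_def)

lemma eigenspace_one:
  assumes "lie H v = v" obtains c where "v = c *\<^sub>C E \<theta>"
proof -
  have "{\<alpha> \<in> roots h. \<alpha> H = 1} \<subseteq> {\<theta>}" using root_H_one by blast
  then have "(\<Union>\<alpha>\<in>{\<alpha> \<in> roots h. \<alpha> H = 1}. root_space h \<alpha>) \<subseteq> root_space h \<theta>" by blast
  then have "v \<in> cvs.span (root_space h \<theta>)"
    by (rule subsetD[OF cvs.span_mono]) (rule eigenspace_span[OF H], simp_all add: assms)
  then have "v \<in> root_space h \<theta>" using root_space_subspace cvs.span_eq_iff by blast
  then obtain c where "v = c *\<^sub>C E \<theta>"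
    using root_space_one_dim[OF \<theta> _ _ \<open>v \<in> root_space h \<theta>\<close>, of "E \<theta>"] E[OF \<theta>] by blast
  then show ?thesis by (rule that)
qed

lemma eigenspace_half:
  assumes "lie H v = (1 / 2) *\<^sub>C v"
  shows "v \<in> cvs.span (E ` P \<union> (\<lambda>\<mu>. E (\<theta> - \<mu>)) ` P)" (is "_ \<in> cvs.span ?S")
proof -
  have "root_space h \<alpha> \<subseteq> cvs.span ?S" if \<alpha>: "\<alpha> \<in> roots h" "\<alpha> H = 1 / 2" for \<alpha>
  proof
    fix x assume x: "x \<in> root_space h \<alpha>"
    obtain c where "x = c *\<^sub>C E \<alpha>" using root_space_one_dim[OF \<alpha>(1) _ _ x] E[OF \<alpha>(1)] by blast
    moreover have "\<alpha> \<in> P \<or> \<theta> - \<alpha> \<in> P"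
      using root_H_half[OF \<alpha>] choice by (auto simp: constituent_choice_def)
    then have "E \<alpha> \<in> ?S"
    proof
      assume "\<theta> - \<alpha> \<in> P"
      then have "E (\<theta> - (\<theta> - \<alpha>)) \<in> ?S" by blast
      then show ?thesis by simp
    qed blast
    ultimately show "x \<in> cvs.span ?S" by (simp add: cvs.span_scale cvs.span_base)
  qed
  then have "cvs.span (\<Union>\<alpha>\<in>{\<alpha> \<in> roots h. \<alpha> H = 1 / 2}. root_space h \<alpha>) \<subseteq> cvs.span ?S"
    by (intro cvs.span_minimal cvs.subspace_span UN_least) blast
  moreover have "v \<in> cvs.span (\<Union>\<alpha>\<in>{\<alpha> \<in> roots h. \<alpha> H = 1 / 2}. root_space h \<alpha>)"
    by (rule eigenspace_span[OF H assms]) simp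
  ultimately show ?thesis by blast
qed

end

section \<open>Matrix models of the classical Lie algebras\<close>

text \<open>The functionals are added one at a time: a new one costs at most one further vector,
  chosen in the common kernel of the earlier ones.\<close>

lemma finite_span_of_separating:
  fixes \<phi> :: "'i \<Rightarrow> 'a::complex_space \<Rightarrow> complex"
  assumes fin: "finite I" and \<phi>: "\<And>i x y. i \<in> I \<Longrightarrow> \<phi> i (x + y) = \<phi> i x + \<phi> i y"
    "\<And>i c x. i \<in> I \<Longrightarrow> \<phi> i (c *\<^sub>C x) = c * \<phi> i x"
    and sep: "\<And>x. (\<And>i. i \<in> I \<Longrightarrow> \<phi> i x = 0) \<Longrightarrow> x = 0"
  obtains C :: "'a set" where "finite C" "cvs.span C = UNIV"
proof -
  have diff: "\<phi> i (x - y) = \<phi> i x - \<phi> i y" if "i \<in> I" for i x y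
    using \<phi>(1)[OF that, of "x - y" y] by simp
  have "\<exists>C. finite C \<and> (\<forall>x. \<exists>y\<in>cvs.span C. \<forall>i\<in>J. \<phi> i (x - y) = 0)" if "finite J" "J \<subseteq> I" for J
    using that
  proof (induction J rule: finite_induct)
    case empty
    then show ?case by (intro exI[of _ "{}"]) auto
  next
    case (insert j J)
    then obtain C where C: "finite C" "\<And>x. \<exists>y\<in>cvs.span C. \<forall>i\<in>J. \<phi> i (x - y) = 0" by auto
    show ?case
    proof (cases "\<exists>z. (\<forall>i\<in>J. \<phi> i z = 0) \<and> \<phi> j z \<noteq> 0")
      case False
      then show ?thesis using C by (intro exI[of _ C]) (metis insert_iff)
    next
      case True
      then obtain z where z: "\<And>i. i \<in> J \<Longrightarrow> \<phi> i z = 0" "\<phi> j z \<noteq> 0" by blast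
      have "\<exists>y\<in>cvs.span (insert z C). \<forall>i\<in>insert j J. \<phi> i (x - y) = 0" for x
      proof -
        obtain y where y: "y \<in> cvs.span C" "\<And>i. i \<in> J \<Longrightarrow> \<phi> i (x - y) = 0" using C(2) by blast
        let ?y = "y + (\<phi> j (x - y) / \<phi> j z) *\<^sub>C z"
        have "?y \<in> cvs.span (insert z C)"
          using cvs.span_mono[of C "insert z C"] y(1)
          by (intro cvs.span_add cvs.span_scale cvs.span_base[of z]) auto
        moreover have "\<forall>i\<in>insert j J. \<phi> i (x - ?y) = 0"
          using y(2) z insert.prems \<phi> by (auto simp: diff subset_iff)
        ultimately show ?thesis by blast
      qed
      then show ?thesis using C(1) by (intro exI[of _ "insert z C"]) auto
    qed
  qed
  from this[OF fin order_refl] obtain C where C: "finite C"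
    "\<And>x. \<exists>y\<in>cvs.span C. \<forall>i\<in>I. \<phi> i (x - y) = 0" by blast
  have "x \<in> cvs.span C" for x
  proof -
    obtain y where y: "y \<in> cvs.span C" "\<And>i. i \<in> I \<Longrightarrow> \<phi> i (x - y) = 0" using C(2) by blast
    then have "x - y = 0" by (intro sep)
    then show ?thesis using y(1) by simp
  qed
  then have "cvs.span C = UNIV" by auto
  then show ?thesis by (rule that[OF C(1)])
qed

text \<open>\<open>e x i j\<close> is the \<open>(i, j)\<close> entry of \<open>x\<close>; the involution \<open>\<sigma>\<close> relates the entries that are
  linked by the defining equations of the algebra.\<close>

locale matrix_model =
  fixes h :: "'g::complex_lie_algebra set" and N :: nat and e :: "'g \<Rightarrow> nat \<Rightarrow> nat \<Rightarrow> complex"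
    and \<sigma> :: "nat \<times> nat \<Rightarrow> nat \<times> nat"
  assumes e_add: "i < N \<Longrightarrow> j < N \<Longrightarrow> e (x + y) i j = e x i j + e y i j"
    and e_scale: "i < N \<Longrightarrow> j < N \<Longrightarrow> e (c *\<^sub>C x) i j = c * e x i j"
    and e_lie: "K \<in> h \<Longrightarrow> i < N \<Longrightarrow> j < N \<Longrightarrow> e (lie K x) i j = (e K i i - e K j j) * e x i j"
    and e_inj: "(\<And>i j. i < N \<Longrightarrow> j < N \<Longrightarrow> e x i j = 0) \<Longrightarrow> x = 0"
    and h_iff: "x \<in> h \<longleftrightarrow> (\<forall>i<N. \<forall>j<N. i \<noteq> j \<longrightarrow> e x i j = 0)"
    and mask: "Z = {(i, i) |i. True} \<or> Z \<inter> {(i, i) |i. True} = {} \<and> (\<forall>i<N. \<forall>j<N. \<sigma> (i, j) \<in> Z \<longleftrightarrow> (i, j) \<in> Z) \<Longrightarrow>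
      \<exists>y. \<forall>i<N. \<forall>j<N. e y i j = (if (i, j) \<in> Z then e x i j else 0)"
    and \<sigma>: "i < N \<Longrightarrow> j < N \<Longrightarrow> \<sigma> (i, j) = (k, l) \<Longrightarrow> k < N \<and> l < N \<and> (k = l \<longleftrightarrow> i = j) \<and> \<sigma> (k, l) = (i, j)"
    and \<sigma>_weight: "K \<in> h \<Longrightarrow> i < N \<Longrightarrow> j < N \<Longrightarrow> i \<noteq> j \<Longrightarrow> \<sigma> (i, j) = (k, l) \<Longrightarrow> e K k k - e K l l = e K i i - e K j j"
    and separate: "i < N \<Longrightarrow> j < N \<Longrightarrow> i \<noteq> j \<Longrightarrow> \<exists>K\<in>h. e K i i \<noteq> e K j j"
    and h_faithful: "K \<in> h \<Longrightarrow> (\<And>i j x. i < N \<Longrightarrow> j < N \<Longrightarrow> i \<noteq> j \<Longrightarrow> e x i j \<noteq> 0 \<Longrightarrow> e K i i = e K j j) \<Longrightarrow> K = 0"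
begin

lemma e_eqI: "(\<And>i j. i < N \<Longrightarrow> j < N \<Longrightarrow> e x i j = e y i j) \<Longrightarrow> x = y"
proof -
  assume *: "\<And>i j. i < N \<Longrightarrow> j < N \<Longrightarrow> e x i j = e y i j"
  have "x - y = 0"
  proof (rule e_inj)
    fix i j assume "i < N" "j < N"
    then show "e (x - y) i j = 0" using e_add[of i j "x - y" y] * by simp
  qed
  then show ?thesis by simp
qed

lemma e_zero: "i < N \<Longrightarrow> j < N \<Longrightarrow> e 0 i j = 0"
  using e_scale[of i j 0 0] by simp

definition entry_weight :: "nat \<Rightarrow> nat \<Rightarrow> 'g \<Rightarrow> complex"
  where "entry_weight i j K = (if K \<in> h then e K i i - e K j j else 0)"

lemma entry_weight_eq:
  assumes "x \<in> root_space h \<alpha>" "\<And>K. K \<notin> h \<Longrightarrow> \<alpha> K = 0" "i < N" "j < N" "e x i j \<noteq> 0"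
  shows "\<alpha> = entry_weight i j"
proof
  fix K
  show "\<alpha> K = entry_weight i j K"
  proof (cases "K \<in> h")
    case True
    then have "(e K i i - e K j j) * e x i j = \<alpha> K * e x i j"
      using assms e_lie[of K i j x] e_scale[of i j "\<alpha> K" x] by (simp add: root_space_def)
    then show ?thesis using assms True by (simp add: entry_weight_def)
  qed (simp add: assms entry_weight_def)
qed

text \<open>Entries linked by \<sigma> have the same weight, so the part of x supported on one orbit
  is a weight vector.\<close>

lemma orbit_piece:
  assumes "i < N" "j < N" "i \<noteq> j"
    and y: "\<And>k l. k < N \<Longrightarrow> l < N \<Longrightarrow> e y k l = (if (k, l) \<in> {(i, j), \<sigma> (i, j)} then e x k l else 0)"
  shows "y \<in> root_space h (entry_weight i j)"
  unfolding root_space_def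
proof (intro CollectI ballI e_eqI)
  fix K k l assume K: "K \<in> h" and kl: "k < N" "l < N"
  have "e K k k - e K l l = e K i i - e K j j" if "(k, l) \<in> {(i, j), \<sigma> (i, j)}"
    using that \<sigma>_weight[OF K assms(1-3), of k l] by auto
  then show "e (lie K y) k l = e (entry_weight i j K *\<^sub>C y) k l"
    using K kl by (auto simp: e_lie e_scale entry_weight_def y)
qed

lemma entry_weight_root:
  assumes "i < N" "j < N" "i \<noteq> j" "y \<in> root_space h (entry_weight i j)" "y \<noteq> 0"
  shows "entry_weight i j \<in> roots h"
proof -
  obtain K where "K \<in> h" "e K i i \<noteq> e K j j" using separate[OF assms(1-3)] by blast
  then have "entry_weight i j K \<noteq> 0" by (simp add: entry_weight_def)
  then have "entry_weight i j \<noteq> 0" by (metis zero_fun_apply)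
  then show ?thesis using assms(4,5) by (auto simp: roots_def entry_weight_def)
qed

lemma orbit_mask:
  assumes "i < N" "j < N" "i \<noteq> j"
  obtains y where "\<And>k l. k < N \<Longrightarrow> l < N \<Longrightarrow> e y k l = (if (k, l) \<in> {(i, j), \<sigma> (i, j)} then e x k l else 0)"
proof -
  obtain k l where kl: "\<sigma> (i, j) = (k, l)" by fastforce
  note s = \<sigma>[OF assms(1,2) kl]
  have "\<sigma> (p, q) \<in> {(i, j), (k, l)} \<longleftrightarrow> (p, q) \<in> {(i, j), (k, l)}" if "p < N" "q < N" for p q
    using \<sigma>[OF that, of "fst (\<sigma> (p, q))" "snd (\<sigma> (p, q))"] s kl by auto
  then have "\<exists>y. \<forall>p<N. \<forall>q<N. e y p q = (if (p, q) \<in> {(i, j), (k, l)} then e x p q else 0)"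
    using assms s by (intro mask disjI2) auto
  then show ?thesis using that unfolding kl by blast
qed

abbreviation root_span :: "'g set"
  where "root_span \<equiv> cvs.span (h \<union> (\<Union>\<alpha>\<in>roots h. root_space h \<alpha>))"

text \<open>One orbit of \<sigma> is split off at a time; the rest stays stable because \<sigma> is
  an involution.\<close>

lemma off_diagonal_span:
  assumes "finite S" "S \<subseteq> {(i, j). i < N \<and> j < N \<and> i \<noteq> j}" "\<And>i j. (i, j) \<in> S \<Longrightarrow> \<sigma> (i, j) \<in> S"
    and "\<And>i j. i < N \<Longrightarrow> j < N \<Longrightarrow> e y i j = (if (i, j) \<in> S then e x i j else 0)"
  shows "y \<in> root_span"
  using assms
proof (induction S arbitrary: y rule: finite_psubset_induct)
  case (psubset S)
  show ?case
  proof (cases "S = {}")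
    case True
    then have "y = 0" using psubset.prems(3) by (intro e_inj) auto
    then show ?thesis by (simp add: cvs.span_zero)
  next
    case False
    then obtain i j where ij: "(i, j) \<in> S" by auto
    then have ij': "i < N" "j < N" "i \<noteq> j" using psubset.prems(1) by auto
    obtain z where z: "\<And>k l. k < N \<Longrightarrow> l < N \<Longrightarrow> e z k l = (if (k, l) \<in> {(i, j), \<sigma> (i, j)} then e x k l else 0)"
      by (rule orbit_mask[OF ij', of x]) (rule that)
    have "z \<in> root_span"
    proof (cases "z = 0")
      case False
      have "z \<in> root_space h (entry_weight i j)"
        using z by (intro orbit_piece[OF ij', of z]) simp
      then show ?thesis using entry_weight_root[OF ij' _ False] by (intro cvs.span_base) auto
    qed (simp add: cvs.span_zero)
    moreover have "y - z \<in> root_span"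
    proof (rule psubset.IH[of "S - {(i, j), \<sigma> (i, j)}"])
      have "\<sigma> (k, l) \<noteq> (i, j) \<and> \<sigma> (k, l) \<noteq> \<sigma> (i, j)" if "(k, l) \<in> S - {(i, j), \<sigma> (i, j)}" for k l
        using \<sigma>[of k l "fst (\<sigma> (k, l))" "snd (\<sigma> (k, l))"] \<sigma>[of i j "fst (\<sigma> (i, j))" "snd (\<sigma> (i, j))"]
          that psubset.prems(1) ij' by auto
      then show "\<sigma> (k, l) \<in> S - {(i, j), \<sigma> (i, j)}" if "(k, l) \<in> S - {(i, j), \<sigma> (i, j)}" for k l
        using that psubset.prems(2) by auto
      show "e (y - z) k l = (if (k, l) \<in> S - {(i, j), \<sigma> (i, j)} then e x k l else 0)"
        if "k < N" "l < N" for k l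
        using e_add[OF that, of "y - z" z] psubset.prems(2)[OF ij] psubset.prems(3)[OF that] z[OF that] ij
        by (cases "(k, l) = (i, j) \<or> (k, l) = \<sigma> (i, j)") auto
    qed (use psubset.prems(1) ij in auto)
    ultimately have "(y - z) + z \<in> root_span" by (intro cvs.span_add)
    then show ?thesis by simp
  qed
qed

lemma all_in_root_span: "x \<in> root_span"
proof -
  let ?S = "{(i, j). i < N \<and> j < N \<and> i \<noteq> j}"
  obtain y where y: "\<And>i j. i < N \<Longrightarrow> j < N \<Longrightarrow> e y i j = (if (i, j) \<in> {(i, i) |i. True} then e x i j else 0)"
    using mask[of "{(i, i) |i. True}" x] by blast
  have "y \<in> h" using y by (auto simp: h_iff)
  moreover have "x - y \<in> root_span"
  proof (rule off_diagonal_span[of ?S])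
    show "finite ?S" by (rule finite_subset[of _ "{..<N} \<times> {..<N}"]) auto
    show "\<sigma> (i, j) \<in> ?S" if "(i, j) \<in> ?S" for i j
      using \<sigma>[of i j "fst (\<sigma> (i, j))" "snd (\<sigma> (i, j))"] that by (auto simp: case_prod_beta)
    show "e (x - y) i j = (if (i, j) \<in> ?S then e x i j else 0)" if "i < N" "j < N" for i j
      using e_add[OF that, of "x - y" y] y[OF that] that by auto
  qed auto
  moreover have "y \<in> root_span" using \<open>y \<in> h\<close> by (simp add: cvs.span_base)
  ultimately have "(x - y) + y \<in> root_span" by (intro cvs.span_add)
  then show ?thesis by simp
qed

lemma finite_dimensional: obtains C :: "'g set" where "finite C" "cvs.span C = UNIV"
proof (rule finite_span_of_separating[of "{..<N} \<times> {..<N}" "\<lambda>(i, j) x. e x i j"])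
  show "finite ({..<N} \<times> {..<N})" by simp
  show "x = 0" if "\<And>p. p \<in> {..<N} \<times> {..<N} \<Longrightarrow> (case p of (i, j) \<Rightarrow> \<lambda>x. e x i j) x = 0" for x
    using that by (intro e_inj) force
  show "(case p of (i, j) \<Rightarrow> \<lambda>x. e x i j) (x + y)
      = (case p of (i, j) \<Rightarrow> \<lambda>x. e x i j) x + (case p of (i, j) \<Rightarrow> \<lambda>x. e x i j) y"
    "(case p of (i, j) \<Rightarrow> \<lambda>x. e x i j) (c *\<^sub>C x) = c * (case p of (i, j) \<Rightarrow> \<lambda>x. e x i j) x"
    if "p \<in> {..<N} \<times> {..<N}" for p x y c
    using that by (auto simp: e_add e_scale)
qed (rule that)

lemma cartan_roots:
  assumes "invariant_form B"
  shows "cartan_roots h B"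
proof
  show "cvs.subspace h" by (rule cvs.subspaceI) (auto simp: h_iff e_add e_scale e_zero)
  show "lie K K' = 0" if "K \<in> h" "K' \<in> h" for K K'
  proof (rule e_inj)
    show "e (lie K K') i j = 0" if "i < N" "j < N" for i j
      using \<open>K' \<in> h\<close> that \<open>K \<in> h\<close> by (cases "i = j") (auto simp: e_lie h_iff)
  qed
  show "x \<in> h" if "\<And>K. K \<in> h \<Longrightarrow> lie K x = 0" for x
    unfolding h_iff
  proof (intro allI impI)
    fix i j assume ij: "i < N" "j < N" "i \<noteq> j"
    then obtain K where K: "K \<in> h" "e K i i \<noteq> e K j j" using separate by blast
    then show "e x i j = 0" using e_lie[of K i j x] that ij by (simp add: e_zero)
  qed
  show "x \<in> root_span" for x by (rule all_in_root_span)
  have "roots h \<subseteq> (\<lambda>(i, j). entry_weight i j) ` ({..<N} \<times> {..<N})"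
  proof
    fix \<alpha> assume \<alpha>: "\<alpha> \<in> roots h"
    have "0 \<in> root_space h \<alpha>" by (simp add: root_space_def)
    then obtain x where x: "x \<in> root_space h \<alpha>" "x \<noteq> 0" using \<alpha> by (auto simp: roots_def)
    then obtain i j where "i < N" "j < N" "e x i j \<noteq> 0" using e_inj by blast
    moreover from this have "\<alpha> = entry_weight i j"
      using \<alpha> by (intro entry_weight_eq[OF x(1)]) (auto simp: roots_def)
    ultimately show "\<alpha> \<in> (\<lambda>(i, j). entry_weight i j) ` ({..<N} \<times> {..<N})" by force
  qed
  then show "finite (roots h)" by (rule finite_subset) simp
  show "K = 0" if K: "K \<in> h" and 0: "\<And>\<alpha>. \<alpha> \<in> roots h \<Longrightarrow> \<alpha> K = 0" for K
  \<comment> \<open>Each off-diagonal entry that is nonzero in some element belongs to a root, and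
    that root vanishes at K only if the two diagonal entries of K agree.\<close>
  proof (rule h_faithful[OF K])
    fix i j x assume ij: "i < N" "j < N" "i \<noteq> j" and x: "e x i j \<noteq> 0"
    obtain y where y: "\<And>k l. k < N \<Longrightarrow> l < N \<Longrightarrow> e y k l = (if (k, l) \<in> {(i, j), \<sigma> (i, j)} then e x k l else 0)"
      by (rule orbit_mask[OF ij, of x]) (rule that)
    have "y \<noteq> 0" using y[OF ij(1,2)] x ij by (auto simp: e_zero)
    moreover have "y \<in> root_space h (entry_weight i j)"
      using y by (intro orbit_piece[OF ij, of y]) simp
    ultimately have "entry_weight i j \<in> roots h" by (intro entry_weight_root[OF ij])
    then have "entry_weight i j K = 0" by (rule 0)
    then show "e K i i = e K j j" using K by (simp add: entry_weight_def)
  qed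
qed (rule assms)

end

section \<open>Verification of the model for each classical type\<close>

locale matrix_iso =
  fixes h :: "'g::complex_lie_algebra set" and M :: "complex mat set" and N :: nat and f :: "'g \<Rightarrow> complex mat"
  assumes carrier: "M \<subseteq> carrier_mat N N"
    and iso: "lie_isomorphism scaleC lie UNIV (\<cdot>\<^sub>m) commutator M f"
    and h: "f ` h = {A \<in> M. diagonal_mat A}"
begin

lemma f_M: "f x \<in> M" and f_inj: "f x = f y \<Longrightarrow> x = y" and f_surj: "A \<in> M \<Longrightarrow> \<exists>x. A = f x"
  using iso by (auto simp: lie_isomorphism_def bij_betw_def inj_on_def)

lemma f_dim [simp]: "f x \<in> carrier_mat N N" "dim_row (f x) = N" "dim_col (f x) = N"
  using f_M[of x] carrier by auto

lemma f_hom: "f (x + y) = f x + f y" "f (c *\<^sub>C x) = c \<cdot>\<^sub>m f x" "f (lie x y) = f x * f y - f y * f x"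
  using iso by (auto simp: lie_isomorphism_def commutator_def)

lemma in_h_iff: "x \<in> h \<longleftrightarrow> (\<forall>i<N. \<forall>j<N. i \<noteq> j \<longrightarrow> f x $$ (i, j) = 0)"
proof -
  have "x \<in> h \<longleftrightarrow> f x \<in> f ` h" using f_inj by auto
  also have "\<dots> \<longleftrightarrow> diagonal_mat (f x)" by (simp add: h f_M)
  finally show ?thesis by (simp add: diagonal_mat_def)
qed

lemma mat_in_h: "A \<in> M \<Longrightarrow> diagonal_mat A \<Longrightarrow> \<exists>K\<in>h. f K = A"
  using h by (metis (mono_tags, lifting) imageE mem_Collect_eq)

lemma mat_mult_entry: "A \<in> carrier_mat N N \<Longrightarrow> C \<in> carrier_mat N N \<Longrightarrow> i < N \<Longrightarrow> j < N \<Longrightarrow>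
    (A * C) $$ (i, j) = (\<Sum>k<N. A $$ (i, k) * C $$ (k, j))"
  by (auto simp: scalar_prod_def lessThan_atLeast0 intro!: sum.cong)

text \<open>Moves the conditions to the matrix algebra itself, so that each type is checked without
  reference to the isomorphism.\<close>

lemma matrix_model:
  assumes mask: "\<And>A Z. A \<in> M \<Longrightarrow> Z = {(i, i) |i. True} \<or>
      Z \<inter> {(i, i) |i. True} = {} \<and> (\<forall>i<N. \<forall>j<N. \<sigma> (i, j) \<in> Z \<longleftrightarrow> (i, j) \<in> Z) \<Longrightarrow>
      mat N N (\<lambda>(i, j). if (i, j) \<in> Z then A $$ (i, j) else 0) \<in> M"
    and \<sigma>: "\<And>i j k l. i < N \<Longrightarrow> j < N \<Longrightarrow> \<sigma> (i, j) = (k, l) \<Longrightarrow>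
      k < N \<and> l < N \<and> (k = l \<longleftrightarrow> i = j) \<and> \<sigma> (k, l) = (i, j)"
    and \<sigma>_weight: "\<And>A i j k l. A \<in> M \<Longrightarrow> i < N \<Longrightarrow> j < N \<Longrightarrow> i \<noteq> j \<Longrightarrow> \<sigma> (i, j) = (k, l) \<Longrightarrow>
      A $$ (k, k) - A $$ (l, l) = A $$ (i, i) - A $$ (j, j)"
    and separate: "\<And>i j. i < N \<Longrightarrow> j < N \<Longrightarrow> i \<noteq> j \<Longrightarrow> \<exists>A\<in>M. diagonal_mat A \<and> A $$ (i, i) \<noteq> A $$ (j, j)"
    and faithful: "\<And>A i. A \<in> M \<Longrightarrow> i < N \<Longrightarrow>
      (\<And>i j C. i < N \<Longrightarrow> j < N \<Longrightarrow> i \<noteq> j \<Longrightarrow> C \<in> M \<Longrightarrow> C $$ (i, j) \<noteq> 0 \<Longrightarrow> A $$ (i, i) = A $$ (j, j)) \<Longrightarrow>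
      A $$ (i, i) = 0"
  shows "matrix_model h N (\<lambda>x i j. f x $$ (i, j)) \<sigma>"
proof
  have eqI: "A = C" if "A \<in> carrier_mat N N" "C \<in> carrier_mat N N"
    "\<And>i j. i < N \<Longrightarrow> j < N \<Longrightarrow> A $$ (i, j) = C $$ (i, j)" for A C :: "complex mat"
    using that by (intro eq_matI) auto
  have f0: "f 0 $$ (i, j) = 0" if "i < N" "j < N" for i j
    using f_hom(2)[of 0 0] that by (metis cvs.scale_zero_left f_dim(2,3) index_smult_mat(1) mult_zero_left)
  show inj: "x = 0" if "\<And>i j. i < N \<Longrightarrow> j < N \<Longrightarrow> f x $$ (i, j) = 0" for x
    using that f0 by (intro f_inj eqI) auto
  show "f (lie K x) $$ (i, j) = (f K $$ (i, i) - f K $$ (j, j)) * f x $$ (i, j)"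
    if K: "K \<in> h" and ij: "i < N" "j < N" for K x i j
  proof -
    have diag: "f K $$ (k, l) = 0" if "k < N" "l < N" "k \<noteq> l" for k l
      using K that by (auto simp: in_h_iff)
    have "(\<Sum>k<N. f K $$ (i, k) * f x $$ (k, j)) = (\<Sum>k<N. if k = i then f K $$ (i, i) * f x $$ (i, j) else 0)"
      using ij diag[of i] by (intro sum.cong) auto
    moreover have "(\<Sum>k<N. f x $$ (i, k) * f K $$ (k, j)) = (\<Sum>k<N. if k = j then f x $$ (i, j) * f K $$ (j, j) else 0)"
      using ij diag[of _ j] by (intro sum.cong) auto
    moreover have "f (lie K x) $$ (i, j) = (f K * f x) $$ (i, j) - (f x * f K) $$ (i, j)"
      using ij by (simp add: f_hom del: index_mult_mat(1))
    ultimately show ?thesis using ij mat_mult_entry[of "f K" "f x" i j] mat_mult_entry[of "f x" "f K" i j]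
      by (simp add: left_diff_distrib)
  qed
  show "\<exists>y. \<forall>i<N. \<forall>j<N. f y $$ (i, j) = (if (i, j) \<in> Z then f x $$ (i, j) else 0)"
    if Z: "Z = {(i, i) |i. True} \<or>
      Z \<inter> {(i, i) |i. True} = {} \<and> (\<forall>i<N. \<forall>j<N. \<sigma> (i, j) \<in> Z \<longleftrightarrow> (i, j) \<in> Z)" for Z x
  proof -
    obtain y where "mat N N (\<lambda>(i, j). if (i, j) \<in> Z then f x $$ (i, j) else 0) = f y"
      using f_surj[OF mask[OF f_M[of x] Z]] by blast
    then show ?thesis by (intro exI[of _ y]) (simp flip: \<open>mat N N _ = f y\<close>)
  qed
  show "\<exists>K\<in>h. f K $$ (i, i) \<noteq> f K $$ (j, j)" if ij: "i < N" "j < N" "i \<noteq> j" for i j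
  proof -
    obtain A where "A \<in> M" "diagonal_mat A" "A $$ (i, i) \<noteq> A $$ (j, j)" using separate[OF ij] by blast
    moreover from this obtain K where "K \<in> h" "f K = A" using mat_in_h by blast
    ultimately show ?thesis by blast
  qed
  show "K = 0" if K: "K \<in> h"
    and *: "\<And>i j x. i < N \<Longrightarrow> j < N \<Longrightarrow> i \<noteq> j \<Longrightarrow> f x $$ (i, j) \<noteq> 0 \<Longrightarrow> f K $$ (i, i) = f K $$ (j, j)" for K
  proof (rule inj)
    fix i j assume ij: "i < N" "j < N"
    show "f K $$ (i, j) = 0"
    proof (cases "i = j")
      case True
      have "f K $$ (i, i) = 0"
      proof (rule faithful[OF f_M ij(1)])
        fix i j C assume "i < N" "j < N" "i \<noteq> j" "C \<in> M" "C $$ (i, j) \<noteq> 0"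
        moreover from this obtain x where "C = f x" using f_surj by blast
        ultimately show "f K $$ (i, i) = f K $$ (j, j)" by (intro *[of i j x]) auto
      qed
      then show ?thesis using True by simp
    qed (use K ij in \<open>auto simp: in_h_iff\<close>)
  qed
  show "f (x + y) $$ (i, j) = f x $$ (i, j) + f y $$ (i, j)" "f (c *\<^sub>C x) $$ (i, j) = c * f x $$ (i, j)"
    if "i < N" "j < N" for x y c i j
    using that by (simp_all add: f_hom)
qed (fact in_h_iff \<sigma> | rule \<sigma>_weight[OF f_M], assumption+)+

end

text \<open>Off-diagonal entries of traceless matrices are independent, so \<sigma> is the identity.
  A diagonal matrix on which all roots vanish is scalar, and trace 0 makes it zero.\<close>

lemma special_linear_model:
  assumes "2 \<le> N" "matrix_iso h (special_linear N) N f"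
  shows "matrix_model h N (\<lambda>x i j. f x $$ (i, j)) (\<lambda>p. p)"
proof -
  interpret matrix_iso h "special_linear N" N f by fact
  show ?thesis
  proof (rule matrix_model)
    fix A :: "complex mat" and Z :: "(nat \<times> nat) set"
    assume A: "A \<in> special_linear N"
    assume "Z = {(i, i) |i. True} \<or> Z \<inter> {(i, i) |i. True} = {} \<and> (\<forall>i<N. \<forall>j<N. (i, j) \<in> Z \<longleftrightarrow> (i, j) \<in> Z)"
    then have "(\<forall>i. (i, i) \<in> Z) \<or> (\<forall>i. (i, i) \<notin> Z)" by blast
    then show "mat N N (\<lambda>(i, j). if (i, j) \<in> Z then A $$ (i, j) else 0) \<in> special_linear N"
      using A by (auto simp: special_linear_def)
  next
    fix i j assume ij: "i < N" "j < N" "i \<noteq> j"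
    let ?A = "mat N N (\<lambda>(k, l). if k = l then (if k = i then 1 else if k = j then - 1 else 0) else (0 :: complex))"
    have "(\<Sum>k<N. ?A $$ (k, k)) = (\<Sum>k<N. (if k = i then 1 else 0) - (if k = j then 1 else 0))"
      using ij by (intro sum.cong) auto
    also have "\<dots> = 0" using ij by (simp add: sum_subtractf)
    finally have "?A \<in> special_linear N" by (simp add: special_linear_def)
    moreover have "diagonal_mat ?A" by (auto simp: diagonal_mat_def)
    moreover have "?A $$ (i, i) \<noteq> ?A $$ (j, j)" using ij by simp
    ultimately show "\<exists>A\<in>special_linear N. diagonal_mat A \<and> A $$ (i, i) \<noteq> A $$ (j, j)" by blast
  next
    fix A :: "complex mat" and i
    assume A: "A \<in> special_linear N" "i < N" and
      *: "\<And>i j C. i < N \<Longrightarrow> j < N \<Longrightarrow> i \<noteq> j \<Longrightarrow> C \<in> special_linear N \<Longrightarrow> C $$ (i, j) \<noteq> 0 \<Longrightarrow> A $$ (i, i) = A $$ (j, j)"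
    have eq: "A $$ (j, j) = A $$ (i, i)" if "j < N" for j
    proof (cases "i = j")
      case False
      let ?C = "mat N N (\<lambda>(k, l). if k = j \<and> l = i then 1 else (0 :: complex))"
      have "?C \<in> special_linear N" using False by (auto simp: special_linear_def intro!: sum.neutral)
      then show ?thesis using False A that by (intro *[of j i ?C]) auto
    qed simp
    have "(\<Sum>j<N. A $$ (j, j)) = of_nat N * A $$ (i, i)" by (simp add: eq)
    then show "A $$ (i, i) = 0" using A assms(1) by (auto simp: special_linear_def)
  qed auto
qed

text \<open>A common shape of both forms: s is constantly 1 in the orthogonal case and changes sign
  in the middle in the symplectic case.\<close>

definition antidiagonal :: "nat \<Rightarrow> (nat \<Rightarrow> complex) \<Rightarrow> complex mat"
  where "antidiagonal N s = mat N N (\<lambda>(i, j). if i + j + 1 = N then s i else 0)"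

lemma preserves_antidiagonal:
  assumes A: "A \<in> carrier_mat N N"
  shows "A \<in> preserves_form N (antidiagonal N s) \<longleftrightarrow>
    (\<forall>i<N. \<forall>j<N. A $$ (N - 1 - j, i) * s (N - 1 - j) + s i * A $$ (N - 1 - i, j) = 0)"
proof -
  let ?J = "antidiagonal N s"
  have J: "?J \<in> carrier_mat N N" by (simp add: antidiagonal_def)
  have entry: "(transpose_mat A * ?J + ?J * A) $$ (i, j)
     = A $$ (N - 1 - j, i) * s (N - 1 - j) + s i * A $$ (N - 1 - i, j)" if ij: "i < N" "j < N" for i j
  proof -
    have "(transpose_mat A * ?J) $$ (i, j) = (\<Sum>k<N. A $$ (k, i) * ?J $$ (k, j))"
      using A J ij by (simp add: scalar_prod_def lessThan_atLeast0)
    also have "\<dots> = (\<Sum>k<N. if k = N - 1 - j then A $$ (N - 1 - j, i) * s (N - 1 - j) else 0)"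
      using ij by (intro sum.cong) (auto simp: antidiagonal_def)
    finally have 1: "(transpose_mat A * ?J) $$ (i, j) = A $$ (N - 1 - j, i) * s (N - 1 - j)" using ij by simp
    have "(?J * A) $$ (i, j) = (\<Sum>k<N. ?J $$ (i, k) * A $$ (k, j))"
      using A J ij by (simp add: scalar_prod_def lessThan_atLeast0)
    also have "\<dots> = (\<Sum>k<N. if k = N - 1 - i then s i * A $$ (N - 1 - i, j) else 0)"
      using ij by (intro sum.cong) (auto simp: antidiagonal_def)
    finally have 2: "(?J * A) $$ (i, j) = s i * A $$ (N - 1 - i, j)" using ij by simp
    show ?thesis using A J ij 1 2 by simp
  qed
  have "transpose_mat A * ?J + ?J * A = 0\<^sub>m N N \<longleftrightarrow>
    (\<forall>i<N. \<forall>j<N. (transpose_mat A * ?J + ?J * A) $$ (i, j) = 0)"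
  proof (intro iffI allI impI)
    fix i j assume "transpose_mat A * ?J + ?J * A = 0\<^sub>m N N" "i < N" "j < N"
    then show "(transpose_mat A * ?J + ?J * A) $$ (i, j) = 0" by (simp only: index_zero_mat)
  next
    assume "\<forall>i<N. \<forall>j<N. (transpose_mat A * ?J + ?J * A) $$ (i, j) = 0"
    then show "transpose_mat A * ?J + ?J * A = 0\<^sub>m N N"
      using A J by (intro eq_matI) (simp_all del: index_add_mat(1))
  qed
  then show ?thesis using A entry by (simp add: preserves_form_def del: index_add_mat)
qed

text \<open>Preservation of the form links each entry with its reflection in the antidiagonal. On
  the diagonal the reflected entry is the negative, whence the reflection preserves weights.\<close>

lemma form_model:
  assumes s: "\<And>i. i < N \<Longrightarrow> s i \<noteq> 0"
    and faithful: "\<And>A i. A \<in> preserves_form N (antidiagonal N s) \<Longrightarrow> i < N \<Longrightarrow>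
      (\<And>i. i < N \<Longrightarrow> A $$ (N - 1 - i, N - 1 - i) = - A $$ (i, i)) \<Longrightarrow>
      (\<And>i j C. i < N \<Longrightarrow> j < N \<Longrightarrow> i \<noteq> j \<Longrightarrow> C \<in> preserves_form N (antidiagonal N s) \<Longrightarrow>
        C $$ (i, j) \<noteq> 0 \<Longrightarrow> A $$ (i, i) = A $$ (j, j)) \<Longrightarrow> A $$ (i, i) = 0"
    and iso: "matrix_iso h (preserves_form N (antidiagonal N s)) N f"
  shows "matrix_model h N (\<lambda>x i j. f x $$ (i, j)) (\<lambda>(i, j). (N - 1 - j, N - 1 - i))"
proof -
  let ?M = "preserves_form N (antidiagonal N s)"
  interpret matrix_iso h ?M N f by fact
  have opp: "A $$ (N - 1 - i, N - 1 - i) = - A $$ (i, i)" if A: "A \<in> ?M" and i: "i < N" for A i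
  proof -
    have "A \<in> carrier_mat N N" using A carrier by blast
    from A[unfolded preserves_antidiagonal[OF this], rule_format, OF i, of "N - 1 - i"]
    have "A $$ (N - 1 - (N - 1 - i), i) * s (N - 1 - (N - 1 - i)) + s i * A $$ (N - 1 - i, N - 1 - i) = 0"
      using i by simp
    then have "s i * (A $$ (i, i) + A $$ (N - 1 - i, N - 1 - i)) = 0" using i by (simp add: algebra_simps)
    then show ?thesis using s[OF i] by (simp add: eq_neg_iff_add_eq_0 add.commute)
  qed
  show ?thesis
  proof (rule matrix_model)
    fix A :: "complex mat" and Z :: "(nat \<times> nat) set"
    assume A: "A \<in> ?M"
    assume "Z = {(i, i) |i. True} \<or> Z \<inter> {(i, i) |i. True} = {} \<and>
      (\<forall>i<N. \<forall>j<N. (case (i, j) of (i, j) \<Rightarrow> (N - 1 - j, N - 1 - i)) \<in> Z \<longleftrightarrow> (i, j) \<in> Z)"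
    then have Z: "(N - 1 - j, N - 1 - i) \<in> Z \<longleftrightarrow> (i, j) \<in> Z" if "i < N" "j < N" for i j
      using that by auto
    have Z': "(N - Suc j, i) \<in> Z \<longleftrightarrow> (N - Suc i, j) \<in> Z" if "i < N" "j < N" for i j
      using Z[of "N - 1 - i" j] that by simp
    have "A \<in> carrier_mat N N" using A carrier by blast
    then show "mat N N (\<lambda>(i, j). if (i, j) \<in> Z then A $$ (i, j) else 0) \<in> ?M"
      using A by (auto simp: preserves_antidiagonal Z')
  next
    fix i j assume ij: "i < N" "j < N" "i \<noteq> j"
    \<comment> \<open>At most one index is its own opposite, so one of i and j is not.\<close>
    have "\<exists>p. p < N \<and> p \<noteq> N - 1 - p \<and> (p = i \<or> p = j)"
    proof (cases "i = N - 1 - i")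
      case True
      then have "j \<noteq> N - 1 - j" using ij by linarith
      then show ?thesis using ij(2) by blast
    qed (use ij(1) in blast)
    then obtain p where p: "p < N" "p \<noteq> N - 1 - p" "p = i \<or> p = j" by blast
    \<comment> \<open>The diagonal with 1 at p and -1 at the opposite index takes the value 1 only
      at p, and so separates i from j.\<close>
    define \<kappa> :: "nat \<Rightarrow> complex" where "\<kappa> k = (if k = p then 1 else if k = N - 1 - p then - 1 else 0)" for k
    have \<kappa>: "\<kappa> (N - 1 - k) = - \<kappa> k" if "k < N" for k
    proof -
      have "N - 1 - k = p \<longleftrightarrow> k = N - 1 - p" "N - 1 - k = N - 1 - p \<longleftrightarrow> k = p" using that p(1) by linarith+
      then show ?thesis using p(2) by (simp add: \<kappa>_def)
    qed
    let ?A = "mat N N (\<lambda>(k, l). if k = l then \<kappa> k else 0)"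
    have "?A $$ (N - 1 - l, k) * s (N - 1 - l) + s k * ?A $$ (N - 1 - k, l) = 0" if kl: "k < N" "l < N" for k l
    proof (cases "l = N - 1 - k")
      case True
      have "N - 1 - (N - 1 - k) = k" using kl by simp
      then show ?thesis using True kl \<kappa>[of k] by simp
    next
      case False
      then have "N - 1 - l \<noteq> k" using kl by linarith
      then show ?thesis using False kl by simp
    qed
    then have "?A \<in> ?M" by (subst preserves_antidiagonal) simp_all
    moreover have "diagonal_mat ?A" by (auto simp: diagonal_mat_def)
    moreover have "?A $$ (i, i) \<noteq> ?A $$ (j, j)" using ij p by (auto simp: \<kappa>_def)
    ultimately show "\<exists>A\<in>?M. diagonal_mat A \<and> A $$ (i, i) \<noteq> A $$ (j, j)" by blast
  next
    fix A i j k l assume "A \<in> ?M" "i < N" "j < N" "(case (i, j) of (i, j) \<Rightarrow> (N - 1 - j, N - 1 - i)) = (k, l)"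
    then show "A $$ (k, k) - A $$ (l, l) = A $$ (i, i) - A $$ (j, j)" using opp by auto
  next
    fix A i assume "A \<in> ?M" "i < N"
      "\<And>i j C. i < N \<Longrightarrow> j < N \<Longrightarrow> i \<noteq> j \<Longrightarrow> C \<in> ?M \<Longrightarrow> C $$ (i, j) \<noteq> 0 \<Longrightarrow> A $$ (i, i) = A $$ (j, j)"
    then show "A $$ (i, i) = 0" using opp by (intro faithful) blast+
  qed auto
qed

text \<open>For N \<ge> 3 there is an index j other than i and its opposite. The entries of row i in
  column j and in the opposite column force the diagonal entry at i to equal both that at j and its
  negative.\<close>

lemma orthogonal_model:
  assumes "3 \<le> N" "matrix_iso h (preserves_form N (orthogonal_form N)) N f"
  shows "matrix_model h N (\<lambda>x i j. f x $$ (i, j)) (\<lambda>(i, j). (N - 1 - j, N - 1 - i))"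
proof -
  have J: "orthogonal_form N = antidiagonal N (\<lambda>_. 1)" by (simp add: orthogonal_form_def antidiagonal_def)
  show ?thesis
  proof (rule form_model[where s = "\<lambda>_. 1"])
    fix A i
    assume A: "A \<in> preserves_form N (antidiagonal N (\<lambda>_. 1))" and i: "i < N"
      and opp: "\<And>i. i < N \<Longrightarrow> A $$ (N - 1 - i, N - 1 - i) = - A $$ (i, i)"
      and *: "\<And>i j C. i < N \<Longrightarrow> j < N \<Longrightarrow> i \<noteq> j \<Longrightarrow> C \<in> preserves_form N (antidiagonal N (\<lambda>_. 1)) \<Longrightarrow>
        C $$ (i, j) \<noteq> 0 \<Longrightarrow> A $$ (i, i) = A $$ (j, j)"
    have eq: "A $$ (i, i) = A $$ (j, j)" if j: "j < N" "i \<noteq> j" "i \<noteq> N - 1 - j" for j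
    proof -
      let ?C = "mat N N (\<lambda>(k, l). if k = i \<and> l = j then 1 else if k = N - 1 - j \<and> l = N - 1 - i then - 1 else (0 :: complex))"
      have "?C \<in> preserves_form N (antidiagonal N (\<lambda>_. 1))"
        using i j by (subst preserves_antidiagonal) auto
      then show ?thesis using i j by (intro *[of i j ?C]) auto
    qed
    have "card {i, N - 1 - i} < card {..<N}" using assms(1) by (auto intro: le_less_trans[OF card_insert_le_m1])
    then obtain j where j: "j < N" "j \<notin> {i, N - 1 - i}"
      by (metis card_mono finite.emptyI finite.insertI lessThan_iff not_le subsetI)
    have "A $$ (i, i) = A $$ (j, j)" using i j by (intro eq) auto
    moreover have "A $$ (i, i) = A $$ (N - 1 - j, N - 1 - j)" using i j by (intro eq) auto
    ultimately show "A $$ (i, i) = 0" using opp[OF j(1)] by simp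
  qed (use assms J in auto)
qed

text \<open>Antidiagonal entries are allowed here. The one in row i belongs to a long root, whose
  value is twice the diagonal entry at i.\<close>

lemma symplectic_model:
  assumes "matrix_iso h (preserves_form (2 * r) (symplectic_form r)) (2 * r) f"
  shows "matrix_model h (2 * r) (\<lambda>x i j. f x $$ (i, j)) (\<lambda>(i, j). (2 * r - 1 - j, 2 * r - 1 - i))"
proof -
  let ?s = "\<lambda>i. if i < r then 1 else - 1 :: complex"
  have J: "symplectic_form r = antidiagonal (2 * r) ?s" by (simp add: symplectic_form_def antidiagonal_def)
  show ?thesis
  proof (rule form_model[where s = ?s])
    fix A i
    assume A: "A \<in> preserves_form (2 * r) (antidiagonal (2 * r) ?s)" and i: "i < 2 * r"
      and opp: "\<And>i. i < 2 * r \<Longrightarrow> A $$ (2 * r - 1 - i, 2 * r - 1 - i) = - A $$ (i, i)"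
      and *: "\<And>i j C. i < 2 * r \<Longrightarrow> j < 2 * r \<Longrightarrow> i \<noteq> j \<Longrightarrow> C \<in> preserves_form (2 * r) (antidiagonal (2 * r) ?s) \<Longrightarrow>
        C $$ (i, j) \<noteq> 0 \<Longrightarrow> A $$ (i, i) = A $$ (j, j)"
    let ?C = "mat (2 * r) (2 * r) (\<lambda>(k, l). if k = i \<and> l = 2 * r - 1 - i then 1 else (0 :: complex))"
    have "?C \<in> preserves_form (2 * r) (antidiagonal (2 * r) ?s)"
      using i by (subst preserves_antidiagonal) auto
    moreover have "i \<noteq> 2 * r - 1 - i" using i by presburger
    ultimately have "A $$ (i, i) = A $$ (2 * r - 1 - i, 2 * r - 1 - i)"
      using i by (intro *[of i "2 * r - 1 - i" ?C]) simp_all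
    then show "A $$ (i, i) = 0" using opp[OF i] by simp
  qed (use assms J in auto)
qed

theorem classical_matrix_model:
  assumes "classical_with_cartan (h :: 'g::complex_lie_algebra set)"
  obtains N e \<sigma> where "matrix_model h N e \<sigma>"
proof -
  obtain X r f where X: "simple_rank X r"
    "lie_isomorphism scaleC lie UNIV (\<cdot>\<^sub>m) commutator (classical_matrices X r) f"
    "f ` h = {A \<in> classical_matrices X r. diagonal_mat A}"
    using assms unfolding classical_with_cartan_def by blast
  show ?thesis
  proof (cases X)
    case Type_A
    have "matrix_iso h (special_linear (r + 1)) (r + 1) f"
      using X Type_A by unfold_locales (auto simp: special_linear_def)
    then show ?thesis using X(1) Type_A special_linear_model[of "r + 1"] by (intro that) (auto simp: simple_rank_def)
  next
    case Type_B
    have "matrix_iso h (preserves_form (2 * r + 1) (orthogonal_form (2 * r + 1))) (2 * r + 1) f"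
      using X Type_B by unfold_locales (auto simp: preserves_form_def)
    then show ?thesis using X(1) Type_B orthogonal_model[of "2 * r + 1"] by (intro that) (auto simp: simple_rank_def)
  next
    case Type_C
    have "matrix_iso h (preserves_form (2 * r) (symplectic_form r)) (2 * r) f"
      using X Type_C by unfold_locales (auto simp: preserves_form_def)
    then show ?thesis using symplectic_model by (intro that)
  next
    case Type_D
    have "matrix_iso h (preserves_form (2 * r) (orthogonal_form (2 * r))) (2 * r) f"
      using X Type_D by unfold_locales (auto simp: preserves_form_def)
    then show ?thesis using X(1) Type_D orthogonal_model[of "2 * r"] by (intro that) (auto simp: simple_rank_def)
  qed
qed

section \<open>Scalars in power series algebras\<close>

interpretation fsm: Modules.module "fps_scale :: complex fps \<Rightarrow> 'a::complex_algebra_1 fps \<Rightarrow> 'a fps"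
  by unfold_locales (simp_all add: fps_scale_conv fps_scalar_add fps_scalar_mult fps_scalar_one
      distrib_left distrib_right mult.assoc)

lemma fps_scale_mult_left: "fps_scale c x * y = fps_scale c (x * y)" for x y :: "'a::complex_algebra_1 fps"
  by (simp add: fps_scale_conv mult.assoc)

lemma fps_scale_mult_right: "x * fps_scale c y = fps_scale c (x * y)" for x y :: "'a::complex_algebra_1 fps"
  by (simp add: fps_scale_conv fps_scalar_left_commute)

lemma fps_scale_X: "fps_scale fps_X x = fps_X * x" for x :: "'a::complex_algebra_1 fps"
  by (simp add: fps_scale_conv fps_scalar_X)

lemma fps_scale_const_nth: "fps_nth (fps_scale (fps_const c) x) n = c *\<^sub>C fps_nth x n"
proof -
  have "fps_nth (fps_scale (fps_const c) x) n = (\<Sum>i=0..n. if i = 0 then c *\<^sub>C fps_nth x n else 0)"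
    unfolding fps_scale_nth by (intro sum.cong) auto
  then show ?thesis by simp
qed

lemma sum_scaleC_update:
  assumes "finite A" "i \<in> A"
  shows "(\<Sum>j\<in>A. (\<alpha> j + (if j = i then c else 0)) *\<^sub>C g j) = (\<Sum>j\<in>A. \<alpha> j *\<^sub>C g j) + c *\<^sub>C g i"
proof -
  have "(\<Sum>j\<in>A. (\<alpha> j + (if j = i then c else 0)) *\<^sub>C g j)
      = (\<Sum>j\<in>A. \<alpha> j *\<^sub>C g j + (if j = i then c *\<^sub>C g i else 0))"
    by (intro sum.cong) (auto simp: scaleC_add_left)
  then show ?thesis using assms by (simp add: sum.distrib)
qed

abbreviation emb :: "'g::complex_lie_algebra \<Rightarrow> 'g uea fps"
  where "emb x \<equiv> fps_const (uea_inj x)"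

abbreviation hat :: "'g::complex_lie_algebra fps \<Rightarrow> 'g uea fps"
  where "hat \<equiv> fps_map uea_inj"

lemma uea_inj_zero: "uea_inj 0 = 0"
  using uea_inj_scaleC[of 0 0] by simp

lemma uea_inj_sum: "uea_inj (sum g A) = (\<Sum>i\<in>A. uea_inj (g i))"
  by (induction A rule: infinite_finite_induct) (simp_all add: uea_inj_zero uea_inj_add)

lemma hat_add: "hat (x + y) = hat x + hat y"
  by (simp add: fps_eq_iff uea_inj_add)

lemma hat_scale: "hat (fps_scale c x) = fps_scale c (hat x)"
  by (simp add: fps_eq_iff fps_scale_nth uea_inj_sum uea_inj_scaleC)

lemma hat_lie: "hat (fps_lie x y) = hat x * hat y - hat y * hat x"
proof (rule fps_ext)
  fix n
  have "(\<Sum>i=0..n. uea_inj (fps_nth y (n - i)) * uea_inj (fps_nth x i)) = fps_nth (hat y * hat x) n"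
    unfolding fps_mult_nth fps_map_nth by (subst sum.atLeastAtMost_rev) simp
  then show "fps_nth (hat (fps_lie x y)) n = fps_nth (hat x * hat y - hat y * hat x) n"
    by (simp add: fps_lie_nth uea_inj_sum uea_inj_lie sum_subtractf fps_mult_nth)
qed

lemma emb_commutator: "emb x * emb y - emb y * emb x = emb (lie x y)"
  by (simp add: uea_inj_lie)

lemma emb_mult: "emb x * emb y = emb y * emb x + emb (lie x y)"
  by (simp add: uea_inj_lie)

section \<open>Action of the orthogonal subalgebra on the Heisenberg algebra\<close>

text \<open>Indexed by \<pi>'. Everything about the twist and the deformation is derived from these
  brackets, without roots.\<close>

locale heisenberg =
  fixes I :: "'i set" and e f :: "'i \<Rightarrow> 'g::complex_lie_algebra" and z H :: 'g
  assumes fin: "finite I"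
    and ee: "i \<in> I \<Longrightarrow> j \<in> I \<Longrightarrow> lie (e i) (e j) = 0"
    and ff: "i \<in> I \<Longrightarrow> j \<in> I \<Longrightarrow> lie (f i) (f j) = 0"
    and ef: "i \<in> I \<Longrightarrow> j \<in> I \<Longrightarrow> lie (e i) (f j) = (if i = j then z else 0)"
    and ze: "i \<in> I \<Longrightarrow> lie z (e i) = 0" and zf: "i \<in> I \<Longrightarrow> lie z (f i) = 0"
    and He: "i \<in> I \<Longrightarrow> lie H (e i) = (1 / 2) *\<^sub>C e i" and Hf: "i \<in> I \<Longrightarrow> lie H (f i) = (1 / 2) *\<^sub>C f i"
    and Hz: "lie H z = z" and z: "z \<noteq> 0"
begin

lemma fe: "i \<in> I \<Longrightarrow> j \<in> I \<Longrightarrow> lie (f i) (e j) = (if i = j then - z else 0)"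
  using ef[of j i] by (subst lie_anti) auto

text \<open>Reads the coefficient off a multiple of z. Any functional with value 1 at z serves,
  since it is evaluated on such multiples.\<close>

definition \<zeta> :: "'g \<Rightarrow> complex" where "\<zeta> = (SOME \<phi>. functional \<phi> \<and> \<phi> z = 1)"

lemma \<zeta>: "functional \<zeta>" "\<zeta> z = 1"
proof -
  have "cvs.independent {z}" using z by (simp add: cvs.independent_insert)
  then have "\<exists>\<phi>. functional \<phi> \<and> \<phi> z = 1"
    using functional_extend[of "{z}" "\<lambda>_. 1"] by (metis singletonI)
  from someI_ex[OF this] show "functional \<zeta>" "\<zeta> z = 1" by (auto simp: \<zeta>_def)
qed

lemma \<zeta>_scale: "\<zeta> (c *\<^sub>C z) = c"
  by (simp add: functional_scaleC \<zeta>)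

abbreviation V where "V \<equiv> cvs.span (e ` I \<union> f ` I)"

text \<open>\<open>e\<close> and \<open>f\<close> form a symplectic basis for the bracket with
  values in the line of z, so brackets with one half give the coordinates for the other
  half.\<close>

lemma V_expand:
  assumes "v \<in> V"
  shows "v = (\<Sum>j\<in>I. (- \<zeta> (lie (f j) v)) *\<^sub>C e j) + (\<Sum>j\<in>I. \<zeta> (lie (e j) v) *\<^sub>C f j)"
    and "j \<in> I \<Longrightarrow> lie (e j) v = \<zeta> (lie (e j) v) *\<^sub>C z"
    and "j \<in> I \<Longrightarrow> lie (f j) v = \<zeta> (lie (f j) v) *\<^sub>C z"
proof -
  have "\<exists>\<alpha> \<beta>. v = (\<Sum>j\<in>I. \<alpha> j *\<^sub>C e j) + (\<Sum>j\<in>I. \<beta> j *\<^sub>C f j)"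
    using assms
  proof (induction v rule: cvs.span_induct_alt)
    case base
    show ?case by (intro exI[of _ "\<lambda>_. 0"]) simp
  next
    case (step c x y)
    then obtain \<alpha> \<beta> where y: "y = (\<Sum>j\<in>I. \<alpha> j *\<^sub>C e j) + (\<Sum>j\<in>I. \<beta> j *\<^sub>C f j)" by blast
    from step(1) consider i where "i \<in> I" "x = e i" | i where "i \<in> I" "x = f i" by blast
    then show ?case
    proof cases
      case 1
      have "(\<Sum>j\<in>I. (\<alpha> j + (if j = i then c else 0)) *\<^sub>C e j) = (\<Sum>j\<in>I. \<alpha> j *\<^sub>C e j) + c *\<^sub>C e i"
        using fin 1(1) by (rule sum_scaleC_update)
      then show ?thesis unfolding y 1(2)
        by (intro exI[of _ "\<lambda>j. \<alpha> j + (if j = i then c else 0)"] exI[of _ \<beta>]) simp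
    next
      case 2
      have "(\<Sum>j\<in>I. (\<beta> j + (if j = i then c else 0)) *\<^sub>C f j) = (\<Sum>j\<in>I. \<beta> j *\<^sub>C f j) + c *\<^sub>C f i"
        using fin 2(1) by (rule sum_scaleC_update)
      then show ?thesis unfolding y 2(2)
        by (intro exI[of _ \<alpha>] exI[of _ "\<lambda>j. \<beta> j + (if j = i then c else 0)"]) simp
    qed
  qed
  then obtain \<alpha> \<beta> where v: "v = (\<Sum>j\<in>I. \<alpha> j *\<^sub>C e j) + (\<Sum>j\<in>I. \<beta> j *\<^sub>C f j)" by blast
  have 1: "lie (e j) v = \<beta> j *\<^sub>C z" if "j \<in> I" for j
  proof -
    have "lie (e j) v = (\<Sum>k\<in>I. if k = j then \<beta> j *\<^sub>C z else 0)"
      unfolding v lie_add_right lie_sum_right using that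
      by (simp add: lie_scaleC_right ee ef) (auto intro!: sum.cong)
    then show ?thesis using fin that by simp
  qed
  have 2: "lie (f j) v = (- \<alpha> j) *\<^sub>C z" if "j \<in> I" for j
  proof -
    have "lie (f j) v = (\<Sum>k\<in>I. if k = j then (- \<alpha> j) *\<^sub>C z else 0)"
      unfolding v lie_add_right lie_sum_right using that
      by (simp add: lie_scaleC_right ff fe) (auto intro!: sum.cong)
    then show ?thesis using fin that by simp
  qed
  show "v = (\<Sum>j\<in>I. (- \<zeta> (lie (f j) v)) *\<^sub>C e j) + (\<Sum>j\<in>I. \<zeta> (lie (e j) v) *\<^sub>C f j)"
    by (simp add: 1 2 \<zeta>_scale del: cvs.scale_minus_left cong: sum.cong) (rule v)
  show "j \<in> I \<Longrightarrow> lie (e j) v = \<zeta> (lie (e j) v) *\<^sub>C z" "j \<in> I \<Longrightarrow> lie (f j) v = \<zeta> (lie (f j) v) *\<^sub>C z"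
    by (simp_all only: 1 2 \<zeta>_scale)
qed

definition acts :: "'g \<Rightarrow> bool"
  where "acts x \<longleftrightarrow> lie x H = 0 \<and> lie x z = 0 \<and> (\<forall>i\<in>I. lie x (e i) \<in> V \<and> lie x (f i) \<in> V)"

text \<open>In the basis \<open>e\<close>, \<open>f\<close> an acting element has the symplectic matrix with blocks
  \<open>a\<close>, \<open>b\<close>, \<open>c\<close>, and the negative transpose of \<open>a\<close>.\<close>

definition "a x j i = - \<zeta> (lie (f j) (lie x (e i)))"
definition "b x j i = - \<zeta> (lie (f j) (lie x (f i)))"
definition "c x j i = \<zeta> (lie (e j) (lie x (e i)))"

text \<open>The derivation ad x is applied to [e_j, e_i] = 0.\<close>

lemma c_sym: "acts x \<Longrightarrow> i \<in> I \<Longrightarrow> j \<in> I \<Longrightarrow> c x i j = c x j i"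
  using lie_leibniz[of x "e j" "e i"] lie_anti[of "lie x (e j)" "e i"]
  by (simp add: c_def ee)

lemma b_sym: "acts x \<Longrightarrow> i \<in> I \<Longrightarrow> j \<in> I \<Longrightarrow> b x i j = b x j i"
  using lie_leibniz[of x "f j" "f i"] lie_anti[of "lie x (f j)" "f i"]
  by (simp add: b_def ff)

text \<open>The third equation is the negative transpose of block \<open>a\<close>: ad x kills
  [e_j, f_i], which is 0 or z.\<close>

lemma acts_pairing:
  assumes "acts x" "i \<in> I" "j \<in> I"
  shows "lie (e j) (lie x (e i)) = c x j i *\<^sub>C z" "lie (f j) (lie x (e i)) = (- a x j i) *\<^sub>C z"
    "lie (e j) (lie x (f i)) = (- a x i j) *\<^sub>C z" "lie (f j) (lie x (f i)) = (- b x j i) *\<^sub>C z"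
proof -
  have V: "lie x (e k) \<in> V" "lie x (f k) \<in> V" if "k \<in> I" for k
    using assms(1) that by (auto simp: acts_def)
  show "lie (e j) (lie x (e i)) = c x j i *\<^sub>C z" "lie (f j) (lie x (e i)) = (- a x j i) *\<^sub>C z"
     "lie (f j) (lie x (f i)) = (- b x j i) *\<^sub>C z"
    using V_expand(2)[OF V(1)] V_expand(3)[OF V(1)] V_expand(3)[OF V(2)] assms by (simp_all add: a_def b_def c_def)
  have "lie x (lie (e j) (f i)) = 0"
    using assms by (simp add: ef acts_def)
  then have "lie (e j) (lie x (f i)) = lie (f i) (lie x (e j))"
    using lie_leibniz[of x "e j" "f i"] lie_anti[of "lie x (e j)" "f i"] by simp
  then show "lie (e j) (lie x (f i)) = (- a x i j) *\<^sub>C z"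
    using V_expand(3)[OF V(1)] assms by (simp add: a_def)
qed

lemma acts_e:
  assumes "acts x" "i \<in> I"
  shows "lie x (e i) = (\<Sum>j\<in>I. a x j i *\<^sub>C e j) + (\<Sum>j\<in>I. c x j i *\<^sub>C f j)"
  using V_expand(1)[of "lie x (e i)"] assms by (simp add: acts_def a_def c_def)

lemma acts_f:
  assumes "acts x" "i \<in> I"
  shows "lie x (f i) = (\<Sum>j\<in>I. b x j i *\<^sub>C e j) - (\<Sum>j\<in>I. a x i j *\<^sub>C f j)"
proof -
  have "lie x (f i) = (\<Sum>j\<in>I. b x j i *\<^sub>C e j) + (\<Sum>j\<in>I. \<zeta> (lie (e j) (lie x (f i))) *\<^sub>C f j)"
    using V_expand(1)[of "lie x (f i)"] assms by (simp add: acts_def b_def)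
  also have "(\<Sum>j\<in>I. \<zeta> (lie (e j) (lie x (f i))) *\<^sub>C f j) = (\<Sum>j\<in>I. (- a x i j) *\<^sub>C f j)"
    using assms by (intro sum.cong refl) (simp only: acts_pairing(3) \<zeta>_scale)
  finally show ?thesis by (simp add: sum_negf)
qed

lemma acts_lie: "acts x \<Longrightarrow> acts y \<Longrightarrow> acts (lie x y)"
proof -
  assume x: "acts x" and y: "acts y"
  have V: "lie u v \<in> V" if u: "acts u" and v: "v \<in> V" for u v
    using v
  proof (induction v rule: cvs.span_induct_alt)
    case (step c x y)
    then have "lie u x \<in> V" using u by (auto simp: acts_def)
    then show ?case using step by (simp add: lie_add_right lie_scaleC_right cvs.span_add cvs.span_scale)
  qed (simp add: cvs.span_zero)
  have jac: "lie (lie x y) v = lie x (lie y v) - lie y (lie x v)" for v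
    using lie_leibniz[of x y v] by simp
  show "acts (lie x y)"
    using x y V[OF x] V[OF y] unfolding acts_def jac by (auto simp: cvs.span_diff)
qed

lemma acts_subspace: "cvs.subspace {x. acts x}"
  by (rule cvs.subspaceI)
    (auto simp: acts_def lie_add_left lie_scaleC_left cvs.span_zero cvs.span_add cvs.span_scale)

lemma coefficient_linear:
  "a (x + y) j i = a x j i + a y j i" "a (k *\<^sub>C x) j i = k * a x j i"
  "b (x + y) j i = b x j i + b y j i" "b (k *\<^sub>C x) j i = k * b x j i"
  "c (x + y) j i = c x j i + c y j i" "c (k *\<^sub>C x) j i = k * c x j i"
  by (simp_all add: a_def b_def c_def lie_add_left lie_add_right lie_scaleC_left lie_scaleC_right
      functional_add functional_scaleC \<zeta>)

text \<open>The two off-diagonal blocks of a commutator of symplectic matrices. Only these blocks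
  enter the correction term of \<open>deformed\<close>.\<close>

lemma coefficient_lie:
  assumes x: "acts x" and y: "acts y" and ij: "i \<in> I" "j \<in> I"
  shows "c (lie x y) j i = (\<Sum>k\<in>I. c x j k * a y k i - a x k j * c y k i) - (\<Sum>k\<in>I. c y j k * a x k i - a y k j * c x k i)"
    "b (lie x y) j i = (\<Sum>k\<in>I. a x j k * b y k i - b x j k * a y i k) - (\<Sum>k\<in>I. a y j k * b x k i - b y j k * a x i k)"
proof -
  have jac: "lie (lie x y) v = lie x (lie y v) - lie y (lie x v)" for v
    using lie_leibniz[of x y v] by simp
  have 1: "lie (e j) (lie x (lie y (e i))) = (\<Sum>k\<in>I. c x j k * a y k i - a x k j * c y k i) *\<^sub>C z"
    if "acts x" "acts y" for x y
    unfolding acts_e[OF that(2) ij(1)] lie_add_right lie_sum_right lie_scaleC_right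
    using that ij by (simp add: acts_pairing cvs.scale_sum_left cvs.scale_left_diff_distrib
        sum_subtractf sum_negf mult.commute cong: sum.cong)
  have 2: "lie (f j) (lie x (lie y (f i))) = (- (\<Sum>k\<in>I. a x j k * b y k i - b x j k * a y i k)) *\<^sub>C z"
    if "acts x" "acts y" for x y
    unfolding acts_f[OF that(2) ij(1)] lie_diff_right lie_sum_right lie_scaleC_right
    using that ij by (simp add: acts_pairing cvs.scale_sum_left cvs.scale_left_diff_distrib
        sum_subtractf sum_negf mult.commute cong: sum.cong)
  have "lie (e j) (lie (lie x y) (e i)) = ((\<Sum>k\<in>I. c x j k * a y k i - a x k j * c y k i)
      - (\<Sum>k\<in>I. c y j k * a x k i - a y k j * c x k i)) *\<^sub>C z"
    unfolding jac lie_diff_right using 1[OF x y] 1[OF y x] by (simp only: cvs.scale_left_diff_distrib)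
  then show "c (lie x y) j i = (\<Sum>k\<in>I. c x j k * a y k i - a x k j * c y k i)
      - (\<Sum>k\<in>I. c y j k * a x k i - a y k j * c x k i)"
    unfolding c_def[of "lie x y"] by (simp only: \<zeta>_scale)
  have "lie (f j) (lie (lie x y) (f i)) = (- ((\<Sum>k\<in>I. a x j k * b y k i - b x j k * a y i k)
      - (\<Sum>k\<in>I. a y j k * b x k i - b y j k * a x i k))) *\<^sub>C z"
    unfolding jac lie_diff_right using 2[OF x y] 2[OF y x]
    by (simp only: cvs.scale_left_diff_distrib cvs.scale_minus_left minus_diff_minus)
  then show "b (lie x y) j i = (\<Sum>k\<in>I. a x j k * b y k i - b x j k * a y i k)
      - (\<Sum>k\<in>I. a y j k * b x k i - b y j k * a x i k)"
    unfolding b_def[of "lie x y"] by (simp only: \<zeta>_scale minus_minus)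
qed

abbreviation acting :: "'g fps \<Rightarrow> bool"
  where "acting x \<equiv> \<forall>n. acts (fps_nth x n)"

definition "ca x j i = fps_map (\<lambda>v. a v j i) x"
definition "cb x j i = fps_map (\<lambda>v. b v j i) x"
definition "cc x j i = fps_map (\<lambda>v. c v j i) x"

lemma coefficient_zero: "a 0 j i = 0" "b 0 j i = 0" "c 0 j i = 0"
  using coefficient_linear(2)[of 0 0 j i] coefficient_linear(4)[of 0 0 j i] coefficient_linear(6)[of 0 0 j i] by simp_all

lemma coefficient_sum: "a (sum g A) j i = (\<Sum>k\<in>A. a (g k) j i)" "b (sum g A) j i = (\<Sum>k\<in>A. b (g k) j i)"
    "c (sum g A) j i = (\<Sum>k\<in>A. c (g k) j i)"
  by (induction A rule: infinite_finite_induct; simp add: coefficient_zero coefficient_linear)+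

lemma fps_coefficient_linear:
  "ca (x + y) j i = ca x j i + ca y j i" "ca (fps_scale k x) j i = k * ca x j i"
  "cb (x + y) j i = cb x j i + cb y j i" "cb (fps_scale k x) j i = k * cb x j i"
  "cc (x + y) j i = cc x j i + cc y j i" "cc (fps_scale k x) j i = k * cc x j i"
  by (simp_all add: fps_eq_iff ca_def cb_def cc_def coefficient_linear fps_scale_nth fps_mult_nth coefficient_sum)

lemma fps_coefficient_lie:
  assumes "acting x" "acting y" and ij: "i \<in> I" "j \<in> I"
  shows "cc (fps_lie x y) j i = (\<Sum>k\<in>I. cc x j k * ca y k i - ca x k j * cc y k i)
      - (\<Sum>k\<in>I. cc y j k * ca x k i - ca y k j * cc x k i)"
    "cb (fps_lie x y) j i = (\<Sum>k\<in>I. ca x j k * cb y k i - cb x j k * ca y i k)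
      - (\<Sum>k\<in>I. ca y j k * cb x k i - cb y j k * ca x i k)"
proof -
  \<comment> \<open>In the second half of the block formula x and y are exchanged, hence the
    reversed Cauchy indices n - m and m.\<close>
  have conv: "(\<Sum>m=0..n. (\<Sum>k\<in>I. u k m * v k (n - m) - u' k m * v' k (n - m)) - (\<Sum>k\<in>I. w k (n - m) * t k m - w' k (n - m) * t' k m))
    = fps_nth ((\<Sum>k\<in>I. Abs_fps (u k) * Abs_fps (v k) - Abs_fps (u' k) * Abs_fps (v' k))
        - (\<Sum>k\<in>I. Abs_fps (w k) * Abs_fps (t k) - Abs_fps (w' k) * Abs_fps (t' k))) n"
    for n and u v u' v' w t w' t' :: "'i \<Rightarrow> nat \<Rightarrow> complex"
  proof -
    have rev: "(\<Sum>m=0..n. w k (n - m) * t k m) = fps_nth (Abs_fps (w k) * Abs_fps (t k)) n"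
      for k and w t :: "'i \<Rightarrow> nat \<Rightarrow> complex"
      by (subst mult.commute[of "Abs_fps (w k)"]) (simp add: fps_mult_nth mult.commute)
    have fwd: "(\<Sum>m=0..n. w k m * t k (n - m)) = fps_nth (Abs_fps (w k) * Abs_fps (t k)) n"
      for k and w t :: "'i \<Rightarrow> nat \<Rightarrow> complex"
      by (simp add: fps_mult_nth)
    show ?thesis
      unfolding sum_subtractf fps_sub_nth fps_sum_nth
      by (subst (1 2 3 4) sum.swap) (simp only: rev fwd)
  qed
  have A: "ca x j i = Abs_fps (\<lambda>n. a (fps_nth x n) j i)" "cb x j i = Abs_fps (\<lambda>n. b (fps_nth x n) j i)"
    "cc x j i = Abs_fps (\<lambda>n. c (fps_nth x n) j i)" for x j i
    by (simp_all add: ca_def cb_def cc_def fps_map_def)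
  show "cc (fps_lie x y) j i = (\<Sum>k\<in>I. cc x j k * ca y k i - ca x k j * cc y k i)
      - (\<Sum>k\<in>I. cc y j k * ca x k i - ca y k j * cc x k i)"
    unfolding A(1,3) using assms
    by (intro fps_ext, subst conv[symmetric]) (simp add: fps_lie_nth coefficient_sum coefficient_lie)
  show "cb (fps_lie x y) j i = (\<Sum>k\<in>I. ca x j k * cb y k i - cb x j k * ca y i k)
      - (\<Sum>k\<in>I. ca y j k * cb x k i - cb y j k * ca x i k)"
    unfolding A(1,2) using assms
    by (intro fps_ext, subst conv[symmetric]) (simp add: fps_lie_nth coefficient_sum coefficient_lie)
qed

lemma hat_emb_commutator: "hat x * emb v - emb v * hat x = Abs_fps (\<lambda>n. uea_inj (lie (fps_nth x n) v))"
  by (simp add: fps_eq_iff uea_inj_lie)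

lemma fps_scale_emb: "fps_scale k (emb v) = Abs_fps (\<lambda>n. uea_inj (fps_nth k n *\<^sub>C v))"
proof (rule fps_ext)
  fix n
  have "fps_nth (fps_scale k (emb v)) n = (\<Sum>i=0..n. if i = n then fps_nth k n *\<^sub>C uea_inj v else 0)"
    unfolding fps_scale_nth by (intro sum.cong) auto
  then show "fps_nth (fps_scale k (emb v)) n = fps_nth (Abs_fps (\<lambda>n. uea_inj (fps_nth k n *\<^sub>C v))) n"
    by (simp add: uea_inj_scaleC)
qed

lemma hat_e:
  assumes "acting x" "i \<in> I"
  shows "hat x * emb (e i) = emb (e i) * hat x
    + ((\<Sum>j\<in>I. fps_scale (ca x j i) (emb (e j))) + (\<Sum>j\<in>I. fps_scale (cc x j i) (emb (f j))))"
proof -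
  have "hat x * emb (e i) - emb (e i) * hat x
     = (\<Sum>j\<in>I. fps_scale (ca x j i) (emb (e j))) + (\<Sum>j\<in>I. fps_scale (cc x j i) (emb (f j)))"
    unfolding hat_emb_commutator fps_scale_emb using assms
    by (simp add: fps_eq_iff fps_sum_nth acts_e uea_inj_add uea_inj_sum ca_def cc_def)
  then show ?thesis by (simp add: algebra_simps)
qed

lemma hat_f:
  assumes "acting x" "i \<in> I"
  shows "hat x * emb (f i) = emb (f i) * hat x
    + ((\<Sum>j\<in>I. fps_scale (cb x j i) (emb (e j))) - (\<Sum>j\<in>I. fps_scale (ca x i j) (emb (f j))))"
proof -
  have diff: "uea_inj (u - v) = uea_inj u - uea_inj v" for u v :: 'g
    using uea_inj_add[of "u - v" v] by simp
  have "hat x * emb (f i) - emb (f i) * hat x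
     = (\<Sum>j\<in>I. fps_scale (cb x j i) (emb (e j))) - (\<Sum>j\<in>I. fps_scale (ca x i j) (emb (f j)))"
    unfolding hat_emb_commutator fps_scale_emb using assms
    by (simp add: fps_eq_iff fps_sum_nth acts_f diff uea_inj_sum ca_def cb_def)
  then show ?thesis by (simp add: algebra_simps)
qed

lemma hat_H: "acting x \<Longrightarrow> hat x * emb H = emb H * hat x"
  using hat_emb_commutator[of x H] by (simp add: acts_def uea_inj_zero fps_eq_iff)

lemma cc_sym: "acting x \<Longrightarrow> i \<in> I \<Longrightarrow> j \<in> I \<Longrightarrow> cc x i j = cc x j i"
  by (simp add: cc_def fps_eq_iff c_sym)

lemma cb_sym: "acting x \<Longrightarrow> i \<in> I \<Longrightarrow> j \<in> I \<Longrightarrow> cb x i j = cb x j i"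
  by (simp add: cb_def fps_eq_iff b_sym)

end

section \<open>The deformed embedding\<close>

text \<open>These rules would merge products of embedded Lie algebra elements into one constant series
  and hide them from the commutation rules.\<close>

declare fps_const_mult [simp del] fps_const_neg [simp del]

lemma commutator_mult_right: "commutator w (u * v) = commutator w u * v + u * commutator w v"
  and commutator_mult_left: "commutator (u * v) w = u * commutator v w + commutator u w * v"
  and commutator_add_right: "commutator w (u + v) = commutator w u + commutator w v"
  and commutator_add_left: "commutator (u + v) w = commutator u w + commutator v w"
  and commutator_anti: "commutator u w = - commutator w u"
  for u v w :: "'a::ring"
  by (simp_all add: commutator_def algebra_simps)

lemma commutator_sum_right: "commutator w (sum g A) = (\<Sum>i\<in>A. commutator w (g i))"
  and commutator_sum_left: "commutator (sum g A) w = (\<Sum>i\<in>A. commutator (g i) w)"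
  for w :: "'a::ring"
  by (simp_all add: commutator_def sum_distrib_left sum_distrib_right sum_subtractf)

lemma commutator_scale_right: "commutator w (fps_scale k u) = fps_scale k (commutator w u)"
  and commutator_scale_left: "commutator (fps_scale k u) w = fps_scale k (commutator u w)"
  for u w :: "'a::complex_algebra_1 fps"
  by (simp_all add: commutator_def fps_scale_mult_left fps_scale_mult_right fsm.scale_right_diff_distrib)

lemma commutator_eq_0_iff: "commutator u w = 0 \<longleftrightarrow> u * w = w * u" for u w :: "'a::ring"
  by (simp add: commutator_def)

lemma root_exp_commute:
  assumes "\<And>n. uea_inj z * fps_nth y n = fps_nth y n * uea_inj z"
  shows "root_exp r z * y = y * root_exp r z"
  unfolding root_exp_def by (rule fps_eval_at_map_commute[OF assms])

lemma root_exp_mult: "root_exp r z * root_exp r' z = root_exp (r + r') z"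
  by (simp add: root_exp_add)

definition matmul :: "'i set \<Rightarrow> ('i \<Rightarrow> 'i \<Rightarrow> 'a::comm_ring_1) \<Rightarrow> ('i \<Rightarrow> 'i \<Rightarrow> 'a) \<Rightarrow> 'i \<Rightarrow> 'i \<Rightarrow> 'a"
  where "matmul I M N i j = (\<Sum>k\<in>I. M i k * N k j)"

abbreviation (input) tr :: "('i \<Rightarrow> 'i \<Rightarrow> 'a) \<Rightarrow> 'i \<Rightarrow> 'i \<Rightarrow> 'a" where "tr M \<equiv> \<lambda>i j. M j i"

definition quad :: "'i set \<Rightarrow> ('i \<Rightarrow> 'i \<Rightarrow> complex fps) \<Rightarrow> ('i \<Rightarrow> 'a fps) \<Rightarrow> ('i \<Rightarrow> 'a fps) \<Rightarrow> 'a::complex_algebra_1 fps"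
  where "quad I M u v = (\<Sum>i\<in>I. \<Sum>j\<in>I. fps_scale (M i j) (u i * v j))"

lemma quad_cong:
  "(\<And>i j. i \<in> I \<Longrightarrow> j \<in> I \<Longrightarrow> fps_scale (M i j) (u i * v j) = fps_scale (M' i j) (u' i * v' j)) \<Longrightarrow> quad I M u v = quad I M' u' v'"
  unfolding quad_def by (intro sum.cong refl)

lemma quad_linear:
  "quad I (\<lambda>i j. M i j + M' i j) u v = quad I M u v + quad I M' u v"
  "quad I (\<lambda>i j. M i j - M' i j) u v = quad I M u v - quad I M' u v"
  "quad I (\<lambda>i j. k * M i j) u v = fps_scale k (quad I M u v)"
  "quad I M (\<lambda>i. u i + u' i) v = quad I M u v + quad I M u' v"
  "quad I M (\<lambda>i. u i - u' i) v = quad I M u v - quad I M u' v"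
  "quad I M u (\<lambda>j. v j + v' j) = quad I M u v + quad I M u v'"
  "quad I M u (\<lambda>j. v j - v' j) = quad I M u v - quad I M u v'"
  unfolding quad_def
  by (simp_all add: fsm.scale_left_distrib fsm.scale_right_distrib fsm.scale_left_diff_distrib
      fsm.scale_right_diff_distrib distrib_left distrib_right left_diff_distrib right_diff_distrib
      sum.distrib sum_subtractf fsm.scale_sum_right)

text \<open>A linear substitution in the vectors is absorbed into the matrix; commutators of
  quadratic expressions then reduce to matrix products.\<close>

lemma quad_left: "quad I M (\<lambda>i. \<Sum>k\<in>I. fps_scale (N k i) (u k)) v = quad I (matmul I N M) u v"
proof -
  have "quad I M (\<lambda>i. \<Sum>k\<in>I. fps_scale (N k i) (u k)) v
    = (\<Sum>i\<in>I. \<Sum>j\<in>I. \<Sum>k\<in>I. fps_scale (N k i * M i j) (u k * v j))"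
    by (simp add: quad_def sum_distrib_right fps_scale_mult_left fsm.scale_sum_right mult.commute)
  also have "\<dots> = (\<Sum>k\<in>I. \<Sum>j\<in>I. \<Sum>i\<in>I. fps_scale (N k i * M i j) (u k * v j))"
    by (subst sum.swap, subst (2) sum.swap, subst sum.swap, rule refl)
  finally show ?thesis by (simp add: quad_def matmul_def fsm.scale_sum_left)
qed

lemma quad_right: "quad I M u (\<lambda>j. \<Sum>k\<in>I. fps_scale (N j k) (v k)) = quad I (matmul I M N) u v"
proof -
  have "quad I M u (\<lambda>j. \<Sum>k\<in>I. fps_scale (N j k) (v k))
    = (\<Sum>i\<in>I. \<Sum>j\<in>I. \<Sum>k\<in>I. fps_scale (M i j * N j k) (u i * v k))"
    by (simp add: quad_def sum_distrib_left fps_scale_mult_right fsm.scale_sum_right)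
  also have "\<dots> = (\<Sum>i\<in>I. \<Sum>k\<in>I. \<Sum>j\<in>I. fps_scale (M i j * N j k) (u i * v k))"
    by (subst (2) sum.swap, rule refl)
  finally show ?thesis by (simp add: quad_def matmul_def fsm.scale_sum_left)
qed

lemma quad_delta_left:
  "finite I \<Longrightarrow> k \<in> I \<Longrightarrow> quad I M (\<lambda>i. if i = k then y else 0) v = (\<Sum>j\<in>I. fps_scale (M k j) (y * v j))"
  by (simp add: quad_def if_distrib if_distribR sum.delta cong: if_cong)
    (subst sum.swap, simp add: if_distrib if_distribR sum.delta cong: if_cong)

lemma quad_delta_right:
  "finite I \<Longrightarrow> k \<in> I \<Longrightarrow> quad I M u (\<lambda>j. if j = k then y else 0) = (\<Sum>i\<in>I. fps_scale (M i k) (u i * y))"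
  by (simp add: quad_def if_distrib if_distribR sum.delta cong: if_cong)

lemma commutator_quad_right:
  "commutator w (quad I M u v) = quad I M (\<lambda>i. commutator w (u i)) v + quad I M u (\<lambda>j. commutator w (v j))"
  by (simp add: quad_def commutator_sum_right commutator_scale_right commutator_mult_right
      fsm.scale_right_distrib sum.distrib)

lemma commutator_quad_left:
  "commutator (quad I M u v) w = quad I M u (\<lambda>j. commutator (v j) w) + quad I M (\<lambda>i. commutator (u i) w) v"
  by (simp add: quad_def commutator_sum_left commutator_scale_left commutator_mult_left
      fsm.scale_right_distrib sum.distrib)

lemma half_X: "fps_scale (fps_const (1 / 2) * fps_X) y + fps_scale (fps_const (1 / 2) * fps_X) y = fps_X * y"
  for y :: "'a::complex_algebra_1 fps"
proof -
  have "fps_const (1 / 2) + fps_const (1 / 2) = (1 :: complex fps)" by (simp only: fps_const_add) simp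
  then have "fps_const (1 / 2) * fps_X + fps_const (1 / 2) * fps_X = (fps_X :: complex fps)"
    by (simp only: distrib_right[symmetric] mult_1_left)
  then show ?thesis by (simp only: fsm.scale_left_distrib[symmetric] fps_scale_X)
qed

context heisenberg
begin

abbreviation "e' \<equiv> \<lambda>i. emb (e i)"
abbreviation "f' \<equiv> \<lambda>i. emb (f i)"
abbreviation "z' \<equiv> emb z"
abbreviation "q \<equiv> root_exp 1 z"
abbreviation "q1 \<equiv> root_exp (- 1) z"

text \<open>\<open>deformed x\<close> below acts on \<open>e\<close> and \<open>ft\<close> by the matrix with which \<open>x\<close> acts on \<open>e\<close> and \<open>f\<close>.\<close>

definition "ft i = f' i * q1"

lemma q_inverse: "q * q1 = 1" "q1 * q = 1"
  using root_exp_mult[of 1 z "- 1"] root_exp_mult[of "- 1" z 1] by (simp_all add: root_exp_0)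

lemma z_central: "i \<in> I \<Longrightarrow> z' * e' i = e' i * z'" "i \<in> I \<Longrightarrow> z' * f' i = f' i * z'"
  using emb_mult[of z "e i"] emb_mult[of z "f i"] by (simp_all add: ze zf uea_inj_zero)

lemma root_exp_central:
  "i \<in> I \<Longrightarrow> root_exp r z * e' i = e' i * root_exp r z" "i \<in> I \<Longrightarrow> root_exp r z * f' i = f' i * root_exp r z"
  "root_exp r z * z' = z' * root_exp r z"
  "acting x \<Longrightarrow> root_exp r z * hat x = hat x * root_exp r z"
proof -
  have *: "uea_inj z * uea_inj v = uea_inj v * uea_inj z" if "lie z v = 0" for v
    using uea_inj_lie[of z v] by (simp add: that uea_inj_zero)
  show "i \<in> I \<Longrightarrow> root_exp r z * e' i = e' i * root_exp r z" "i \<in> I \<Longrightarrow> root_exp r z * f' i = f' i * root_exp r z"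
    "root_exp r z * z' = z' * root_exp r z"
    using *[of "e i"] *[of "f i"] by (auto intro!: root_exp_commute simp: ze zf)
  assume "acting x"
  then have "lie z (fps_nth x n) = 0" for n
    using lie_anti[of z "fps_nth x n"] by (simp add: acts_def)
  then show "root_exp r z * hat x = hat x * root_exp r z"
    using * by (intro root_exp_commute) simp
qed

lemma commutator_basis:
  "i \<in> I \<Longrightarrow> j \<in> I \<Longrightarrow> commutator (e' i) (e' j) = 0" "i \<in> I \<Longrightarrow> j \<in> I \<Longrightarrow> commutator (f' i) (f' j) = 0"
  "i \<in> I \<Longrightarrow> j \<in> I \<Longrightarrow> commutator (e' i) (f' j) = (if i = j then z' else 0)"
  "i \<in> I \<Longrightarrow> j \<in> I \<Longrightarrow> commutator (f' i) (e' j) = (if i = j then - z' else 0)"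
proof -
  have "uea_inj (- z) = - uea_inj z" using uea_inj_scaleC[of "- 1" z] by simp
  then show "i \<in> I \<Longrightarrow> j \<in> I \<Longrightarrow> commutator (e' i) (e' j) = 0" "i \<in> I \<Longrightarrow> j \<in> I \<Longrightarrow> commutator (f' i) (f' j) = 0"
  "i \<in> I \<Longrightarrow> j \<in> I \<Longrightarrow> commutator (e' i) (f' j) = (if i = j then z' else 0)"
  "i \<in> I \<Longrightarrow> j \<in> I \<Longrightarrow> commutator (f' i) (e' j) = (if i = j then - z' else 0)"
    unfolding commutator_def emb_commutator by (auto simp: ee ff ef fe uea_inj_zero fps_const_neg)
qed

lemma commutator_q: "i \<in> I \<Longrightarrow> commutator (root_exp r z) (e' i) = 0" "i \<in> I \<Longrightarrow> commutator (e' i) (root_exp r z) = 0"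
  "i \<in> I \<Longrightarrow> commutator (root_exp r z) (f' i) = 0" "i \<in> I \<Longrightarrow> commutator (f' i) (root_exp r z) = 0"
  "acting x \<Longrightarrow> commutator (hat x) (root_exp r z) = 0"
  by (simp_all add: commutator_eq_0_iff root_exp_central)

lemma commutator_ft: "i \<in> I \<Longrightarrow> k \<in> I \<Longrightarrow> commutator (ft i) (e' k) = (if i = k then - (z' * q1) else 0)"
  "i \<in> I \<Longrightarrow> k \<in> I \<Longrightarrow> commutator (ft i) (f' k) = 0"
  by (simp_all add: ft_def commutator_mult_left commutator_q commutator_basis)

text \<open>From f = ft (1 + \<xi> z). The subtracted term is the one that the quadratic correction
  contributes to the commutator with e.\<close>

lemma f_ft: "f' j - fps_X * (z' * ft j) = ft j" if "j \<in> I"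
proof -
  have "f' j = f' j * (q1 * q)" by (simp add: q_inverse)
  also have "\<dots> = ft j * (1 + fps_X * z')" by (simp add: ft_def mult.assoc root_exp_1)
  also have "\<dots> = ft j + fps_X * (ft j * z')"
    by (simp add: distrib_left mult.assoc[symmetric] fps_X_central[of "ft j"])
  also have "ft j * z' = z' * ft j"
    using that by (simp add: ft_def mult.assoc root_exp_central) (simp add: z_central flip: mult.assoc)
  finally show ?thesis by (simp add: algebra_simps)
qed

abbreviation "QC x \<equiv> quad I (cc x) f' ft"
abbreviation "QB x \<equiv> quad I (cb x) e' e'"

definition deformed :: "'g fps \<Rightarrow> 'g uea fps"
  where "deformed x = hat x + fps_scale (fps_const (1 / 2) * fps_X) (QC x + QB x)"

lemma hat_commutator_e:
  "acting x \<Longrightarrow> i \<in> I \<Longrightarrow> commutator (hat x) (e' i)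
    = (\<Sum>j\<in>I. fps_scale (ca x j i) (e' j)) + (\<Sum>j\<in>I. fps_scale (cc x j i) (f' j))"
  by (simp add: commutator_def hat_e)

lemma hat_commutator_f:
  "acting x \<Longrightarrow> i \<in> I \<Longrightarrow> commutator (hat x) (f' i)
    = (\<Sum>j\<in>I. fps_scale (cb x j i) (e' j)) - (\<Sum>j\<in>I. fps_scale (ca x i j) (f' j))"
  by (simp add: commutator_def hat_f)

lemma hat_commutator_ft:
  assumes "acting x" "i \<in> I"
  shows "commutator (hat x) (ft i)
    = (\<Sum>j\<in>I. fps_scale (cb x j i) (e' j * q1)) - (\<Sum>j\<in>I. fps_scale (ca x i j) (ft j))"
  using assms
  by (simp add: ft_def commutator_mult_right commutator_q hat_commutator_f left_diff_distrib
      sum_distrib_right fps_scale_mult_left)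

text \<open>Both factors in \<open>QC\<close> contribute the same term by symmetry of block
  \<open>c\<close>. With the factor \<xi>/2 they add up to -\<xi> c z ft, which turns the f in
  [x, e] into ft.\<close>

lemma deformed_commutator_e:
  assumes x: "acting x" and k: "k \<in> I"
  shows "commutator (deformed x) (e' k)
    = (\<Sum>j\<in>I. fps_scale (ca x j k) (e' j)) + (\<Sum>j\<in>I. fps_scale (cc x j k) (ft j))"
proof -
  let ?Y = "\<Sum>j\<in>I. fps_scale (cc x j k) (z' * ft j)"
  have "quad I (cc x) f' (\<lambda>j. commutator (ft j) (e' k)) = quad I (cc x) f' (\<lambda>j. if j = k then - (z' * q1) else 0)"
    using k by (intro quad_cong) (simp add: commutator_ft)
  also have "\<dots> = (\<Sum>j\<in>I. fps_scale (cc x j k) (f' j * (- (z' * q1))))"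
    using fin k by (rule quad_delta_right)
  also have "\<dots> = - ?Y"
    unfolding sum_negf[symmetric]
    by (intro sum.cong refl) (simp add: ft_def mult.assoc[symmetric] z_central)
  finally have 1: "quad I (cc x) f' (\<lambda>j. commutator (ft j) (e' k)) = - ?Y" .
  have "quad I (cc x) (\<lambda>i. commutator (f' i) (e' k)) ft = quad I (cc x) (\<lambda>i. if i = k then - z' else 0) ft"
    using k by (intro quad_cong) (simp add: commutator_basis)
  also have "\<dots> = (\<Sum>j\<in>I. fps_scale (cc x k j) (- z' * ft j))"
    using fin k by (rule quad_delta_left)
  also have "\<dots> = - ?Y"
    unfolding sum_negf[symmetric] using x k
    by (intro sum.cong refl) (simp add: cc_sym[of x k])
  finally have 2: "quad I (cc x) (\<lambda>i. commutator (f' i) (e' k)) ft = - ?Y" .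
  have 3: "quad I (cb x) e' (\<lambda>j. commutator (e' j) (e' k)) = quad I (\<lambda>_ _. 0) e' e'"
    "quad I (cb x) (\<lambda>i. commutator (e' i) (e' k)) e' = quad I (\<lambda>_ _. 0) e' e'"
    using k by (auto intro!: quad_cong simp: commutator_basis)
  have zero: "quad I (\<lambda>_ _. 0) u v = 0" for u v :: "_ \<Rightarrow> 'g uea fps" by (simp add: quad_def)
  have "commutator (deformed x) (e' k) = commutator (hat x) (e' k)
      - (fps_scale (fps_const (1 / 2) * fps_X) ?Y + fps_scale (fps_const (1 / 2) * fps_X) ?Y)"
    by (simp add: deformed_def commutator_add_left commutator_scale_left commutator_quad_left 1 2 3 zero
        fsm.scale_right_diff_distrib)
  also have "\<dots> = (\<Sum>j\<in>I. fps_scale (ca x j k) (e' j))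
      + (\<Sum>j\<in>I. fps_scale (cc x j k) (f' j) - fps_X * fps_scale (cc x j k) (z' * ft j))"
    unfolding half_X by (simp add: hat_commutator_e x k sum_subtractf sum_distrib_left)
  also have "(\<Sum>j\<in>I. fps_scale (cc x j k) (f' j) - fps_X * fps_scale (cc x j k) (z' * ft j))
      = (\<Sum>j\<in>I. fps_scale (cc x j k) (ft j))"
    by (intro sum.cong refl)
      (simp add: fps_scale_mult_right fsm.scale_right_diff_distrib[symmetric] f_ft)
  finally show ?thesis .
qed

text \<open>\<open>QB\<close> adds \<xi> b e z, which turns e into e (1 + \<xi> z). The factor (1 +
  \<xi> z)^-1 in ft removes it again in \<open>deformed_commutator_ft\<close>.\<close>

lemma deformed_commutator_f:
  assumes x: "acting x" and k: "k \<in> I"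
  shows "commutator (deformed x) (f' k)
    = (\<Sum>j\<in>I. fps_scale (cb x j k) (e' j * q)) - (\<Sum>j\<in>I. fps_scale (ca x k j) (f' j))"
proof -
  let ?Y = "\<Sum>j\<in>I. fps_scale (cb x j k) (e' j * z')"
  have "quad I (cb x) e' (\<lambda>j. commutator (e' j) (f' k)) = quad I (cb x) e' (\<lambda>j. if j = k then z' else 0)"
    using k by (intro quad_cong) (simp add: commutator_basis)
  also have "\<dots> = ?Y" using fin k by (rule quad_delta_right)
  finally have 1: "quad I (cb x) e' (\<lambda>j. commutator (e' j) (f' k)) = ?Y" .
  have "quad I (cb x) (\<lambda>i. commutator (e' i) (f' k)) e' = quad I (cb x) (\<lambda>i. if i = k then z' else 0) e'"
    using k by (intro quad_cong) (simp add: commutator_basis)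
  also have "\<dots> = (\<Sum>j\<in>I. fps_scale (cb x k j) (z' * e' j))"
    using fin k by (rule quad_delta_left)
  also have "\<dots> = ?Y"
    using x k by (intro sum.cong refl) (simp add: cb_sym[of x k] z_central del: fps_const_mult)
  finally have 2: "quad I (cb x) (\<lambda>i. commutator (e' i) (f' k)) e' = ?Y" .
  have 3: "quad I (cc x) f' (\<lambda>j. commutator (ft j) (f' k)) = quad I (\<lambda>_ _. 0) e' e'"
    "quad I (cc x) (\<lambda>i. commutator (f' i) (f' k)) ft = quad I (\<lambda>_ _. 0) e' e'"
    using k by (auto intro!: quad_cong simp: commutator_basis commutator_ft)
  have zero: "quad I (\<lambda>_ _. 0) u v = 0" for u v :: "_ \<Rightarrow> 'g uea fps" by (simp add: quad_def)
  have "commutator (deformed x) (f' k) = commutator (hat x) (f' k)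
      + (fps_scale (fps_const (1 / 2) * fps_X) ?Y + fps_scale (fps_const (1 / 2) * fps_X) ?Y)"
    by (simp add: deformed_def commutator_add_left commutator_scale_left commutator_quad_left 1 2 3 zero
        fsm.scale_right_distrib)
  also have "\<dots> = (\<Sum>j\<in>I. fps_scale (cb x j k) (e' j) + fps_X * fps_scale (cb x j k) (e' j * z'))
      - (\<Sum>j\<in>I. fps_scale (ca x k j) (f' j))"
    unfolding half_X by (simp add: hat_commutator_f x k sum.distrib sum_distrib_left)
  also have "(\<Sum>j\<in>I. fps_scale (cb x j k) (e' j) + fps_X * fps_scale (cb x j k) (e' j * z'))
      = (\<Sum>j\<in>I. fps_scale (cb x j k) (e' j * q))"
  proof (intro sum.cong refl)
    fix j
    have "e' j * q = e' j + fps_X * (e' j * z')"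
      by (simp add: root_exp_1 distrib_left mult.assoc[symmetric] fps_X_central[of "e' j"] del: fps_const_mult)
    then show "fps_scale (cb x j k) (e' j) + fps_X * fps_scale (cb x j k) (e' j * z') = fps_scale (cb x j k) (e' j * q)"
      by (simp only: fps_scale_mult_right fsm.scale_right_distrib)
  qed
  finally show ?thesis .
qed

lemma deformed_commutator_q:
  assumes x: "acting x" shows "commutator (deformed x) q1 = 0"
proof -
  have "commutator (QC x) q1 = 0" "commutator (QB x) q1 = 0"
    by (simp_all add: quad_def ft_def commutator_sum_left commutator_scale_left commutator_mult_left commutator_q)
      (simp_all add: commutator_def)
  then show ?thesis
    by (simp add: deformed_def commutator_add_left commutator_scale_left commutator_q x)
qed

lemma deformed_commutator_ft:
  assumes x: "acting x" and k: "k \<in> I"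
  shows "commutator (deformed x) (ft k)
    = (\<Sum>j\<in>I. fps_scale (cb x j k) (e' j)) - (\<Sum>j\<in>I. fps_scale (ca x k j) (ft j))"
  using assms
  by (simp add: ft_def commutator_mult_right deformed_commutator_q deformed_commutator_f
      left_diff_distrib sum_distrib_right fps_scale_mult_left mult.assoc q_inverse)

text \<open>In [deformed x, deformed y] the quadratic part of y is moved by the matrix of
  \<open>deformed x\<close> in e, f and ft, the quadratic part of x by the matrix of
  \<open>hat y\<close>. The mixed terms in e and f cancel, and the rest are the \<open>b\<close> and
  \<open>c\<close> blocks of the matrix commutator.\<close>

lemma deformed_lie:
  assumes x: "acting x" and y: "acting y"
  shows "deformed (fps_lie x y) = commutator (deformed x) (deformed y)"
proof -
  have sym: "(\<Sum>j\<in>I. fps_scale (cb u j k) (w j)) = (\<Sum>j\<in>I. fps_scale (cb u k j) (w j))"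
    "(\<Sum>j\<in>I. fps_scale (cc u j k) (w j)) = (\<Sum>j\<in>I. fps_scale (cc u k j) (w j))"
    if "acting u" "k \<in> I" for u k and w :: "_ \<Rightarrow> 'g uea fps"
    using that by (auto intro!: sum.cong simp: cb_sym[of u _ k] cc_sym[of u _ k])
  let ?hX = "fps_const (1 / 2) * fps_X :: complex fps"
  have Q1: "commutator (deformed x) (QC y) = quad I (matmul I (cb x) (cc y)) (\<lambda>i. e' i * q) ft - quad I (matmul I (tr (ca x)) (cc y)) f' ft
     + (quad I (matmul I (cc y) (cb x)) f' e' - quad I (matmul I (cc y) (ca x)) f' ft)"
  proof -
    have "quad I (cc y) (\<lambda>i. commutator (deformed x) (f' i)) ft = quad I (cc y) (\<lambda>i.
       (\<Sum>j\<in>I. fps_scale (cb x j i) (e' j * q)) - (\<Sum>j\<in>I. fps_scale (ca x i j) (f' j))) ft"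
      by (intro quad_cong) (simp add: deformed_commutator_f x)
    moreover have "quad I (cc y) f' (\<lambda>i. commutator (deformed x) (ft i)) = quad I (cc y) f' (\<lambda>i.
       (\<Sum>j\<in>I. fps_scale (cb x i j) (e' j)) - (\<Sum>j\<in>I. fps_scale (ca x i j) (ft j)))"
      by (intro quad_cong) (simp add: deformed_commutator_ft x sym)
    ultimately show ?thesis
      unfolding commutator_quad_right by (simp only: quad_linear quad_left quad_right)
  qed
  have Q2: "commutator (deformed x) (QB y) = quad I (matmul I (ca x) (cb y)) e' e' + quad I (matmul I (cc x) (cb y)) ft e'
     + (quad I (matmul I (cb y) (tr (ca x))) e' e' + quad I (matmul I (cb y) (cc x)) e' ft)"
  proof -
    have "quad I (cb y) (\<lambda>i. commutator (deformed x) (e' i)) e' = quad I (cb y) (\<lambda>i.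
       (\<Sum>j\<in>I. fps_scale (ca x j i) (e' j)) + (\<Sum>j\<in>I. fps_scale (cc x j i) (ft j))) e'"
      by (intro quad_cong) (simp add: deformed_commutator_e x)
    moreover have "quad I (cb y) e' (\<lambda>i. commutator (deformed x) (e' i)) = quad I (cb y) e' (\<lambda>i.
       (\<Sum>j\<in>I. fps_scale (ca x j i) (e' j)) + (\<Sum>j\<in>I. fps_scale (cc x i j) (ft j)))"
      by (intro quad_cong) (simp add: deformed_commutator_e x sym)
    ultimately show ?thesis
      unfolding commutator_quad_right by (simp only: quad_linear quad_left quad_right)
  qed
  have R1: "commutator (hat y) (QC x) = quad I (matmul I (cb y) (cc x)) e' ft - quad I (matmul I (tr (ca y)) (cc x)) f' ft
     + (quad I (matmul I (cc x) (cb y)) f' (\<lambda>i. e' i * q1) - quad I (matmul I (cc x) (ca y)) f' ft)"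
  proof -
    have "quad I (cc x) (\<lambda>i. commutator (hat y) (f' i)) ft = quad I (cc x) (\<lambda>i.
       (\<Sum>j\<in>I. fps_scale (cb y j i) (e' j)) - (\<Sum>j\<in>I. fps_scale (ca y i j) (f' j))) ft"
      by (intro quad_cong) (simp add: hat_commutator_f y)
    moreover have "quad I (cc x) f' (\<lambda>i. commutator (hat y) (ft i)) = quad I (cc x) f' (\<lambda>i.
       (\<Sum>j\<in>I. fps_scale (cb y i j) (e' j * q1)) - (\<Sum>j\<in>I. fps_scale (ca y i j) (ft j)))"
      by (intro quad_cong) (simp add: hat_commutator_ft y sym)
    ultimately show ?thesis
      unfolding commutator_quad_right by (simp only: quad_linear quad_left quad_right)
  qed
  have R2: "commutator (hat y) (QB x) = quad I (matmul I (ca y) (cb x)) e' e' + quad I (matmul I (cc y) (cb x)) f' e'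
     + (quad I (matmul I (cb x) (tr (ca y))) e' e' + quad I (matmul I (cb x) (cc y)) e' f')"
  proof -
    have "quad I (cb x) (\<lambda>i. commutator (hat y) (e' i)) e' = quad I (cb x) (\<lambda>i.
       (\<Sum>j\<in>I. fps_scale (ca y j i) (e' j)) + (\<Sum>j\<in>I. fps_scale (cc y j i) (f' j))) e'"
      by (intro quad_cong) (simp add: hat_commutator_e y)
    moreover have "quad I (cb x) e' (\<lambda>i. commutator (hat y) (e' i)) = quad I (cb x) e' (\<lambda>i.
       (\<Sum>j\<in>I. fps_scale (ca y j i) (e' j)) + (\<Sum>j\<in>I. fps_scale (cc y i j) (f' j)))"
      by (intro quad_cong) (simp add: hat_commutator_e y sym)
    ultimately show ?thesis
      unfolding commutator_quad_right by (simp only: quad_linear quad_left quad_right)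
  qed
  \<comment> \<open>Shifting the powers of 1 + \<xi> z makes the mixed terms on both sides literally
    equal, so that e and f never have to be reordered.\<close>
  have S1: "quad I M (\<lambda>i. e' i * q) ft = quad I M e' f'" for M
  proof (rule quad_cong)
    fix i j assume "i \<in> I" "j \<in> I"
    then have "e' i * q * ft j = e' i * (f' j * (q * q1))"
      by (simp add: ft_def mult.assoc) (simp add: root_exp_central flip: mult.assoc)
    then show "fps_scale (M i j) (e' i * q * ft j) = fps_scale (M i j) (e' i * f' j)" by (simp add: q_inverse)
  qed
  have S2: "quad I M f' (\<lambda>i. e' i * q1) = quad I M ft e'" for M
    by (rule quad_cong) (simp add: ft_def mult.assoc root_exp_central)
  have "quad I (cc (fps_lie x y)) f' ft = quad I (\<lambda>j i.
      (matmul I (cc x) (ca y) j i - matmul I (tr (ca x)) (cc y) j i) - (matmul I (cc y) (ca x) j i - matmul I (tr (ca y)) (cc x) j i)) f' ft"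
    using x y by (intro quad_cong) (simp add: fps_coefficient_lie matmul_def sum_subtractf)
  then have C: "QC (fps_lie x y) = (quad I (matmul I (cc x) (ca y)) f' ft - quad I (matmul I (tr (ca x)) (cc y)) f' ft)
      - (quad I (matmul I (cc y) (ca x)) f' ft - quad I (matmul I (tr (ca y)) (cc x)) f' ft)"
    by (simp only: quad_linear)
  have "quad I (cb (fps_lie x y)) e' e' = quad I (\<lambda>j i.
      (matmul I (ca x) (cb y) j i - matmul I (cb x) (tr (ca y)) j i) - (matmul I (ca y) (cb x) j i - matmul I (cb y) (tr (ca x)) j i)) e' e'"
    using x y by (intro quad_cong) (simp add: fps_coefficient_lie matmul_def sum_subtractf)
  then have B: "QB (fps_lie x y) = (quad I (matmul I (ca x) (cb y)) e' e' - quad I (matmul I (cb x) (tr (ca y))) e' e')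
      - (quad I (matmul I (ca y) (cb x)) e' e' - quad I (matmul I (cb y) (tr (ca x))) e' e')"
    by (simp only: quad_linear)
  have sum: "QC (fps_lie x y) + QB (fps_lie x y) = commutator (deformed x) (QC y) + commutator (deformed x) (QB y)
      - (commutator (hat y) (QC x) + commutator (hat y) (QB x))"
    unfolding Q1 Q2 R1 R2 S1 S2 B C by (simp add: algebra_simps)
  have "commutator (deformed x) (hat y) = hat (fps_lie x y) - fps_scale ?hX (commutator (hat y) (QC x) + commutator (hat y) (QB x))"
    unfolding deformed_def commutator_add_left commutator_scale_left
    by (subst (2 3) commutator_anti)
      (simp add: hat_lie commutator_def[of "hat x" "hat y"] fsm.scale_right_distrib fsm.scale_right_diff_distrib)
  moreover have "commutator (deformed x) (deformed y) = commutator (deformed x) (hat y)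
      + fps_scale ?hX (commutator (deformed x) (QC y) + commutator (deformed x) (QB y))"
    by (subst (2) deformed_def) (simp only: commutator_add_right commutator_scale_right fsm.scale_right_distrib)
  ultimately show ?thesis
    unfolding deformed_def[of "fps_lie x y"] sum by (simp add: fsm.scale_right_diff_distrib)
qed

lemma deformed_add: "deformed (x + y) = deformed x + deformed y"
proof -
  have "cc (x + y) = (\<lambda>j i. cc x j i + cc y j i)" "cb (x + y) = (\<lambda>j i. cb x j i + cb y j i)"
    by (intro ext, rule fps_coefficient_linear)+
  then show ?thesis by (simp add: deformed_def hat_add quad_linear fsm.scale_right_distrib)
qed

lemma deformed_scale: "deformed (fps_scale k x) = fps_scale k (deformed x)"
proof -
  have "cc (fps_scale k x) = (\<lambda>j i. k * cc x j i)" "cb (fps_scale k x) = (\<lambda>j i. k * cb x j i)"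
    by (intro ext, rule fps_coefficient_linear)+
  then show ?thesis by (simp add: deformed_def hat_scale quad_linear fsm.scale_right_distrib mult_ac)
qed

lemma deformed_nth_0: "fps_nth (deformed x) 0 = uea_inj (fps_nth x 0)"
proof -
  have "fps_nth (fps_scale (fps_const (1 / 2) * fps_X) y) 0 = 0" for y :: "'g uea fps"
    by (simp add: fps_scale_nth)
  then show ?thesis by (simp add: deformed_def)
qed

end

section \<open>The twist and its primitive elements\<close>

lemma tensor_mult: "(u \<otimes>\<^sub>\<xi> v) * (u' \<otimes>\<^sub>\<xi> v') = (u * u') \<otimes>\<^sub>\<xi> (v * v')"
  for u v u' v' :: "'a::complex_algebra_1 fps"
proof -
  have "left_leg u * right_leg v * (left_leg u' * right_leg v')
      = left_leg u * (right_leg v * left_leg u') * right_leg v'"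
    by (simp only: mult.assoc)
  also have "\<dots> = left_leg u * left_leg u' * (right_leg v * right_leg v')"
    by (simp only: legs_commute mult.assoc)
  finally show ?thesis by (simp only: fps_tensor_conv left.map_mult right.map_mult)
qed

lemma tensor_one: "(1 :: 'a fps) \<otimes>\<^sub>\<xi> (1 :: 'a::complex_algebra_1 fps) = 1"
  by (simp add: fps_tensor_conv left.map_one right.map_one)

lemma tensor_add_left: "(u + u') \<otimes>\<^sub>\<xi> v = u \<otimes>\<^sub>\<xi> v + u' \<otimes>\<^sub>\<xi> v"
  and tensor_add_right: "u \<otimes>\<^sub>\<xi> (v + v') = u \<otimes>\<^sub>\<xi> v + u \<otimes>\<^sub>\<xi> v'"
  and tensor_diff_left: "(u - u') \<otimes>\<^sub>\<xi> v = u \<otimes>\<^sub>\<xi> v - u' \<otimes>\<^sub>\<xi> v"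
  and tensor_diff_right: "u \<otimes>\<^sub>\<xi> (v - v') = u \<otimes>\<^sub>\<xi> v - u \<otimes>\<^sub>\<xi> v'"
  and tensor_sum_left: "sum g A \<otimes>\<^sub>\<xi> v = (\<Sum>i\<in>A. g i \<otimes>\<^sub>\<xi> v)"
  and tensor_sum_right: "u \<otimes>\<^sub>\<xi> sum g A = (\<Sum>i\<in>A. u \<otimes>\<^sub>\<xi> g i)"
  for u u' v v' :: "'a::complex_algebra_1 fps" and g :: "'i \<Rightarrow> 'a fps"
  by (simp_all add: fps_tensor_conv left.map_add right.map_add left.map_diff right.map_diff
      left.map_sum right.map_sum distrib_left distrib_right left_diff_distrib right_diff_distrib
      sum_distrib_left sum_distrib_right)

lemma fps_map_scale: "complex_alg_hom \<phi> \<Longrightarrow> fps_map \<phi> (fps_scale k u) = fps_scale k (fps_map \<phi> u)"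
  using coefficient_hom.map_mult[of \<phi> "fps_scalar k" u] fps_map_scalar[of \<phi> k]
  by (simp add: fps_scale_conv coefficient_hom_def)

lemma tensor_scale_left: "fps_scale k u \<otimes>\<^sub>\<xi> v = fps_scale k (u \<otimes>\<^sub>\<xi> v)"
  and tensor_scale_right: "u \<otimes>\<^sub>\<xi> fps_scale k v = fps_scale k (u \<otimes>\<^sub>\<xi> v)"
  for u v :: "'a::complex_algebra_1 fps"
  by (simp_all add: fps_tensor_conv fps_map_scale alg_hom_left alg_hom_right fps_scale_mult_left fps_scale_mult_right)

lemma tensor_zero: "(0 :: 'a fps) \<otimes>\<^sub>\<xi> v = 0" "u \<otimes>\<^sub>\<xi> (0 :: 'a fps) = 0" for u v :: "'a::complex_algebra_1 fps"
  by (simp_all add: fps_tensor_conv left.map_zero right.map_zero)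

lemma tensor_minus_right: "u \<otimes>\<^sub>\<xi> (- v) = - (u \<otimes>\<^sub>\<xi> v)" for u v :: "'a::complex_algebra_1 fps"
  using tensor_diff_right[of u 0 v] by (simp add: tensor_zero)

lemma tensor_of_zero: "u \<otimes>\<^sub>t 0 = 0" "0 \<otimes>\<^sub>t u = 0"
  using tensor_of_scaleC_right[of u 0 0] tensor_of_scaleC_left[of 0 0 u] by simp_all

lemma tensor_nth_0: "fps_nth (u \<otimes>\<^sub>\<xi> v) 0 = fps_nth u 0 \<otimes>\<^sub>t fps_nth v 0"
  by (simp add: fps_tensor_def)

lemma tensor_commutator_left: "v * v' = v' * v \<Longrightarrow>
    commutator (u \<otimes>\<^sub>\<xi> v) (u' \<otimes>\<^sub>\<xi> v') = commutator u u' \<otimes>\<^sub>\<xi> (v * v')"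
  and tensor_commutator_right: "u * u' = u' * u \<Longrightarrow>
    commutator (u \<otimes>\<^sub>\<xi> v) (u' \<otimes>\<^sub>\<xi> v') = (u * u') \<otimes>\<^sub>\<xi> commutator v v'"
  for u v u' v' :: "'a::complex_algebra_1 fps"
  by (simp_all add: commutator_def tensor_mult tensor_diff_left tensor_diff_right)

abbreviation coprod :: "'g::complex_lie_algebra uea fps \<Rightarrow> ('g uea, 'g uea) tensor fps"
  where "coprod \<equiv> fps_map coproduct"

lemma coprod_hat: "coprod (hat x) = hat x \<otimes>\<^sub>\<xi> 1 + 1 \<otimes>\<^sub>\<xi> hat x"
  by (simp add: fps_eq_iff fps_tensor_one coproduct_inj)

lemma coprod_emb: "coprod (emb x) = emb x \<otimes>\<^sub>\<xi> 1 + 1 \<otimes>\<^sub>\<xi> emb x"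
  by (simp add: fps_tensor_one coproduct.map_const left.map_const right.map_const coproduct_inj)

lemma coprod_scale: "coprod (fps_scale k u) = fps_scale k (coprod u)"
  by (rule fps_map_scale[OF coproduct_hom])

text \<open>Expresses F u F^-1 = v without an inverse.\<close>

definition conjugates :: "'a::ring_1 \<Rightarrow> 'a \<Rightarrow> 'a \<Rightarrow> bool"
  where "conjugates F u v \<longleftrightarrow> F * u = v * F"

lemma conjugates_add: "conjugates F u v \<Longrightarrow> conjugates F u' v' \<Longrightarrow> conjugates F (u + u') (v + v')"
  by (simp add: conjugates_def distrib_left distrib_right)

lemma conjugates_mult:
  assumes "conjugates F u v" "conjugates F u' v'" shows "conjugates F (u * u') (v * v')"
proof -
  have "F * (u * u') = v * (F * u')" using assms(1) by (simp add: conjugates_def flip: mult.assoc)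
  then show ?thesis using assms(2) by (simp add: conjugates_def mult.assoc)
qed

lemma conjugates_sum: "(\<And>i. i \<in> A \<Longrightarrow> conjugates F (g i) (k i)) \<Longrightarrow> conjugates F (sum g A) (sum k A)"
  by (simp add: conjugates_def sum_distrib_left sum_distrib_right)

lemma conjugates_scale: "conjugates F u v \<Longrightarrow> conjugates F (fps_scale k u) (fps_scale k v)"
  for F :: "'a::complex_algebra_1 fps"
  by (simp add: conjugates_def fps_scale_mult_left fps_scale_mult_right)

lemma conjugates_compose:
  assumes "conjugates F u v" "conjugates F' v w" shows "conjugates (F' * F) u w"
proof -
  have "F' * (F * u) = F' * v * F" using assms(1) by (simp add: conjugates_def mult.assoc)
  also have "F' * v = w * F'" using assms(2) by (simp add: conjugates_def)
  finally show ?thesis by (simp add: conjugates_def mult.assoc)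
qed

lemma conjugates_inverse:
  assumes "conjugates F u v" "u * u' = 1" "v' * v = 1" shows "conjugates F u' v'"
proof -
  have "F * u' = v' * v * F * u'" by (simp add: assms(3))
  also have "\<dots> = v' * (F * u) * u'" using assms(1) by (simp add: conjugates_def mult.assoc)
  also have "\<dots> = v' * F" by (simp add: mult.assoc assms(2))
  finally show ?thesis by (simp add: conjugates_def)
qed

lemma conjugates_exp_one_step:
  assumes "fps_nth t 0 = 0" "commutator t u = w" "commutator t w = 0"
  shows "conjugates (formal_exp t) u (u + w)"
  unfolding conjugates_def using assms
  by (intro formal_exp_one_step) (auto simp: commutator_def algebra_simps)

lemma conjugates_exp_two_step:
  assumes "fps_nth t 0 = 0" "commutator t u = w" "commutator t w = y" "commutator t y = 0"
  shows "conjugates (formal_exp t) u (u + w + fps_scale (fps_const (1 / 2)) y)"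
  unfolding conjugates_def fps_scale_conv using assms
  by (intro formal_exp_two_step) (auto simp: commutator_def algebra_simps)

context heisenberg
begin

abbreviation "p \<equiv> root_exp (1 / 2) z"
abbreviation "s \<equiv> root_exp (- (1 / 2)) z"

lemma root_exp_products:
  "s * q = p" "q * s = p" "p * q1 = s" "q1 * p = s" "s * s = q1" "p * p = q" "s * p = 1" "p * s = 1" "q1 * q = 1" "q * q1 = 1"
  by (simp_all add: root_exp_mult root_exp_0)

lemma sigma_nth_0: "fps_nth (sigma z) 0 = 0"
  by (simp add: sigma_eval_at fps_eval_at_def)

lemma sigma_commute:
  assumes "\<And>n. uea_inj z * fps_nth y n = fps_nth y n * uea_inj z"
  shows "sigma z * y = y * sigma z"
  unfolding sigma_eval_at by (rule fps_eval_at_map_commute[OF assms])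

definition "cartan_twist = formal_exp (emb H \<otimes>\<^sub>\<xi> sigma z)"

lemma cartan_twist_commute:
  assumes "emb H * u = u * emb H" "\<And>n. uea_inj z * fps_nth v n = fps_nth v n * uea_inj z"
  shows "conjugates cartan_twist (u \<otimes>\<^sub>\<xi> v) (u \<otimes>\<^sub>\<xi> v)"
  unfolding conjugates_def cartan_twist_def
  by (rule formal_exp_commute)
    (simp_all add: tensor_mult assms(1) sigma_commute[OF assms(2)] tensor_nth_0 sigma_nth_0 tensor_of_zero)

text \<open>Moving H \<otimes> \<sigma> past u \<otimes> 1 adds r (1 \<otimes> \<sigma>). The two
  summands commute, and the added one exponentiates to 1 \<otimes> (1 + \<xi> z)^r.\<close>

lemma cartan_twist_eigenvector:
  assumes u: "lie H u = r *\<^sub>C u"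
  shows "conjugates cartan_twist (emb u \<otimes>\<^sub>\<xi> 1) (emb u \<otimes>\<^sub>\<xi> root_exp r z)"
proof -
  let ?x = "emb H \<otimes>\<^sub>\<xi> sigma z" and ?y = "(1 :: 'g uea fps) \<otimes>\<^sub>\<xi> fps_scale (fps_const r) (sigma z)"
  have 0: "fps_nth ?x 0 = 0" "fps_nth ?y 0 = 0"
    by (simp_all add: tensor_nth_0 sigma_nth_0 fps_scale_const_nth tensor_of_zero)
  have "emb H * emb u = emb u * emb H + fps_scale (fps_const r) (emb u)"
    using emb_mult[of H u] by (simp add: u uea_inj_scaleC fps_eq_iff fps_scale_const_nth)
  then have "?x * (emb u \<otimes>\<^sub>\<xi> 1) = (emb u \<otimes>\<^sub>\<xi> 1) * (?x + ?y)"
    by (simp add: tensor_mult distrib_left tensor_add_left tensor_scale_left tensor_scale_right fps_scale_mult_right)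
  then have "formal_exp ?x * (emb u \<otimes>\<^sub>\<xi> 1) = (emb u \<otimes>\<^sub>\<xi> 1) * formal_exp (?y + ?x)"
    unfolding formal_exp_def by (intro fps_subst_mult_commute) (simp_all add: add.commute 0)
  also have "formal_exp (?y + ?x) = formal_exp ?y * formal_exp ?x"
    by (rule formal_exp_add)
      (simp_all add: 0 tensor_mult fps_scale_mult_left fps_scale_mult_right)
  also have "formal_exp ?y = 1 \<otimes>\<^sub>\<xi> root_exp r z"
    unfolding fps_tensor_one formal_exp_sigma[symmetric] formal_exp_def by (simp add: right.map_subst)
  finally show ?thesis
    by (simp add: conjugates_def cartan_twist_def tensor_mult flip: mult.assoc)
qed

text \<open>The factors over \<pi>' commute, so their product in any order is the exponential of
  this sum (\<open>extended_twist_eq\<close>).\<close>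

definition "twist_exponent = (\<Sum>k\<in>I. fps_scale fps_X (e' k \<otimes>\<^sub>\<xi> (f' k * s)))"

abbreviation "extension_twist \<equiv> formal_exp twist_exponent"

lemma twist_exponent_nth_0: "fps_nth twist_exponent 0 = 0"
  by (simp add: twist_exponent_def fps_sum_nth fps_scale_X)

lemma twist_exponent_commutator:
  "commutator twist_exponent u = fps_scale fps_X (\<Sum>k\<in>I. commutator (e' k \<otimes>\<^sub>\<xi> (f' k * s)) u)"
  unfolding twist_exponent_def
  by (simp add: commutator_sum_left commutator_scale_left fsm.scale_sum_right)

lemma twist_exponent_commutator_0:
  "(\<And>k. k \<in> I \<Longrightarrow> commutator (e' k \<otimes>\<^sub>\<xi> (f' k * s)) u = 0) \<Longrightarrow> commutator twist_exponent u = 0"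
  unfolding twist_exponent_commutator by simp

lemma twist_exponent_commutator_delta:
  assumes "i \<in> I" "\<And>k. k \<in> I \<Longrightarrow> commutator (e' k \<otimes>\<^sub>\<xi> (f' k * s)) u = (if k = i then w else 0)"
  shows "commutator twist_exponent u = fps_scale fps_X w"
  unfolding twist_exponent_commutator using fin assms by (simp cong: sum.cong)

lemma commute_basis:
  "i \<in> I \<Longrightarrow> j \<in> I \<Longrightarrow> e' i * e' j = e' j * e' i" "i \<in> I \<Longrightarrow> j \<in> I \<Longrightarrow> f' i * f' j = f' j * f' i"
  using commutator_basis(1,2)[of i j] by (simp_all add: commutator_def)

lemma commute_left:
  "i \<in> I \<Longrightarrow> j \<in> I \<Longrightarrow> e' i * (e' j * u) = e' j * (e' i * u)"
  "i \<in> I \<Longrightarrow> j \<in> I \<Longrightarrow> f' i * (f' j * u) = f' j * (f' i * u)"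
  "i \<in> I \<Longrightarrow> z' * (e' i * u) = e' i * (z' * u)" "i \<in> I \<Longrightarrow> z' * (f' i * u) = f' i * (z' * u)"
  "i \<in> I \<Longrightarrow> root_exp r z * (e' i * u) = e' i * (root_exp r z * u)"
  "i \<in> I \<Longrightarrow> root_exp r z * (f' i * u) = f' i * (root_exp r z * u)"
  "root_exp r z * (z' * u) = z' * (root_exp r z * u)"
  by (simp_all add: commute_basis z_central root_exp_central flip: mult.assoc)

lemmas normal_order = mult.assoc z_central root_exp_central commute_left root_exp_mult

lemma commutator_fs:
  assumes "i \<in> I" "j \<in> I"
  shows "commutator (f' i * s) (f' j) = 0" "commutator (f' i * s) (f' j * root_exp r z) = 0"
    "commutator (f' i * s) (e' j) = (if i = j then - (z' * s) else 0)"
    "commutator (f' i * s) (e' j * s) = (if i = j then - (z' * q1) else 0)"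
    "commutator (f' i * s) (root_exp r z) = 0" "commutator (f' i * s) (z' * root_exp r z) = 0"
    "commutator (e' i) (z' * root_exp r z) = 0"
  using assms
  by (simp_all add: commutator_mult_left commutator_mult_right commutator_basis commutator_q mult.assoc root_exp_mult)
    (simp_all add: commutator_def normal_order)

lemma q_z: "q = 1 + fps_scale fps_X z'"
  by (simp add: root_exp_1 fps_scale_X)

text \<open>The Cartan factor gives e \<otimes> p + 1 \<otimes> e, whose commutator with the
  exponent is -\<xi> e \<otimes> z s. As p = s q = s + \<xi> z s, this lowers p to s.\<close>

lemma e_conjugate:
  assumes i: "i \<in> I"
  shows "conjugates (extension_twist * cartan_twist) (coprod (e' i)) (e' i \<otimes>\<^sub>\<xi> s + 1 \<otimes>\<^sub>\<xi> e' i)"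
proof (rule conjugates_compose)
  show "conjugates cartan_twist (coprod (e' i)) (e' i \<otimes>\<^sub>\<xi> p + 1 \<otimes>\<^sub>\<xi> e' i)"
    unfolding coprod_emb using He[OF i] uea_inj_lie[of z "e i"] ze[OF i]
    by (intro conjugates_add cartan_twist_eigenvector cartan_twist_commute) (auto simp: uea_inj_zero)
  let ?u = "e' i \<otimes>\<^sub>\<xi> p + 1 \<otimes>\<^sub>\<xi> e' i" and ?w = "fps_scale fps_X (- (e' i \<otimes>\<^sub>\<xi> (z' * s)))"
  have w: "commutator twist_exponent ?u = ?w"
  proof (rule twist_exponent_commutator_delta[OF i])
    fix k assume k: "k \<in> I"
    have "commutator (e' k \<otimes>\<^sub>\<xi> (f' k * s)) (e' i \<otimes>\<^sub>\<xi> p) = 0"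
      using k i by (subst tensor_commutator_right) (simp_all add: commute_basis commutator_fs tensor_zero)
    moreover have "commutator (e' k \<otimes>\<^sub>\<xi> (f' k * s)) (1 \<otimes>\<^sub>\<xi> e' i) = (if k = i then - (e' i \<otimes>\<^sub>\<xi> (z' * s)) else 0)"
      using k i by (subst tensor_commutator_right) (simp_all add: commutator_fs tensor_zero tensor_minus_right)
    ultimately show "commutator (e' k \<otimes>\<^sub>\<xi> (f' k * s)) ?u = (if k = i then - (e' i \<otimes>\<^sub>\<xi> (z' * s)) else 0)"
      by (simp add: commutator_add_right)
  qed
  have "commutator twist_exponent (e' i \<otimes>\<^sub>\<xi> (z' * s)) = 0"
    using i by (intro twist_exponent_commutator_0, subst tensor_commutator_right)
      (simp_all add: commute_basis commutator_fs tensor_zero)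
  then have w0: "commutator twist_exponent ?w = 0"
    unfolding commutator_scale_right by (simp add: commutator_def)
  have "conjugates extension_twist ?u (?u + ?w)"
    by (rule conjugates_exp_one_step[OF twist_exponent_nth_0 w w0])
  moreover have "p = s + fps_scale fps_X (z' * s)"
    unfolding root_exp_products(2)[symmetric] q_z by (simp add: distrib_right fps_scale_mult_left)
  then have "e' i \<otimes>\<^sub>\<xi> p + ?w = e' i \<otimes>\<^sub>\<xi> s"
    by (simp add: tensor_add_right tensor_scale_right)
  then have "?u + ?w = e' i \<otimes>\<^sub>\<xi> s + 1 \<otimes>\<^sub>\<xi> e' i" by (simp only: add.assoc add.commute add.left_commute)
  ultimately show "conjugates extension_twist ?u (e' i \<otimes>\<^sub>\<xi> s + 1 \<otimes>\<^sub>\<xi> e' i)" by metis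
qed

text \<open>The commutator of the exponent with f \<otimes> p is \<xi> z \<otimes> f because s p =
  1; added to 1 \<otimes> f it makes q \<otimes> f.\<close>

lemma f_conjugate:
  assumes i: "i \<in> I"
  shows "conjugates (extension_twist * cartan_twist) (coprod (f' i)) (f' i \<otimes>\<^sub>\<xi> p + q \<otimes>\<^sub>\<xi> f' i)"
proof (rule conjugates_compose)
  show "conjugates cartan_twist (coprod (f' i)) (f' i \<otimes>\<^sub>\<xi> p + 1 \<otimes>\<^sub>\<xi> f' i)"
    unfolding coprod_emb using Hf[OF i] uea_inj_lie[of z "f i"] zf[OF i]
    by (intro conjugates_add cartan_twist_eigenvector cartan_twist_commute) (auto simp: uea_inj_zero)
  let ?u = "f' i \<otimes>\<^sub>\<xi> p + 1 \<otimes>\<^sub>\<xi> f' i" and ?w = "fps_scale fps_X (z' \<otimes>\<^sub>\<xi> f' i)"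
  have w: "commutator twist_exponent ?u = ?w"
  proof (rule twist_exponent_commutator_delta[OF i])
    fix k assume k: "k \<in> I"
    have "commutator (e' k \<otimes>\<^sub>\<xi> (f' k * s)) (f' i \<otimes>\<^sub>\<xi> p) = (if k = i then z' \<otimes>\<^sub>\<xi> f' i else 0)"
      using k i by (subst tensor_commutator_left) (simp_all add: normal_order commutator_basis tensor_zero root_exp_0)
    moreover have "commutator (e' k \<otimes>\<^sub>\<xi> (f' k * s)) (1 \<otimes>\<^sub>\<xi> f' i) = 0"
      using k i by (subst tensor_commutator_right) (simp_all add: commutator_fs tensor_zero)
    ultimately show "commutator (e' k \<otimes>\<^sub>\<xi> (f' k * s)) ?u = (if k = i then z' \<otimes>\<^sub>\<xi> f' i else 0)"
      by (simp add: commutator_add_right)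
  qed
  have "commutator twist_exponent (z' \<otimes>\<^sub>\<xi> f' i) = 0"
    using i by (intro twist_exponent_commutator_0, subst tensor_commutator_right)
      (simp_all add: z_central commutator_fs tensor_zero)
  then have w0: "commutator twist_exponent ?w = 0"
    unfolding commutator_scale_right by simp
  have "conjugates extension_twist ?u (?u + ?w)"
    by (rule conjugates_exp_one_step[OF twist_exponent_nth_0 w w0])
  moreover have "?u + ?w = f' i \<otimes>\<^sub>\<xi> p + q \<otimes>\<^sub>\<xi> f' i"
    unfolding q_z by (simp add: tensor_add_left tensor_scale_left add.assoc)
  ultimately show "conjugates extension_twist ?u (f' i \<otimes>\<^sub>\<xi> p + q \<otimes>\<^sub>\<xi> f' i)" by metis
qed

text \<open>q = 1 + \<xi> z becomes group-like: z has H-eigenvalue 1, so the Cartan factor turns z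
  \<otimes> 1 into z \<otimes> q, and the extension factor commutes with q \<otimes> q.\<close>

lemma q_conjugate: "conjugates (extension_twist * cartan_twist) (coprod q) (q \<otimes>\<^sub>\<xi> q)"
proof (rule conjugates_compose)
  have coprod_q: "coprod q = 1 \<otimes>\<^sub>\<xi> 1 + fps_scale fps_X (z' \<otimes>\<^sub>\<xi> 1 + 1 \<otimes>\<^sub>\<xi> z')"
    unfolding q_z coproduct.map_add coprod_scale coprod_emb coproduct.map_one tensor_one ..
  have "q \<otimes>\<^sub>\<xi> q = (1 :: 'g uea fps) \<otimes>\<^sub>\<xi> q + fps_scale fps_X (z' \<otimes>\<^sub>\<xi> q)"
    by (subst (1) q_z) (simp add: tensor_add_left tensor_scale_left)
  also have "(1 :: 'g uea fps) \<otimes>\<^sub>\<xi> q = 1 \<otimes>\<^sub>\<xi> 1 + fps_scale fps_X (1 \<otimes>\<^sub>\<xi> z')"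
    unfolding q_z tensor_add_right tensor_scale_right ..
  finally have qq: "q \<otimes>\<^sub>\<xi> q = 1 \<otimes>\<^sub>\<xi> 1 + fps_scale fps_X (z' \<otimes>\<^sub>\<xi> q + 1 \<otimes>\<^sub>\<xi> z')"
    by (simp add: fsm.scale_right_distrib algebra_simps)
  show "conjugates cartan_twist (coprod q) (q \<otimes>\<^sub>\<xi> q)"
    unfolding coprod_q qq using Hz
    by (intro conjugates_add conjugates_scale cartan_twist_eigenvector cartan_twist_commute) auto
  have "commutator twist_exponent (q \<otimes>\<^sub>\<xi> q) = 0"
    by (intro twist_exponent_commutator_0, subst tensor_commutator_right)
      (simp_all add: root_exp_central commutator_fs tensor_zero)
  then show "conjugates extension_twist (q \<otimes>\<^sub>\<xi> q) (q \<otimes>\<^sub>\<xi> q)"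
    unfolding conjugates_def commutator_eq_0_iff by (rule formal_exp_commute[OF _ twist_exponent_nth_0])
qed

lemma q1_conjugate: "conjugates (extension_twist * cartan_twist) (coprod q1) (q1 \<otimes>\<^sub>\<xi> q1)"
proof (rule conjugates_inverse[OF q_conjugate])
  show "coprod q * coprod q1 = 1"
    by (simp only: q_inverse coproduct.map_one flip: coproduct.map_mult)
  show "(q1 \<otimes>\<^sub>\<xi> q1) * (q \<otimes>\<^sub>\<xi> q) = 1" by (simp add: tensor_mult q_inverse tensor_one)
qed

text \<open>Up to sign and powers of \<xi>, the \<open>W\<close> are the single and the
  \<open>Y\<close> the double commutators of the exponent with x \<otimes> 1 + 1 \<otimes> x,
  separated by the blocks \<open>c\<close> and \<open>b\<close>.\<close>

definition "WC x = (\<Sum>i\<in>I. \<Sum>j\<in>I. fps_scale (cc x i j) (f' i \<otimes>\<^sub>\<xi> (f' j * s)))"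
definition "WB x = (\<Sum>i\<in>I. \<Sum>j\<in>I. fps_scale (cb x i j) (e' i \<otimes>\<^sub>\<xi> (e' j * s)))"
definition "YC x = (\<Sum>i\<in>I. \<Sum>j\<in>I. fps_scale (cc x i j) (z' \<otimes>\<^sub>\<xi> (f' i * ft j)))"
definition "YB x = (\<Sum>i\<in>I. \<Sum>j\<in>I. fps_scale (cb x i j) ((e' i * e' j) \<otimes>\<^sub>\<xi> (z' * q1)))"

lemma double_sum_swap:
  assumes "\<And>i j. i \<in> I \<Longrightarrow> j \<in> I \<Longrightarrow> g i j = k j i"
  shows "(\<Sum>i\<in>I. \<Sum>j\<in>I. g i j) = (\<Sum>i\<in>I. \<Sum>j\<in>I. k i j)"
  by (subst sum.swap) (use assms in \<open>auto intro!: sum.cong\<close>)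

lemma commutator_hat_fs:
  assumes "acting x" "k \<in> I"
  shows "commutator (hat x) (f' k * s)
    = (\<Sum>j\<in>I. fps_scale (cb x j k) (e' j * s)) - (\<Sum>j\<in>I. fps_scale (ca x k j) (f' j * s))"
  using assms
  by (simp add: commutator_mult_right commutator_q hat_commutator_f left_diff_distrib sum_distrib_right fps_scale_mult_left)

text \<open>The contributions of block \<open>a\<close> from the two legs cancel. What remains is
  \<open>c\<close> from the left leg, acting on e, and \<open>b\<close> from the right leg, acting
  on f.\<close>

lemma twist_exponent_hat:
  assumes x: "acting x"
  shows "commutator twist_exponent (hat x \<otimes>\<^sub>\<xi> 1 + 1 \<otimes>\<^sub>\<xi> hat x) = - fps_scale fps_X (WC x + WB x)"
proof -
  let ?t = "\<lambda>k. e' k \<otimes>\<^sub>\<xi> (f' k * s)"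
  have "commutator (hat x \<otimes>\<^sub>\<xi> 1 + 1 \<otimes>\<^sub>\<xi> hat x) (?t k)
    = (\<Sum>j\<in>I. fps_scale (ca x j k) (e' j \<otimes>\<^sub>\<xi> (f' k * s))) + (\<Sum>j\<in>I. fps_scale (cc x j k) (f' j \<otimes>\<^sub>\<xi> (f' k * s)))
      + ((\<Sum>j\<in>I. fps_scale (cb x j k) (e' k \<otimes>\<^sub>\<xi> (e' j * s))) - (\<Sum>j\<in>I. fps_scale (ca x k j) (e' k \<otimes>\<^sub>\<xi> (f' j * s))))"
    if k: "k \<in> I" for k
  proof -
    have "commutator (hat x \<otimes>\<^sub>\<xi> 1) (?t k) = commutator (hat x) (e' k) \<otimes>\<^sub>\<xi> (f' k * s)"
      by (subst tensor_commutator_left) simp_all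
    moreover have "commutator (1 \<otimes>\<^sub>\<xi> hat x) (?t k) = e' k \<otimes>\<^sub>\<xi> commutator (hat x) (f' k * s)"
      by (subst tensor_commutator_right) simp_all
    ultimately show ?thesis
      unfolding commutator_add_left hat_commutator_e[OF x k] commutator_hat_fs[OF x k]
        tensor_add_left tensor_diff_right tensor_sum_left tensor_sum_right tensor_scale_left tensor_scale_right
      by simp
  qed
  then have "(\<Sum>k\<in>I. commutator (hat x \<otimes>\<^sub>\<xi> 1 + 1 \<otimes>\<^sub>\<xi> hat x) (?t k))
    = (\<Sum>k\<in>I. \<Sum>j\<in>I. fps_scale (ca x j k) (e' j \<otimes>\<^sub>\<xi> (f' k * s)))
      + (\<Sum>k\<in>I. \<Sum>j\<in>I. fps_scale (cc x j k) (f' j \<otimes>\<^sub>\<xi> (f' k * s)))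
      + ((\<Sum>k\<in>I. \<Sum>j\<in>I. fps_scale (cb x j k) (e' k \<otimes>\<^sub>\<xi> (e' j * s)))
         - (\<Sum>k\<in>I. \<Sum>j\<in>I. fps_scale (ca x k j) (e' k \<otimes>\<^sub>\<xi> (f' j * s))))"
    by (simp add: sum.distrib sum_subtractf)
  also have "(\<Sum>k\<in>I. \<Sum>j\<in>I. fps_scale (ca x j k) (e' j \<otimes>\<^sub>\<xi> (f' k * s)))
      = (\<Sum>k\<in>I. \<Sum>j\<in>I. fps_scale (ca x k j) (e' k \<otimes>\<^sub>\<xi> (f' j * s)))"
    by (rule double_sum_swap) simp
  also have "(\<Sum>k\<in>I. \<Sum>j\<in>I. fps_scale (cc x j k) (f' j \<otimes>\<^sub>\<xi> (f' k * s))) = WC x"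
    unfolding WC_def by (rule double_sum_swap) simp
  also have "(\<Sum>k\<in>I. \<Sum>j\<in>I. fps_scale (cb x j k) (e' k \<otimes>\<^sub>\<xi> (e' j * s))) = WB x"
    unfolding WB_def using x by (intro sum.cong refl) (simp add: cb_sym[of x])
  finally have "(\<Sum>k\<in>I. commutator (hat x \<otimes>\<^sub>\<xi> 1 + 1 \<otimes>\<^sub>\<xi> hat x) (?t k)) = WC x + WB x" by simp
  then show ?thesis
    unfolding twist_exponent_commutator commutator_anti[of "?t _"]
    by (simp add: sum_negf fsm.scale_right_distrib fsm.scale_right_diff_distrib)
qed

lemma twist_exponent_WC: "commutator twist_exponent (WC x) = fps_scale fps_X (YC x)"
proof -
  have "commutator twist_exponent (f' i \<otimes>\<^sub>\<xi> (f' j * s)) = fps_scale fps_X (z' \<otimes>\<^sub>\<xi> (f' i * ft j))"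
    if ij: "i \<in> I" "j \<in> I" for i j
  proof (rule twist_exponent_commutator_delta[OF ij(1)])
    fix k assume k: "k \<in> I"
    show "commutator (e' k \<otimes>\<^sub>\<xi> (f' k * s)) (f' i \<otimes>\<^sub>\<xi> (f' j * s)) = (if k = i then z' \<otimes>\<^sub>\<xi> (f' i * ft j) else 0)"
      using ij k by (subst tensor_commutator_left)
        (simp_all add: normal_order commutator_basis tensor_zero ft_def)
  qed
  then show ?thesis
    unfolding WC_def YC_def
    by (simp add: commutator_sum_right commutator_scale_right fsm.scale_sum_right mult.commute)
qed

lemma twist_exponent_WB: "commutator twist_exponent (WB x) = - fps_scale fps_X (YB x)"
proof -
  have "commutator twist_exponent (e' i \<otimes>\<^sub>\<xi> (e' j * s)) = fps_scale fps_X (- ((e' i * e' j) \<otimes>\<^sub>\<xi> (z' * q1)))"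
    if ij: "i \<in> I" "j \<in> I" for i j
  proof (rule twist_exponent_commutator_delta[OF ij(2)])
    fix k assume k: "k \<in> I"
    show "commutator (e' k \<otimes>\<^sub>\<xi> (f' k * s)) (e' i \<otimes>\<^sub>\<xi> (e' j * s)) = (if k = j then - ((e' i * e' j) \<otimes>\<^sub>\<xi> (z' * q1)) else 0)"
      using ij k by (subst tensor_commutator_right)
        (simp_all add: commute_basis commutator_fs tensor_zero tensor_minus_right)
  qed
  then show ?thesis
    unfolding WB_def YB_def
    by (simp add: commutator_sum_right commutator_scale_right fsm.scale_sum_right sum_negf mult.commute)
qed

lemma twist_exponent_Y: "commutator twist_exponent (YC x) = 0" "commutator twist_exponent (YB x) = 0"
proof -
  have "commutator twist_exponent (z' \<otimes>\<^sub>\<xi> (f' i * ft j)) = 0" if "i \<in> I" "j \<in> I" for i j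
    using that by (intro twist_exponent_commutator_0, subst tensor_commutator_right)
      (simp_all add: z_central commutator_fs commutator_mult_right tensor_zero ft_def)
  then show "commutator twist_exponent (YC x) = 0"
    by (simp add: YC_def commutator_sum_right commutator_scale_right)
  have "commutator twist_exponent ((e' i * e' j) \<otimes>\<^sub>\<xi> (z' * q1)) = 0" if "i \<in> I" "j \<in> I" for i j
    using that by (intro twist_exponent_commutator_0, subst tensor_commutator_right)
      (simp_all add: mult.assoc commute_basis commute_left commutator_fs tensor_zero)
  then show "commutator twist_exponent (YB x) = 0"
    by (simp add: YB_def commutator_sum_right commutator_scale_right)
qed

text \<open>The exponent commutes with \<open>YC\<close> and \<open>YB\<close>, so the exponential
  series ends after the double commutator. Its coefficient 1/2 appears as \<xi>/2 times
  \<xi>.\<close>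

lemma hat_conjugate:
  assumes x: "acting x"
  shows "conjugates (extension_twist * cartan_twist) (coprod (hat x))
    (hat x \<otimes>\<^sub>\<xi> 1 + 1 \<otimes>\<^sub>\<xi> hat x - fps_scale fps_X (WC x + WB x)
      - fps_scale (fps_const (1 / 2) * fps_X) (fps_scale fps_X (YC x - YB x)))"
proof (rule conjugates_compose)
  let ?u = "hat x \<otimes>\<^sub>\<xi> 1 + 1 \<otimes>\<^sub>\<xi> hat x"
  have "lie z (fps_nth x n) = 0" for n
    using x lie_anti[of z "fps_nth x n"] by (simp add: acts_def)
  then have "uea_inj z * uea_inj (fps_nth x n) = uea_inj (fps_nth x n) * uea_inj z" for n
    using uea_inj_lie[of z "fps_nth x n"] by (simp add: uea_inj_zero)
  then show "conjugates cartan_twist (coprod (hat x)) ?u"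
    unfolding coprod_hat using hat_H[OF x] by (intro conjugates_add cartan_twist_commute) auto
  let ?w = "- fps_scale fps_X (WC x + WB x)" and ?y = "- fps_scale fps_X (fps_scale fps_X (YC x - YB x))"
  have minus: "commutator twist_exponent (- v) = - commutator twist_exponent v" for v
    by (simp add: commutator_def)
  have y: "commutator twist_exponent ?w = ?y"
    unfolding minus commutator_scale_right commutator_add_right twist_exponent_WC twist_exponent_WB
    by (simp add: fsm.scale_right_diff_distrib fsm.scale_right_distrib)
  have diff: "commutator twist_exponent (v - w) = commutator twist_exponent v - commutator twist_exponent w" for v w
    by (simp add: commutator_def algebra_simps)
  have "commutator twist_exponent ?y = 0"
    unfolding minus commutator_scale_right diff twist_exponent_Y by simp
  from conjugates_exp_two_step[OF twist_exponent_nth_0 twist_exponent_hat[OF x] y this]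
  show "conjugates extension_twist ?u (?u - fps_scale fps_X (WC x + WB x)
      - fps_scale (fps_const (1 / 2) * fps_X) (fps_scale fps_X (YC x - YB x)))"
    by (simp add: fsm.scale_right_diff_distrib mult.assoc algebra_simps)
qed

text \<open>The factor q1 \<otimes> q1 turns the outer terms into f ft \<otimes> 1 and q \<otimes> f
  ft, where q = 1 + \<xi> z produces \<open>YC\<close>. The two cross terms agree by symmetry of
  block \<open>c\<close>.\<close>

lemma QC_conjugate:
  assumes x: "acting x"
  shows "conjugates (extension_twist * cartan_twist) (coprod (QC x))
    (QC x \<otimes>\<^sub>\<xi> 1 + 1 \<otimes>\<^sub>\<xi> QC x + (WC x + WC x) + fps_scale fps_X (YC x))"
proof -
  let ?\<Phi> = "\<lambda>i. f' i \<otimes>\<^sub>\<xi> p + q \<otimes>\<^sub>\<xi> f' i"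
  have "coprod (QC x) = (\<Sum>i\<in>I. \<Sum>j\<in>I. fps_scale (cc x i j) (coprod (f' i) * (coprod (f' j) * coprod q1)))"
    unfolding quad_def ft_def by (simp add: coproduct.map_sum coprod_scale coproduct.map_mult)
  then have conj: "conjugates (extension_twist * cartan_twist) (coprod (QC x))
     (\<Sum>i\<in>I. \<Sum>j\<in>I. fps_scale (cc x i j) (?\<Phi> i * (?\<Phi> j * (q1 \<otimes>\<^sub>\<xi> q1))))"
    by (simp only:) (intro conjugates_sum conjugates_scale conjugates_mult f_conjugate q1_conjugate)
  have "?\<Phi> i * (?\<Phi> j * (q1 \<otimes>\<^sub>\<xi> q1)) = (f' i * ft j) \<otimes>\<^sub>\<xi> 1 + 1 \<otimes>\<^sub>\<xi> (f' i * ft j)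
      + (f' i \<otimes>\<^sub>\<xi> (f' j * s) + f' j \<otimes>\<^sub>\<xi> (f' i * s)) + fps_scale fps_X (z' \<otimes>\<^sub>\<xi> (f' i * ft j))"
    if ij: "i \<in> I" "j \<in> I" for i j
  proof -
    have "?\<Phi> i * (?\<Phi> j * (q1 \<otimes>\<^sub>\<xi> q1)) = (f' i * ft j) \<otimes>\<^sub>\<xi> 1 + f' i \<otimes>\<^sub>\<xi> (f' j * s) + f' j \<otimes>\<^sub>\<xi> (f' i * s)
      + q \<otimes>\<^sub>\<xi> (f' i * ft j)"
      using ij by (simp add: distrib_left distrib_right tensor_mult ft_def mult.assoc root_exp_central
          commute_left root_exp_mult root_exp_0 add.assoc)
    then show ?thesis unfolding q_z tensor_add_left tensor_scale_left by (simp add: algebra_simps)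
  qed
  then have "(\<Sum>i\<in>I. \<Sum>j\<in>I. fps_scale (cc x i j) (?\<Phi> i * (?\<Phi> j * (q1 \<otimes>\<^sub>\<xi> q1))))
    = (\<Sum>i\<in>I. \<Sum>j\<in>I. fps_scale (cc x i j) ((f' i * ft j) \<otimes>\<^sub>\<xi> (1 :: 'g uea fps))) + (\<Sum>i\<in>I. \<Sum>j\<in>I. fps_scale (cc x i j) ((1 :: 'g uea fps) \<otimes>\<^sub>\<xi> (f' i * ft j)))
     + (WC x + (\<Sum>i\<in>I. \<Sum>j\<in>I. fps_scale (cc x i j) (f' j \<otimes>\<^sub>\<xi> (f' i * s)))) + fps_scale fps_X (YC x)"
    by (simp add: fsm.scale_right_distrib sum.distrib WC_def YC_def fsm.scale_sum_right mult.commute cong: sum.cong)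
  also have "(\<Sum>i\<in>I. \<Sum>j\<in>I. fps_scale (cc x i j) (f' j \<otimes>\<^sub>\<xi> (f' i * s))) = WC x"
    unfolding WC_def using x by (intro double_sum_swap) (simp add: cc_sym[of x])
  also have "(\<Sum>i\<in>I. \<Sum>j\<in>I. fps_scale (cc x i j) ((f' i * ft j) \<otimes>\<^sub>\<xi> (1 :: 'g uea fps))) = QC x \<otimes>\<^sub>\<xi> 1"
    by (simp add: quad_def tensor_sum_left tensor_scale_left)
  also have "(\<Sum>i\<in>I. \<Sum>j\<in>I. fps_scale (cc x i j) ((1 :: 'g uea fps) \<otimes>\<^sub>\<xi> (f' i * ft j))) = 1 \<otimes>\<^sub>\<xi> QC x"
    by (simp add: quad_def tensor_sum_right tensor_scale_right)
  finally show ?thesis using conj by simp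
qed

text \<open>The first outer term carries s s = q1 = 1 - \<xi> z q1, which produces
  \<open>YB\<close>. The two cross terms agree by symmetry of block \<open>b\<close>.\<close>

lemma QB_conjugate:
  assumes x: "acting x"
  shows "conjugates (extension_twist * cartan_twist) (coprod (QB x))
    (QB x \<otimes>\<^sub>\<xi> 1 + 1 \<otimes>\<^sub>\<xi> QB x + (WB x + WB x) - fps_scale fps_X (YB x))"
proof -
  let ?\<Phi> = "\<lambda>i. e' i \<otimes>\<^sub>\<xi> s + 1 \<otimes>\<^sub>\<xi> e' i"
  have "coprod (QB x) = (\<Sum>i\<in>I. \<Sum>j\<in>I. fps_scale (cb x i j) (coprod (e' i) * coprod (e' j)))"
    unfolding quad_def by (simp add: coproduct.map_sum coprod_scale coproduct.map_mult)
  then have conj: "conjugates (extension_twist * cartan_twist) (coprod (QB x))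
     (\<Sum>i\<in>I. \<Sum>j\<in>I. fps_scale (cb x i j) (?\<Phi> i * ?\<Phi> j))"
    by (simp only:) (intro conjugates_sum conjugates_scale conjugates_mult e_conjugate)
  have q1_z: "q1 = 1 - fps_scale fps_X (z' * q1)"
    using q_inverse(1) unfolding q_z by (simp add: distrib_right fps_scale_mult_left algebra_simps)
  have "?\<Phi> i * ?\<Phi> j = (e' i * e' j) \<otimes>\<^sub>\<xi> 1 + 1 \<otimes>\<^sub>\<xi> (e' i * e' j)
      + (e' i \<otimes>\<^sub>\<xi> (e' j * s) + e' j \<otimes>\<^sub>\<xi> (e' i * s)) - fps_scale fps_X ((e' i * e' j) \<otimes>\<^sub>\<xi> (z' * q1))"
    if ij: "i \<in> I" "j \<in> I" for i j
  proof -
    have "?\<Phi> i * ?\<Phi> j = (e' i * e' j) \<otimes>\<^sub>\<xi> q1 + e' i \<otimes>\<^sub>\<xi> (e' j * s) + e' j \<otimes>\<^sub>\<xi> (e' i * s) + 1 \<otimes>\<^sub>\<xi> (e' i * e' j)"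
      using ij by (simp add: distrib_left distrib_right tensor_mult root_exp_central root_exp_mult add.assoc)
    moreover have "(e' i * e' j) \<otimes>\<^sub>\<xi> q1 = (e' i * e' j) \<otimes>\<^sub>\<xi> 1 - fps_scale fps_X ((e' i * e' j) \<otimes>\<^sub>\<xi> (z' * q1))"
      by (subst q1_z) (simp only: tensor_diff_right tensor_scale_right)
    ultimately show ?thesis by (simp add: algebra_simps)
  qed
  then have "(\<Sum>i\<in>I. \<Sum>j\<in>I. fps_scale (cb x i j) (?\<Phi> i * ?\<Phi> j))
    = (\<Sum>i\<in>I. \<Sum>j\<in>I. fps_scale (cb x i j) ((e' i * e' j) \<otimes>\<^sub>\<xi> (1 :: 'g uea fps))) + (\<Sum>i\<in>I. \<Sum>j\<in>I. fps_scale (cb x i j) ((1 :: 'g uea fps) \<otimes>\<^sub>\<xi> (e' i * e' j)))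
     + (WB x + (\<Sum>i\<in>I. \<Sum>j\<in>I. fps_scale (cb x i j) (e' j \<otimes>\<^sub>\<xi> (e' i * s)))) - fps_scale fps_X (YB x)"
    by (simp add: fsm.scale_right_distrib fsm.scale_right_diff_distrib sum.distrib sum_subtractf WB_def YB_def
        fsm.scale_sum_right mult.commute cong: sum.cong)
  also have "(\<Sum>i\<in>I. \<Sum>j\<in>I. fps_scale (cb x i j) (e' j \<otimes>\<^sub>\<xi> (e' i * s))) = WB x"
    unfolding WB_def using x by (intro double_sum_swap) (simp add: cb_sym[of x])
  also have "(\<Sum>i\<in>I. \<Sum>j\<in>I. fps_scale (cb x i j) ((e' i * e' j) \<otimes>\<^sub>\<xi> (1 :: 'g uea fps))) = QB x \<otimes>\<^sub>\<xi> 1"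
    by (simp add: quad_def tensor_sum_left tensor_scale_left)
  also have "(\<Sum>i\<in>I. \<Sum>j\<in>I. fps_scale (cb x i j) ((1 :: 'g uea fps) \<otimes>\<^sub>\<xi> (e' i * e' j))) = 1 \<otimes>\<^sub>\<xi> QB x"
    by (simp add: quad_def tensor_sum_right tensor_scale_right)
  finally show ?thesis using conj by simp
qed

text \<open>Multiplied by \<xi>/2, the doubled cross terms 2 W cancel the single commutator and
  \<xi> (YC - YB) cancels the double one. This fixes the constant 1/2 in
  \<open>deformed\<close>.\<close>

theorem deformed_primitive:
  assumes x: "acting x"
  shows "conjugates (extension_twist * cartan_twist) (coprod (deformed x)) (deformed x \<otimes>\<^sub>\<xi> 1 + 1 \<otimes>\<^sub>\<xi> deformed x)"
proof -
  let ?hX = "fps_const (1 / 2) * fps_X :: complex fps"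
  have "coprod (deformed x) = coprod (hat x) + fps_scale ?hX (coprod (QC x) + coprod (QB x))"
    unfolding deformed_def coproduct.map_add coprod_scale ..
  moreover have "(hat x \<otimes>\<^sub>\<xi> 1 + 1 \<otimes>\<^sub>\<xi> hat x - fps_scale fps_X (WC x + WB x)
      - fps_scale ?hX (fps_scale fps_X (YC x - YB x)))
    + fps_scale ?hX ((QC x \<otimes>\<^sub>\<xi> 1 + 1 \<otimes>\<^sub>\<xi> QC x + (WC x + WC x) + fps_scale fps_X (YC x))
      + (QB x \<otimes>\<^sub>\<xi> 1 + 1 \<otimes>\<^sub>\<xi> QB x + (WB x + WB x) - fps_scale fps_X (YB x)))
    = deformed x \<otimes>\<^sub>\<xi> 1 + 1 \<otimes>\<^sub>\<xi> deformed x"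
  proof -
    have h: "fps_scale ?hX (v + v) = fps_scale fps_X v" for v :: "('g uea, 'g uea) tensor fps"
      using half_X[of v] by (simp only: fsm.scale_right_distrib fps_scale_X)
    show ?thesis
      unfolding deformed_def tensor_add_left tensor_add_right tensor_scale_left tensor_scale_right
      unfolding fsm.scale_right_distrib[of ?hX] fsm.scale_right_diff_distrib fsm.scale_right_distrib[of fps_X]
      using h[of "WC x"] h[of "WB x"]
      by (simp only: fsm.scale_right_distrib[of ?hX]) (simp add: algebra_simps)
  qed
  ultimately show ?thesis
    using conjugates_add[OF hat_conjugate[OF x] conjugates_scale[OF conjugates_add[OF QC_conjugate[OF x] QB_conjugate[OF x]]]]
    by metis
qed

end

section \<open>The primitive subalgebra\<close>

context heisenberg
begin

lemma extended_twist_eq: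
  assumes "distinct ps" "set ps = I"
  shows "prod_list (map (\<lambda>k. formal_exp (e' k \<otimes>\<^sub>\<xi> (fps_X * f' k *
      formal_exp (fps_scale (fps_const (- 1 / 2)) (sigma z))))) ps) = extension_twist"
proof -
  let ?t = "\<lambda>k. fps_scale fps_X (e' k \<otimes>\<^sub>\<xi> (f' k * s))"
  have "e' k \<otimes>\<^sub>\<xi> (fps_X * f' k * formal_exp (fps_scale (fps_const (- 1 / 2)) (sigma z))) = ?t k" for k
    unfolding formal_exp_sigma tensor_scale_right[symmetric] by (simp add: fps_scale_X mult.assoc)
  moreover have "prod_list (map (\<lambda>k. formal_exp (?t k)) ps) = formal_exp (sum_list (map ?t ps))"
  proof (rule prod_formal_exp)
    show "?t k * ?t l = ?t l * ?t k" if "k \<in> set ps" "l \<in> set ps" for k l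
      using that assms(2)
      by (simp add: fps_scale_mult_left fps_scale_mult_right tensor_mult normal_order commute_basis)
  qed (simp add: fps_scale_X)
  ultimately show ?thesis
    using assms by (simp add: twist_exponent_def sum_list_distinct_conv_sum_set)
qed

lemma twisted_coproduct_deformed:
  assumes "acting x"
  shows "twisted_coproduct (extension_twist * cartan_twist) (deformed x) = deformed x \<otimes>\<^sub>\<xi> 1 + 1 \<otimes>\<^sub>\<xi> deformed x"
proof -
  let ?F = "extension_twist * cartan_twist"
  have "fps_nth ?F 0 = 1" by (simp add: cartan_twist_def)
  then have "?F * ring_inverse ?F = 1" by (rule fps_ring_inverse)
  then show ?thesis
    using deformed_primitive[OF assms] by (simp add: twisted_coproduct_def conjugates_def mult.assoc)
qed

text \<open>After division by the lowest power of \<xi> in x the constant coefficient is given by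
  \<open>uea_inj\<close>, which is injective.\<close>

lemma deformed_eq_0:
  assumes centre: "\<And>v :: 'g. (\<And>w. lie v w = 0) \<Longrightarrow> v = 0" and "deformed x = 0"
  shows "x = 0"
proof (rule ccontr)
  assume "x \<noteq> 0"
  then obtain n where n: "fps_nth x n \<noteq> 0" "\<And>m. m < n \<Longrightarrow> fps_nth x m = 0"
    by (metis fps_nonzero_nth_minimal)
  define y where "y = Abs_fps (\<lambda>k. fps_nth x (k + n))"
  have shift: "fps_nth (fps_scale (fps_X ^ n) u) m = (if n \<le> m then fps_nth u (m - n) else 0)"
    for u :: "'v::complex_space fps" and m
  proof -
    have "fps_nth (fps_scale (fps_X ^ n) u) m = (\<Sum>i=0..m. if i = n then fps_nth u (m - n) else 0)"
      unfolding fps_scale_nth by (intro sum.cong) auto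
    then show ?thesis by simp
  qed
  have "x = fps_scale (fps_X ^ n) y"
    using n(2) by (auto simp: fps_eq_iff shift y_def)
  then have "fps_scale (fps_X ^ n) (deformed y) = 0" using assms(2) deformed_scale by metis
  then have "fps_nth (deformed y) 0 = 0" using shift[of "deformed y" n] by simp
  then have "uea_inj (fps_nth x n) = 0" by (simp add: deformed_nth_0 y_def)
  then show False using uea_inj_eq_0[OF centre] n(1) by blast
qed

end

context extremal_root
begin

lemma lie_H: "x \<in> root_space h \<alpha> \<Longrightarrow> lie H x = \<alpha> H *\<^sub>C x"
  using H by (simp add: root_spaceD)

lemma lie_one_eigenvector_zero:
  assumes "weight \<alpha>" "v \<in> root_space h \<alpha>" "lie H v = v" "\<alpha> \<noteq> \<theta>"
  shows "v = 0"
proof (rule ccontr)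
  assume "v \<noteq> 0"
  obtain k where k: "v = k *\<^sub>C E \<theta>" using eigenspace_one[OF assms(3)] .
  then have "v \<in> root_space h \<theta>" using E[OF \<theta>] cvs.subspace_scale[OF root_space_subspace] by blast
  then show False
    using root_space_unique[OF assms(1) weight_root[OF \<theta>] assms(2)] \<open>v \<noteq> 0\<close> assms(4) by blast
qed

text \<open>A bracket of two vectors with H-eigenvalue 1/2 has eigenvalue 1, so it vanishes unless
  its weight is \<theta>; within \<pi>' this happens only for the two members of a pair. A bracket
  with E \<theta> would have eigenvalue 3/2.\<close>

lemma heisenberg:
  assumes half: "\<And>\<mu>. \<mu> \<in> P \<Longrightarrow> lie H (E \<mu>) = (1 / 2) *\<^sub>C E \<mu>"
    "\<And>\<mu>. \<mu> \<in> P \<Longrightarrow> lie H (E (\<theta> - \<mu>)) = (1 / 2) *\<^sub>C E (\<theta> - \<mu>)"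
  shows "heisenberg P E (\<lambda>\<mu>. E (\<theta> - \<mu>)) (E \<theta>) H"
proof
  have pair: "lie (E \<alpha>) (E \<beta>) = 0"
    if "\<alpha> \<in> roots h" "\<beta> \<in> roots h" "lie H (E \<alpha>) = (1 / 2) *\<^sub>C E \<alpha>" "lie H (E \<beta>) = (1 / 2) *\<^sub>C E \<beta>" "\<alpha> + \<beta> \<noteq> \<theta>"
    for \<alpha> \<beta>
  proof (rule lie_one_eigenvector_zero[OF weight_add lie_root_space])
    have "lie H (lie (E \<alpha>) (E \<beta>)) = (1 / 2 + 1 / 2) *\<^sub>C lie (E \<alpha>) (E \<beta>)"
      unfolding lie_leibniz[of H] that(3,4) lie_scaleC_left lie_scaleC_right scaleC_add_left ..
    then show "lie H (lie (E \<alpha>) (E \<beta>)) = lie (E \<alpha>) (E \<beta>)" by simp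
  qed (use that E weight_root in auto)
  have top: "lie (E \<theta>) (E \<alpha>) = 0" if \<alpha>: "\<alpha> \<in> roots h" "lie H (E \<alpha>) = (1 / 2) *\<^sub>C E \<alpha>" for \<alpha>
  proof (rule ccontr)
    assume "lie (E \<theta>) (E \<alpha>) \<noteq> 0"
    then have "\<theta> + \<alpha> \<in> insert 0 (roots h)"
      using E \<theta> \<alpha>(1) by (intro weight_vector_cases[OF _ lie_root_space] weight_add weight_root) auto
    moreover have "\<alpha> H *\<^sub>C E \<alpha> = (1 / 2) *\<^sub>C E \<alpha>" using \<alpha> E[OF \<alpha>(1)] lie_H by metis
    then have "\<alpha> H = 1 / 2" using E[OF \<alpha>(1)] cvs.scale_right_imp_eq by blast
    then have H32: "(\<theta> + \<alpha>) H = 3 / 2" by (simp add: \<theta>_H)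
    then have "(\<theta> + \<alpha>) H \<noteq> 0" by (simp only:) simp
    ultimately have "\<theta> + \<alpha> \<in> roots h" by (intro nonzero_root)
    then show False using H32 no_root_three_halves by blast
  qed
  show "finite P" by (rule finite_subset[OF _ finite_roots]) (use P_roots(1) in blast)
  show "lie (E \<mu>) (E \<nu>) = 0" if "\<mu> \<in> P" "\<nu> \<in> P" for \<mu> \<nu>
  proof (rule pair)
    show "\<mu> + \<nu> \<noteq> \<theta>"
    proof
      assume "\<mu> + \<nu> = \<theta>"
      then have "\<nu> = \<theta> - \<mu>" by auto
      then show False using P_disjoint that by blast
    qed
  qed (use that P_roots half in auto)
  show "lie (E (\<theta> - \<mu>)) (E (\<theta> - \<nu>)) = 0" if "\<mu> \<in> P" "\<nu> \<in> P" for \<mu> \<nu>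
  proof (rule pair)
    show "\<theta> - \<mu> + (\<theta> - \<nu>) \<noteq> \<theta>"
    proof
      assume "\<theta> - \<mu> + (\<theta> - \<nu>) = \<theta>"
      then have "\<nu> = \<theta> - \<mu>" by (simp add: algebra_simps)
      then show False using P_disjoint that by blast
    qed
  qed (use that P_roots half in auto)
  show "lie (E \<mu>) (E (\<theta> - \<nu>)) = (if \<mu> = \<nu> then E \<theta> else 0)" if "\<mu> \<in> P" "\<nu> \<in> P" for \<mu> \<nu>
  proof (cases "\<mu> = \<nu>")
    case True
    then show ?thesis using E_pair that by simp
  next
    case False
    then have "\<mu> + (\<theta> - \<nu>) \<noteq> \<theta>" by (simp add: algebra_simps)
    then show ?thesis using False that P_roots half by (simp add: pair)
  qed
  show "lie (E \<theta>) (E \<mu>) = 0" "lie (E \<theta>) (E (\<theta> - \<mu>)) = 0" if "\<mu> \<in> P" for \<mu>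
    using top that P_roots half by auto
qed (use half H_E E \<theta> in auto)

text \<open>The acting elements form a Lie subalgebra, so root vectors suffice. A root \<alpha>
  orthogonal to \<theta> vanishes at H, so its vectors preserve the H-eigenspaces: the one for 1/2
  is \<open>V\<close>, and the one for 1 is a line in which there is no room for the weight \<theta>
  + \<alpha>.\<close>

lemma orthogonal_acts:
  assumes half: "\<And>\<mu>. \<mu> \<in> P \<Longrightarrow> lie H (E \<mu>) = (1 / 2) *\<^sub>C E \<mu>"
    "\<And>\<mu>. \<mu> \<in> P \<Longrightarrow> lie H (E (\<theta> - \<mu>)) = (1 / 2) *\<^sub>C E (\<theta> - \<mu>)"
    and x: "x \<in> orthogonal_subalgebra B h \<theta>"
  shows "heisenberg.acts P E (\<lambda>\<mu>. E (\<theta> - \<mu>)) (E \<theta>) H x"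
proof -
  interpret heis: heisenberg P E "\<lambda>\<mu>. E (\<theta> - \<mu>)" "E \<theta>" H by (rule heisenberg[OF half])
  have "lie_subalgebra scaleC lie {x. heis.acts x}"
    using heis.acts_subspace heis.acts_lie
    by (auto simp: lie_subalgebra_def cvs.subspace_def)
  moreover have "heis.acts x" if \<alpha>: "\<alpha> \<in> roots h" "root_inner B h \<alpha> \<theta> = 0" and x: "x \<in> root_space h \<alpha>" for \<alpha> x
  proof -
    have "\<alpha> (dual_element B h \<theta>) = 0"
      using \<alpha> dual_element_root(2)[OF \<alpha>(1) dual_element_root(1)[OF \<theta>]] by (simp add: root_inner_def)
    then have "\<alpha> H = 0" using H_dual weight_linear[OF \<alpha>(1) dual_element_root(1)[OF \<theta>]] by auto
    then have Hx: "lie H x = 0" using lie_H[OF x] by simp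
    then have xH: "lie x H = 0" by (subst lie_anti) simp
    have eig: "lie H (lie x v) = r *\<^sub>C lie x v" if "lie H v = r *\<^sub>C v" for v r
      unfolding lie_leibniz[of H] Hx that by (simp add: lie_scaleC_right)
    have "lie x (E \<theta>) = 0"
    proof (rule lie_one_eigenvector_zero[OF weight_add lie_root_space])
      show "lie H (lie x (E \<theta>)) = lie x (E \<theta>)" using eig[of "E \<theta>" 1] H_E by simp
      show "\<alpha> + \<theta> \<noteq> \<theta>" using \<alpha>(1) by (auto simp: roots_def)
    qed (use \<alpha> \<theta> weight_root x E in auto)
    then show ?thesis
      using xH eigenspace_half[OF eig[OF half(1)]] eigenspace_half[OF eig[OF half(2)]]
      by (auto simp: heis.acts_def)
  qed
  ultimately have "orthogonal_subalgebra B h \<theta> \<subseteq> {x. heis.acts x}"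
    unfolding orthogonal_subalgebra_def lie_generated_def by (intro Inter_lower) auto
  then show ?thesis using x by blast
qed

end

lemma lie_subalgebra_generated: "lie_subalgebra scale br (lie_generated scale br X)"
  unfolding lie_generated_def lie_subalgebra_def by blast

theorem mainTheorem6:
  fixes h :: "'g::complex_lie_algebra set"
    and B :: "'g \<Rightarrow> 'g \<Rightarrow> complex"
    and D P :: "('g \<Rightarrow> complex) set"
    and \<theta> :: "'g \<Rightarrow> complex"
    and ps :: "('g \<Rightarrow> complex) list"
    and E :: "('g \<Rightarrow> complex) \<Rightarrow> 'g"
    and H :: 'g
  assumes "classical_with_cartan h"
    and "invariant_form B"
    and "simple_roots h D"
    and "highest_root h D \<theta>"
    and "constituent_choice h \<theta> P"
    and "distinct ps" and "set ps = P"
    and "\<And>\<alpha>. \<alpha> \<in> roots h \<Longrightarrow> E \<alpha> \<in> root_space h \<alpha> \<and> E \<alpha> \<noteq> 0"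
    and "\<exists>c. H = c *\<^sub>C dual_element B h \<theta>"
    and "lie H (E \<theta>) = E \<theta>"
    and "\<And>\<mu>. \<mu> \<in> P \<Longrightarrow> lie H (E \<mu>) = (1 / 2) *\<^sub>C E \<mu>"
    and "\<And>\<mu>. \<mu> \<in> P \<Longrightarrow> lie H (E (\<theta> - \<mu>)) = (1 / 2) *\<^sub>C E (\<theta> - \<mu>)"
    and "\<And>\<mu>. \<mu> \<in> P \<Longrightarrow> lie (E \<mu>) (E (\<theta> - \<mu>)) = E \<theta>"
  shows "\<exists>(L :: 'g uea fps set) f.
    lie_subalgebra fps_scale commutator L \<and>
    lie_isomorphism fps_scale fps_lie (fps_over (orthogonal_subalgebra B h \<theta>))
      fps_scale commutator L f \<and>
    generates_uea_copy fps_scale fps_lie (fps_over (orthogonal_subalgebra B h \<theta>)) fps_scale f \<and>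
    (\<forall>X\<in>L. twisted_coproduct (extended_twist \<theta> ps E H) X = X \<otimes>\<^sub>\<xi> 1 + 1 \<otimes>\<^sub>\<xi> X)"
proof -
  obtain N e \<sigma> where "matrix_model h N e \<sigma>" by (rule classical_matrix_model[OF assms(1)])
  then interpret model: matrix_model h N e \<sigma> .
  interpret cartan_roots h B by (rule model.cartan_roots[OF assms(2)])
  interpret extremal_root h B D \<theta> E H P by unfold_locales (fact assms)+
  interpret heis: heisenberg P E "\<lambda>\<mu>. E (\<theta> - \<mu>)" "E \<theta>" H
    by (rule heisenberg) (fact assms)+
  let ?S = "orthogonal_subalgebra B h \<theta>" and ?f = heis.deformed
  let ?L = "?f ` fps_over ?S"
  have S: "lie_subalgebra scaleC lie ?S"
    unfolding orthogonal_subalgebra_def by (rule lie_subalgebra_generated)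
  note closed = fps_over_closed[OF S]
  have acting: "heis.acting x" if "x \<in> fps_over ?S" for x
    using that orthogonal_acts[OF assms(11,12)] by (auto simp: fps_over_def)
  have hom: "?f (fps_lie x y) = commutator (?f x) (?f y)" if "x \<in> fps_over ?S" "y \<in> fps_over ?S" for x y
    using acting that by (intro heis.deformed_lie) auto
  have zero: "?f 0 = 0" using heis.deformed_add[of 0 0] by simp
  have inj: "inj ?f"
  proof (rule injI)
    fix x y assume "?f x = ?f y"
    then have "?f (x - y) = 0" using heis.deformed_add[of "x - y" y] by simp
    then have "x - y = 0" by (rule heis.deformed_eq_0[OF centre_trivial, rotated])
    then show "x = y" by simp
  qed
  obtain C :: "'g set" where C: "finite C" "cvs.span C = UNIV" by (rule model.finite_dimensional)
  have twist: "extended_twist \<theta> ps E H = heis.extension_twist * heis.cartan_twist"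
    unfolding extended_twist_def heis.extended_twist_eq[OF assms(6,7)] heis.cartan_twist_def ..
  show ?thesis
  \<comment> \<open>The witnesses left open here are \<open>?L\<close> and \<open>?f\<close>, the
    image of \<open>deformed\<close> and \<open>deformed\<close> itself.\<close>
  proof (intro exI conjI)
    show "lie_subalgebra fps_scale commutator ?L"
      unfolding lie_subalgebra_def
    proof (intro conjI ballI allI)
      show "0 \<in> ?L" using closed(1) zero by (metis image_eqI)
      fix u v c assume "u \<in> ?L"
      then obtain x where x: "x \<in> fps_over ?S" "u = ?f x" by blast
      show "fps_scale c u \<in> ?L"
        unfolding x(2) heis.deformed_scale[symmetric] using closed(3)[OF x(1)] by blast
      assume "v \<in> ?L"
      then obtain y where y: "y \<in> fps_over ?S" "v = ?f y" by blast
      show "u + v \<in> ?L"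
        unfolding x(2) y(2) heis.deformed_add[symmetric] using closed(2)[OF x(1) y(1)] by blast
      show "commutator u v \<in> ?L"
        unfolding x(2) y(2) hom[OF x(1) y(1), symmetric] using closed(4)[OF x(1) y(1)] by blast
    qed
    show "lie_isomorphism fps_scale fps_lie (fps_over ?S) fps_scale commutator ?L ?f"
      unfolding lie_isomorphism_def bij_betw_def
      using inj_on_subset[OF inj subset_UNIV] hom by (simp add: heis.deformed_add heis.deformed_scale)
    show "generates_uea_copy fps_scale fps_lie (fps_over ?S) fps_scale ?f"
      by (rule deformed_uea_copy[OF _ S C(1)])
        (use C(2) hom centre_trivial in \<open>auto simp: heis.deformed_add heis.deformed_scale heis.deformed_nth_0\<close>)
    show "\<forall>X\<in>?L. twisted_coproduct (extended_twist \<theta> ps E H) X = X \<otimes>\<^sub>\<xi> 1 + 1 \<otimes>\<^sub>\<xi> X"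
      unfolding twist using acting heis.twisted_coproduct_deformed by blast
  qed
qed

end
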